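(* Let $s\in(0,1)$, $N>2s$, $\theta\in(-2s,+\infty)$, $p\ge\frac{N+\theta}{N-2s}$, let $h$ be a nonnegative function in $\mathbb{R}^N\setminus B_1$, and let $u_0$ be a nonnegative classical solution of $$(-\Delta)^s u=|x|^\theta u^{p}\ \text{ in } B_1\setminus\{0\},\qquad u=h\ \text{ in }\mathbb{R}^N\setminus B_1 .$$ Then $|x|^\theta u_0^p\in L^1(B_1,(1-|x|)^s\,dx)$, and there exists a uniform constant $c_5>0$, independent of $r$ and $u_0$, such that $$\int_{B_r}|x|^\theta u_0^p\,dx\le c_5\,r^{N-\frac{\theta+2sp}{p-1}}\qquad\text{for all } r\in\left(0,\tfrac12\right).$$
   Context: $B_r$ is the open ball of radius $r$ centered at $0$ in $\mathbb{R}^N$. The fractional Laplacian is $(-\Delta)^s u(x)=C_{N,s}\lim_{\epsilon\to0^+}\int_{\mathbb{R}^N\setminus B_\epsilon}\frac{u(x)-u(x+z)}{|z|^{N+2s}}\,dz$ with $C_{N,s}=2^{2s}\pi^{-N/2}s\frac{\Gamma(\frac{N+2s}{2})}{\Gamma(1-s)}$; it is well defined at $x$ if $u$ is $C^2$ near $x$ and $u\in L^1_s(\mathbb{R}^N)=L^1\left(\mathbb{R}^N,\frac{dx}{(1+|x|)^{N+2s}}\right)$. A classical solution is a function $u\in L^1_s(\mathbb{R}^N)$ regular enough in $B_1\setminus\{0\}$ for $(-\Delta)^su$ to be defined pointwise, satisfying the equation pointwise there. *)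

theory Defs
  imports "HOL-Analysis.Analysis"
begin

definition frac_laplacian_const :: "nat \<Rightarrow> real \<Rightarrow> real" where
  "frac_laplacian_const N s =
     2 powr (2 * s) * pi powr (- real N / 2) * s * Gamma ((real N + 2 * s) / 2) / Gamma (1 - s)"

text \<open>The value \<open>l\<close> of the fractional Laplacian of \<open>u\<close> at \<open>x\<close>, in the style of
  \<open>has_derivative\<close>: the assertion includes the existence of the principal value limit.\<close>

definition has_frac_laplacian ::
    "real \<Rightarrow> (real ^ 'n \<Rightarrow> real) \<Rightarrow> real ^ 'n \<Rightarrow> real \<Rightarrow> bool" where
  "has_frac_laplacian s u x l \<longleftrightarrow>
     ((\<lambda>\<epsilon>. frac_laplacian_const CARD('n) s *
            (LINT z : - ball 0 \<epsilon> | lebesgue.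
               (u x - u (x + z)) / norm z powr (real CARD('n) + 2 * s)))
        \<longlongrightarrow> l) (at_right 0)"

definition in_L1s :: "real \<Rightarrow> (real ^ 'n \<Rightarrow> real) \<Rightarrow> bool" where
  "in_L1s s u \<longleftrightarrow>
     integrable lebesgue (\<lambda>x. u x / (1 + norm x) powr (real CARD('n) + 2 * s))"

text \<open>Twice continuously differentiable on \<open>S\<close>; only meant for open \<open>S\<close>, since the
  derivatives are full derivatives.\<close>

definition C2_on :: "(real ^ 'n) set \<Rightarrow> (real ^ 'n \<Rightarrow> real) \<Rightarrow> bool" where
  "C2_on S u \<longleftrightarrow>
     (\<exists>(D :: real ^ 'n \<Rightarrow> ((real ^ 'n) \<Rightarrow>\<^sub>L real))
       (H :: real ^ 'n \<Rightarrow> ((real ^ 'n) \<Rightarrow>\<^sub>L ((real ^ 'n) \<Rightarrow>\<^sub>L real))).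
       (\<forall>x\<in>S. (u has_derivative blinfun_apply (D x)) (at x)) \<and>
       (\<forall>x\<in>S. (D has_derivative blinfun_apply (H x)) (at x)) \<and>
       continuous_on S H)"

text \<open>Classical solutions of \<open>(-\<Delta>)\<^sup>s u = |x|\<^sup>\<theta> u\<^sup>p\<close> in the punctured unit ball with
  \<open>u = h\<close> outside the unit ball. Together with \<open>u \<in> L\<^sup>1\<^sub>s\<close>, being \<open>C\<^sup>2\<close> is the regularity
  under which the fractional Laplacian is defined pointwise. The value \<open>u 0\<close> is
  unconstrained.\<close>

definition classical_solution ::
    "real \<Rightarrow> real \<Rightarrow> real \<Rightarrow> (real ^ 'n \<Rightarrow> real) \<Rightarrow> (real ^ 'n \<Rightarrow> real) \<Rightarrow> bool" where
  "classical_solution s \<theta> p h u \<longleftrightarrow>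
     in_L1s s u \<and>
     C2_on (ball 0 1 - {0}) u \<and>
     (\<forall>x \<in> ball 0 1 - {0}. has_frac_laplacian s u x (norm x powr \<theta> * u x powr p)) \<and>
     (\<forall>x \<in> - ball 0 1. u x = h x)"

end

(* The truncated operators are symmetric in L^2, so for a bounded test function psi with compact
   support in the punctured ball the integral of psi |x|^theta u^p is at most that of
   u (-Delta)^s psi. Where psi vanishes, (-Delta)^s psi <= 0, and there u >= 0; hence only an
   upper bound of (-Delta)^s psi on {psi > 0} matters and psi need not be smooth.

   The test functions are psi = (T(x/R) - Z(x/e))_+ with the torsion function
   T(x) = (1 - |x|^2)_+^s and a semiconcave plug Z equal to 1 on the unit ball. Since
   (-Delta)^s T is bounded above and -(-Delta)^s Z decays like |x|^{-N-2s} off the plug, on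
   {psi > 0} one has (-Delta)^s psi <= C (R^{-2s} + e^{-2s} (|x|/e)^{-N-2s}).

   Taking e = 1/8 and R -> 1 gives the weighted integrability, because T has the boundary behaviour
   (1 - |x|)^s. Taking psi^{p'} with p' = p/(p-1), Young's inequality absorbs u into
   |x|^theta u^p and leaves C (R^gamma + e^gamma) with gamma = N - (theta + 2sp)/(p-1) >= 0;
   then e -> 0. *)
theory Submission
  imports Defs
begin

section \<open>Averaging over dilations\<close>

text \<open>No test function is ever given a fractional Laplacian: every estimate concerns the
  operator truncated at some t > 0 and is uniform in t. The limit t -> 0 is taken only on the side
  of u, by dominated convergence. For the local bound, what depends on the particular solution
  (local second differences, norm in L^1_s) only justifies this limit and the finiteness of
  integrals, so the constant is independent of u.

  The delicate point is the bound for T, uniform up to the boundary of the ball. It is proved line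
  by line: on a line through x, T is up to scaling (1 + k t - t^2)_+^s, and k is unbounded as x
  approaches the boundary. The short and the long side of the chord then contribute large terms of
  opposite sign, which have to be cancelled exactly before anything is estimated.

  For p > 1 the lower bound on p says exactly that \<gamma> >= 0. In the critical case \<gamma> = 0
  the contribution of the plug does not vanish as e -> 0; it is enough that e^\<gamma> <= R^\<gamma>
  for e < R. The power p' is chosen since (p' - 1) p = p': convexity leaves the factor psi^(p'-1),
  whose p-th power is again the test function.\<close>

lemma nn_integral_lborel_scale:
  fixes H :: "'a::euclidean_space \<Rightarrow> ennreal"
  assumes [measurable]: "H \<in> borel_measurable borel" and c: "c \<noteq> 0"
  shows "(\<integral>\<^sup>+x. H x \<partial>lborel) = ennreal (\<bar>c\<bar> ^ DIM('a)) * (\<integral>\<^sup>+x. H (c *\<^sub>R x) \<partial>lborel)"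
proof -
  have "(\<integral>\<^sup>+x. H x \<partial>lborel) = (\<integral>\<^sup>+x. H x \<partial>(density (distr lborel borel (\<lambda>x. 0 + c *\<^sub>R x)) (\<lambda>_. \<bar>c\<bar>^DIM('a))))"
    using lborel_affine[OF c, of "0::'a"] by simp
  also have "\<dots> = (\<integral>\<^sup>+x. ennreal (\<bar>c\<bar>^DIM('a)) * H (c *\<^sub>R x) \<partial>lborel)"
    by (subst nn_integral_density) (auto simp: nn_integral_distr)
  finally show ?thesis by (simp add: nn_integral_cmult)
qed

lemma lborel_integral_scale:
  fixes H :: "'a::euclidean_space \<Rightarrow> real"
  assumes [measurable]: "H \<in> borel_measurable borel" and c: "c \<noteq> 0"
  shows "(\<integral>x. H x \<partial>lborel) = \<bar>c\<bar> ^ DIM('a) * (\<integral>x. H (c *\<^sub>R x) \<partial>lborel)"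
proof -
  have "(\<integral>x. H x \<partial>lborel) = (\<integral>x. H x \<partial>(density (distr lborel borel (\<lambda>x. 0 + c *\<^sub>R x)) (\<lambda>_. ennreal (\<bar>c\<bar>^DIM('a)))))"
    using lborel_affine[OF c, of "0::'a"] by simp
  also have "\<dots> = (\<integral>x. \<bar>c\<bar>^DIM('a) * H (c *\<^sub>R x) \<partial>lborel)"
    by (subst integral_density) (auto simp: integral_distr)
  finally show ?thesis by simp
qed

lemma lborel_integral_translate:
  fixes H :: "'a::euclidean_space \<Rightarrow> real"
  assumes [measurable]: "H \<in> borel_measurable borel"
  shows "(\<integral>x. H (a + x) \<partial>lborel) = (\<integral>x. H x \<partial>lborel)"
    and "integrable lborel (\<lambda>x. H (a + x)) \<longleftrightarrow> integrable lborel H"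
proof -
  have L: "lborel = distr lborel borel (\<lambda>x. a + x)"
    using lborel_affine[of 1 a] by (simp add: density_1)
  show "(\<integral>x. H (a + x) \<partial>lborel) = (\<integral>x. H x \<partial>lborel)"
    by (subst (2) L, subst integral_distr) auto
  show "integrable lborel (\<lambda>x. H (a + x)) \<longleftrightarrow> integrable lborel H"
    by (subst (2) L, subst integrable_distr_eq) auto
qed

lemma lborel_integral_reflect:
  fixes H :: "'a::euclidean_space \<Rightarrow> real"
  assumes [measurable]: "H \<in> borel_measurable borel"
  shows "(\<integral>x. H (- x) \<partial>lborel) = (\<integral>x. H x \<partial>lborel)"
    and "integrable lborel (\<lambda>x. H (- x)) \<longleftrightarrow> integrable lborel H"
proof -
  have L: "(lborel :: 'a measure) = distr lborel borel (\<lambda>x. - x)"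
    using lborel_affine[of "-1" "0::'a"] by (simp add: density_1)
  show "(\<integral>x. H (- x) \<partial>lborel) = (\<integral>x. H x \<partial>lborel)"
    by (subst (2) L, subst integral_distr) auto
  show "integrable lborel (\<lambda>x. H (- x)) \<longleftrightarrow> integrable lborel H"
    by (subst (2) L, subst integrable_distr_eq) auto
qed

text \<open>The condition says that r / l lies in [1, 2). As dl / l is invariant under dilations,
  the value cannot depend on r; it is the normalising factor of the average below.\<close>

lemma nn_integral_inverse_dyadic:
  assumes "0 < (r::real)"
  shows "(\<integral>\<^sup>+l. ennreal (if r / 2 < l \<and> l \<le> r then 1 / l else 0) \<partial>lborel) = ennreal (ln 2)"
proof -
  have "((\<lambda>l. 1 / l) has_integral (ln r - ln (r/2))) {r/2..r}"
    using assms by (intro fundamental_theorem_of_calculus)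
      (auto intro!: derivative_eq_intros simp flip: has_real_derivative_iff_has_vector_derivative)
  hence "((\<lambda>l. 1 / l) has_integral (ln 2)) {r/2..r}"
    using assms by (simp add: ln_div)
  from nn_integral_has_integral_lebesgue'[OF _ this] assms
  have "integral\<^sup>N lborel (\<lambda>x. ennreal (1/x) * indicator {r/2..r} x) = ennreal (ln 2)"
    by simp
  also have "integral\<^sup>N lborel (\<lambda>x. ennreal (1/x) * indicator {r/2..r} x) =
     (\<integral>\<^sup>+l. ennreal (if r / 2 < l \<and> l \<le> r then 1 / l else 0) \<partial>lborel)"
  proof (rule nn_integral_cong_AE)
    have "AE x in lborel. x \<noteq> r / 2" by (rule AE_lborel_singleton)
    thus "AE x in lborel. ennreal (1/x) * indicator {r/2..r} x
        = ennreal (if r / 2 < x \<and> x \<le> r then 1 / x else 0)"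
      by eventually_elim (auto simp: indicator_def)
  qed
  finally show ?thesis .
qed

text \<open>Averaging the dilation formula over all scales with respect to \<open>dl / l\<close> replaces polar
  coordinates: the sphere is traded for the annulus \<open>1 \<le> |z| < 2\<close>, at the price of
  the factor \<open>ln 2\<close>.\<close>

lemma nn_integral_dilation_average:
  fixes H :: "'a::euclidean_space \<Rightarrow> ennreal"
  assumes [measurable]: "H \<in> borel_measurable borel"
  shows "ennreal (ln 2) * (\<integral>\<^sup>+x. H x \<partial>lborel) =
    (\<integral>\<^sup>+z. (\<integral>\<^sup>+l. ennreal (if 1 \<le> norm z \<and> norm z < 2 \<and> 0 < l then l powr (real DIM('a) - 1) else 0)
        * H (l *\<^sub>R z) \<partial>lborel) \<partial>lborel)"
proof -
  have "ennreal (ln 2) * (\<integral>\<^sup>+x. H x \<partial>lborel) = (\<integral>\<^sup>+x. ennreal (ln 2) * H x \<partial>lborel)"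
    by (simp add: nn_integral_cmult)
  also have "\<dots> = (\<integral>\<^sup>+x. (\<integral>\<^sup>+l. ennreal (if norm x / 2 < l \<and> l \<le> norm x then 1 / l else 0) * H x \<partial>lborel) \<partial>lborel)"
  proof (rule nn_integral_cong_AE)
    have "AE x in lborel. (x::'a) \<noteq> 0" by (rule AE_lborel_singleton)
    thus "AE x in lborel. ennreal (ln 2) * H x =
        (\<integral>\<^sup>+l. ennreal (if norm x / 2 < l \<and> l \<le> norm x then 1 / l else 0) * H x \<partial>lborel)"
      by eventually_elim (simp add: nn_integral_multc nn_integral_inverse_dyadic del: divide_less_eq_numeral1)
  qed
  also have "\<dots> = (\<integral>\<^sup>+l. (\<integral>\<^sup>+x. ennreal (if norm x / 2 < l \<and> l \<le> norm x then 1 / l else 0) * H x \<partial>lborel) \<partial>lborel)"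
    by (rule lborel_pair.Fubini') measurable
  also have "\<dots> = (\<integral>\<^sup>+l. (\<integral>\<^sup>+z. ennreal (if 1 \<le> norm z \<and> norm z < 2 \<and> 0 < l then l powr (real DIM('a) - 1) else 0)
        * H (l *\<^sub>R z) \<partial>lborel) \<partial>lborel)"
  proof (rule nn_integral_cong)
    fix l :: real
    show "(\<integral>\<^sup>+x. ennreal (if norm x / 2 < l \<and> l \<le> norm x then 1 / l else 0) * H x \<partial>lborel) =
      (\<integral>\<^sup>+z. ennreal (if 1 \<le> norm z \<and> norm z < 2 \<and> 0 < l then l powr (real DIM('a) - 1) else 0)
        * H (l *\<^sub>R z) \<partial>lborel)"
    proof (cases "l > 0")
      case True
      have pw: "l ^ DIM('a) * (1 / l) = l powr (real DIM('a) - 1)"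
        using True by (simp add: powr_diff powr_realpow)
      have "(\<integral>\<^sup>+x. ennreal (if norm x / 2 < l \<and> l \<le> norm x then 1 / l else 0) * H x \<partial>lborel) =
        (\<integral>\<^sup>+x. ennreal (l ^ DIM('a)) * (ennreal (if norm (l *\<^sub>R x) / 2 < l \<and> l \<le> norm (l *\<^sub>R x) then 1 / l else 0) * H (l *\<^sub>R x)) \<partial>lborel)"
        using True by (subst nn_integral_lborel_scale[of _ l]) (simp_all add: nn_integral_cmult)
      also have "\<dots> = (\<integral>\<^sup>+z. ennreal (if 1 \<le> norm z \<and> norm z < 2 \<and> 0 < l then l powr (real DIM('a) - 1) else 0)
        * H (l *\<^sub>R z) \<partial>lborel)"
      proof (rule nn_integral_cong)
        fix x :: 'a
        have "norm (l *\<^sub>R x) / 2 < l \<longleftrightarrow> norm x < 2" "l \<le> norm (l *\<^sub>R x) \<longleftrightarrow> 1 \<le> norm x"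
          using True by (auto simp: field_simps)
        thus "ennreal (l ^ DIM('a)) * (ennreal (if norm (l *\<^sub>R x) / 2 < l \<and> l \<le> norm (l *\<^sub>R x) then 1 / l else 0) * H (l *\<^sub>R x))
          = ennreal (if 1 \<le> norm x \<and> norm x < 2 \<and> 0 < l then l powr (real DIM('a) - 1) else 0) * H (l *\<^sub>R x)"
          using True by (auto simp flip: pw simp: mult.assoc[symmetric] ennreal_mult[symmetric])
      qed
      finally show ?thesis .
    next
      case False
      hence "\<not> (norm x / 2 < l)" for x :: 'a by (smt (verit) norm_ge_zero field_sum_of_halves)
      thus ?thesis using False by simp
    qed
  qed
  also have "\<dots> = (\<integral>\<^sup>+z. (\<integral>\<^sup>+l. ennreal (if 1 \<le> norm z \<and> norm z < 2 \<and> 0 < l then l powr (real DIM('a) - 1) else 0)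
        * H (l *\<^sub>R z) \<partial>lborel) \<partial>lborel)"
    by (rule lborel_pair.Fubini') measurable
  finally show ?thesis .
qed

text \<open>Nonnegativity lets Tonelli deliver integrability on the product space before any signed
  integral is split.\<close>

lemma lborel_integral_dilation_average_nonneg:
  fixes H :: "'a::euclidean_space \<Rightarrow> real"
  assumes H: "integrable lborel H" and nonneg: "\<And>x. 0 \<le> H x"
  defines "F \<equiv> \<lambda>(z, l). (if 1 \<le> norm z \<and> norm z < 2 \<and> 0 < l then l powr (real DIM('a) - 1) else 0) * H (l *\<^sub>R z)"
  shows "integrable (lborel \<Otimes>\<^sub>M lborel) F" "(\<integral>x. F x \<partial>(lborel \<Otimes>\<^sub>M lborel)) = ln 2 * (\<integral>x. H x \<partial>lborel)"
proof -
  have [measurable]: "H \<in> borel_measurable borel" using H by auto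
  have [measurable]: "F \<in> borel_measurable (lborel \<Otimes>\<^sub>M lborel)"
    unfolding F_def by measurable
  have Fn: "F x \<ge> 0" for x using nonneg by (auto simp: F_def split: prod.splits)
  have "(\<integral>\<^sup>+x. ennreal (F x) \<partial>(lborel \<Otimes>\<^sub>M lborel)) =
    (\<integral>\<^sup>+z. \<integral>\<^sup>+l. ennreal (F (z, l)) \<partial>lborel \<partial>lborel)"
    by (rule lborel.nn_integral_fst[symmetric]) measurable
  also have "\<dots> = ennreal (ln 2) * (\<integral>\<^sup>+x. ennreal (H x) \<partial>lborel)"
    by (subst nn_integral_dilation_average) (auto simp: F_def ennreal_mult' nonneg intro!: nn_integral_cong)
  also have "\<dots> = ennreal (ln 2 * (\<integral>x. H x \<partial>lborel))"
    using H nonneg by (simp add: nn_integral_eq_integral ennreal_mult)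
  finally have eq: "(\<integral>\<^sup>+x. ennreal (F x) \<partial>(lborel \<Otimes>\<^sub>M lborel)) = ennreal (ln 2 * (\<integral>x. H x \<partial>lborel))" .
  show "integrable (lborel \<Otimes>\<^sub>M lborel) F"
    by (rule integrableI_nonneg) (use eq Fn in auto)
  show "(\<integral>x. F x \<partial>(lborel \<Otimes>\<^sub>M lborel)) = ln 2 * (\<integral>x. H x \<partial>lborel)"
    by (rule integral_eq_nn_integral[THEN trans]) (use eq Fn nonneg in \<open>auto simp: integral_nonneg_AE\<close>)
qed

lemma emeasure_lborel_shell_finite:
  "emeasure lborel {z::'a::euclidean_space. 1 \<le> norm z \<and> norm z < 2} < \<infinity>"
proof -
  have "emeasure lborel {z::'a. 1 \<le> norm z \<and> norm z < 2} \<le> emeasure lborel (ball (0::'a) 2)"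
    by (intro emeasure_mono) auto
  also have "\<dots> < \<infinity>" by (rule emeasure_lborel_ball_finite)
  finally show ?thesis .
qed

text \<open>Only the signed integral along each ray has to be bounded, so cancellation on the ray
  may be exploited. The signed case follows from the nonnegative one applied to the positive and
  negative parts.\<close>

lemma lborel_integral_le_radial:
  fixes H :: "'a::euclidean_space \<Rightarrow> real"
  assumes H: "integrable lborel H"
    and le: "\<And>z. 1 \<le> norm z \<Longrightarrow> norm z < 2 \<Longrightarrow>
      (\<integral>l. (if 0 < l then l powr (real DIM('a) - 1) else 0) * H (l *\<^sub>R z) \<partial>lborel) \<le> C"
  shows "(\<integral>x. H x \<partial>lborel) \<le> C * measure lborel {z::'a. 1 \<le> norm z \<and> norm z < 2} / ln 2"
proof -
  have [measurable]: "H \<in> borel_measurable borel" using H by auto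
  define F where "F G = (\<lambda>(z, l). (if 1 \<le> norm z \<and> norm z < 2 \<and> 0 < l then l powr (real DIM('a) - 1) else 0) * G (l *\<^sub>R z))"
    for G :: "'a \<Rightarrow> real"
  have P: "integrable lborel (\<lambda>x. max 0 (H x))" "integrable lborel (\<lambda>x. max 0 (- H x))"
    using H by auto
  have p: "integrable (lborel \<Otimes>\<^sub>M lborel) (F (\<lambda>x. max 0 (H x)))"
      "(\<integral>x. F (\<lambda>x. max 0 (H x)) x \<partial>(lborel \<Otimes>\<^sub>M lborel)) = ln 2 * (\<integral>x. max 0 (H x) \<partial>lborel)"
      "integrable (lborel \<Otimes>\<^sub>M lborel) (F (\<lambda>x. max 0 (- H x)))"
      "(\<integral>x. F (\<lambda>x. max 0 (- H x)) x \<partial>(lborel \<Otimes>\<^sub>M lborel)) = ln 2 * (\<integral>x. max 0 (- H x) \<partial>lborel)"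
    using lborel_integral_dilation_average_nonneg[OF P(1)] lborel_integral_dilation_average_nonneg[OF P(2)]
    by (simp_all add: F_def)
  have Feq: "F H = (\<lambda>x. F (\<lambda>x. max 0 (H x)) x - F (\<lambda>x. max 0 (- H x)) x)"
    by (auto simp: F_def fun_eq_iff max_def split: prod.splits)
  have FI: "integrable (lborel \<Otimes>\<^sub>M lborel) (F H)"
    unfolding Feq using p by auto
  have "ln 2 * (\<integral>x. H x \<partial>lborel) = ln 2 * (\<integral>x. max 0 (H x) - max 0 (- H x) \<partial>lborel)"
    by (intro arg_cong2[of _ _ _ _ "(*)"] Bochner_Integration.integral_cong) auto
  also have "\<dots> = ln 2 * (\<integral>x. max 0 (H x) \<partial>lborel) - ln 2 * (\<integral>x. max 0 (- H x) \<partial>lborel)"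
    using P by (simp add: right_diff_distrib)
  also have "\<dots> = (\<integral>x. F H x \<partial>(lborel \<Otimes>\<^sub>M lborel))"
    unfolding Feq using p by simp
  also have "\<dots> = (\<integral>z. (\<integral>l. F H (z, l) \<partial>lborel) \<partial>lborel)"
    using FI by (rule lborel_pair.integral_fst'[symmetric])
  also have "\<dots> \<le> (\<integral>z. C * indicator {z::'a. 1 \<le> norm z \<and> norm z < 2} z \<partial>lborel)"
  proof (rule integral_mono)
    show "integrable lborel (\<lambda>z. \<integral>l. F H (z, l) \<partial>lborel)"
      using FI by (rule lborel_pair.integrable_fst')
    show "integrable lborel (\<lambda>z. C * indicator {z::'a. 1 \<le> norm z \<and> norm z < 2} z)"
      using emeasure_lborel_shell_finite by (auto intro!: integrable_real_indicator)
    show "(\<integral>l. F H (z, l) \<partial>lborel) \<le> C * indicator {z::'a. 1 \<le> norm z \<and> norm z < 2} z" for z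
    proof (cases "1 \<le> norm z \<and> norm z < 2")
      case True
      thus ?thesis using le[of z] by (auto simp: F_def indicator_def)
    next
      case False
      hence "F H (z, l) = 0" for l by (auto simp: F_def)
      thus ?thesis using False by simp
    qed
  qed
  also have "\<dots> = C * measure lborel {z::'a. 1 \<le> norm z \<and> norm z < 2}" by simp
  finally show ?thesis by (simp add: field_simps)
qed

section \<open>Integrability of powers of the norm\<close>

lemma integrable_radial:
  fixes g :: "real \<Rightarrow> real"
  assumes [measurable]: "g \<in> borel_measurable borel" "G \<in> borel_measurable borel"
    and nonneg: "\<And>t. 0 \<le> g t"
    and G: "\<And>l c. 0 < l \<Longrightarrow> 1 \<le> c \<Longrightarrow> c < 2 \<Longrightarrow> l powr (real DIM('a) - 1) * g (l * c) \<le> G l"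
    and fin: "(\<integral>\<^sup>+l. ennreal (if 0 < l then G l else 0) \<partial>lborel) < \<infinity>"
  shows "integrable lborel (\<lambda>x::'a::euclidean_space. g (norm x))"
proof (rule integrableI_nonneg)
  let ?I = "\<integral>\<^sup>+l. ennreal (if 0 < l then G l else 0) \<partial>lborel"
  \<comment> \<open>The majorant G does not see c = |z|, so one number bounds the inner integral on
    the whole shell.\<close>
  have "ennreal (ln 2) * (\<integral>\<^sup>+x. ennreal (g (norm (x::'a))) \<partial>lborel) \<le>
    (\<integral>\<^sup>+z. ?I * indicator {z::'a. 1 \<le> norm z \<and> norm z < 2} z \<partial>lborel)"
  proof (subst nn_integral_dilation_average, simp, rule nn_integral_mono)
    fix z :: 'a
    show "(\<integral>\<^sup>+ l. ennreal (if 1 \<le> norm z \<and> norm z < 2 \<and> 0 < l then l powr (real DIM('a) - 1) else 0) *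
          ennreal (g (norm (l *\<^sub>R z))) \<partial>lborel)
         \<le> ?I * indicator {z. 1 \<le> norm z \<and> norm z < 2} z"
    proof (cases "1 \<le> norm z \<and> norm z < 2")
      case True
      show ?thesis using True nonneg G[of _ "norm z"]
        by (auto simp: ennreal_mult[symmetric] intro!: nn_integral_mono ennreal_leI)
    qed (auto simp: indicator_def)
  qed
  also have "\<dots> = ?I * emeasure lborel {z::'a. 1 \<le> norm z \<and> norm z < 2}"
    by (subst nn_integral_cmult_indicator) auto
  also have "\<dots> < \<infinity>" using fin emeasure_lborel_shell_finite by (auto simp: ennreal_mult_less_top)
  finally have "ennreal (ln 2) * (\<integral>\<^sup>+x. ennreal (g (norm (x::'a))) \<partial>lborel) < \<infinity>" .
  thus "(\<integral>\<^sup>+x. ennreal (g (norm (x::'a))) \<partial>lborel) < \<infinity>"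
    by (auto simp: ennreal_mult_less_top)
qed (use nonneg in auto)

lemma powr_le_two_powr_abs:
  fixes a c :: real
  assumes "1 \<le> c" "c < 2"
  shows "c powr a \<le> 2 powr \<bar>a\<bar>"
proof -
  have "c powr a \<le> c powr \<bar>a\<bar>" using assms by (intro powr_mono) auto
  also have "\<dots> \<le> 2 powr \<bar>a\<bar>" using assms by (intro powr_mono2) auto
  finally show ?thesis .
qed

lemma integrable_norm_powr_inside:
  assumes "a > - real DIM('a)"
  shows "integrable lborel (\<lambda>x::'a::euclidean_space. if norm x \<le> 1 then norm x powr a else 0)"
proof (rule integrable_radial[where g = "\<lambda>t. if t \<le> 1 then t powr a else 0"
      and G = "\<lambda>l. 2 powr \<bar>a\<bar> * (if l \<le> 1 then l powr (real DIM('a) - 1 + a) else 0)"])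
  fix l c :: real assume l: "0 < l" and c: "1 \<le> c" "c < 2"
  have "l \<le> 1" if "l * c \<le> 1"
    using that mult_left_mono[of 1 c l] l c by linarith
  moreover have "l powr (real DIM('a) - 1) * (l * c) powr a \<le> 2 powr \<bar>a\<bar> * l powr (real DIM('a) - 1 + a)"
    using powr_le_two_powr_abs[OF c, of a] l c by (simp add: powr_mult powr_add)
  ultimately show "l powr (real DIM('a) - 1) * (if l * c \<le> 1 then (l * c) powr a else 0)
     \<le> 2 powr \<bar>a\<bar> * (if l \<le> 1 then l powr (real DIM('a) - 1 + a) else 0)" by auto
next
  have "((\<lambda>l. l powr (real DIM('a) - 1 + a)) has_integral (1 powr (real DIM('a) + a) / (real DIM('a) + a))) {0..1}"
    using has_integral_powr_from_0[of "real DIM('a) - 1 + a" 1] assms by simp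
  from nn_integral_has_integral_lebesgue'[OF _ this]
  have *: "(\<integral>\<^sup>+l. ennreal (l powr (real DIM('a) - 1 + a)) * indicator {0..1} l \<partial>lborel) < \<infinity>" by simp
  have "(\<integral>\<^sup>+l. ennreal (if 0 < l then 2 powr \<bar>a\<bar> * (if l \<le> 1 then l powr (real DIM('a) - 1 + a) else 0) else 0) \<partial>lborel)
    \<le> (\<integral>\<^sup>+l. ennreal (2 powr \<bar>a\<bar>) * (ennreal (l powr (real DIM('a) - 1 + a)) * indicator {0..1} l) \<partial>lborel)"
    by (intro nn_integral_mono) (auto simp: indicator_def ennreal_mult)
  also have "\<dots> < \<infinity>" using * by (subst nn_integral_cmult) (auto simp: ennreal_mult_less_top)
  finally show "(\<integral>\<^sup>+l. ennreal (if 0 < l then 2 powr \<bar>a\<bar> * (if l \<le> 1 then l powr (real DIM('a) - 1 + a) else 0) else 0) \<partial>lborel) < \<infinity>" .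
qed auto

lemma integrable_norm_powr_outside:
  assumes "a < - real DIM('a)"
  shows "integrable lborel (\<lambda>x::'a::euclidean_space. if 1 \<le> norm x then norm x powr a else 0)"
proof (rule integrable_radial[where g = "\<lambda>t. if 1 \<le> t then t powr a else 0"
      and G = "\<lambda>l. 2 powr \<bar>a\<bar> * (if 1/2 \<le> l then l powr (real DIM('a) - 1 + a) else 0)"])
  fix l c :: real assume l: "0 < l" and c: "1 \<le> c" "c < 2"
  have "1/2 \<le> l" if "1 \<le> l * c"
  proof (rule ccontr)
    assume "\<not> 1/2 \<le> l"
    hence "l * c < 1/2 * 2" using l c by (intro mult_strict_mono) auto
    thus False using that by simp
  qed
  moreover have "l powr (real DIM('a) - 1) * (l * c) powr a \<le> 2 powr \<bar>a\<bar> * l powr (real DIM('a) - 1 + a)"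
    using powr_le_two_powr_abs[OF c, of a] l c by (simp add: powr_mult powr_add)
  ultimately show "l powr (real DIM('a) - 1) * (if 1 \<le> l * c then (l * c) powr a else 0)
     \<le> 2 powr \<bar>a\<bar> * (if 1/2 \<le> l then l powr (real DIM('a) - 1 + a) else 0)" by auto
next
  have "((\<lambda>l. l powr (real DIM('a) - 1 + a)) has_integral (- ((1/2) powr (real DIM('a) - 1 + a + 1)) / (real DIM('a) - 1 + a + 1))) {1/2..}"
    using has_integral_powr_to_inf[of "real DIM('a) - 1 + a" "1/2"] assms by simp
  from nn_integral_has_integral_lebesgue'[OF _ this]
  have *: "(\<integral>\<^sup>+l. ennreal (l powr (real DIM('a) - 1 + a)) * indicator {1/2..} l \<partial>lborel) < \<infinity>" by simp
  have "(\<integral>\<^sup>+l. ennreal (if 0 < l then 2 powr \<bar>a\<bar> * (if 1/2 \<le> l then l powr (real DIM('a) - 1 + a) else 0) else 0) \<partial>lborel)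
    \<le> (\<integral>\<^sup>+l. ennreal (2 powr \<bar>a\<bar>) * (ennreal (l powr (real DIM('a) - 1 + a)) * indicator {1/2..} l) \<partial>lborel)"
    by (intro nn_integral_mono) (auto simp: indicator_def ennreal_mult)
  also have "\<dots> < \<infinity>" using * by (subst nn_integral_cmult) (auto simp: ennreal_mult_less_top)
  finally show "(\<integral>\<^sup>+l. ennreal (if 0 < l then 2 powr \<bar>a\<bar> * (if 1/2 \<le> l then l powr (real DIM('a) - 1 + a) else 0) else 0) \<partial>lborel) < \<infinity>" .
qed auto

section \<open>The torsion function along a chord\<close>

text \<open>The torsion function on a line through an interior point, rescaled to be 1 at t = 0 and
  to have endpoints of product -1. The midpoint of the chord is k / 2: k = 0 for a central base
  point, |k| large for one close to an end.\<close>

definition chord :: "real \<Rightarrow> real \<Rightarrow> real \<Rightarrow> real" where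
  "chord s k t = max 0 (1 + k * t - t\<^sup>2) powr s"

lemma chord_minus: "chord s k (- t) = chord s (- k) t"
  by (simp add: chord_def)

lemma chord_nonneg: "0 \<le> chord s k t"
  by (simp add: chord_def)

lemma continuous_on_chord [continuous_intros]:
  assumes "0 < s" "continuous_on A f"
  shows "continuous_on A (\<lambda>t. chord s k (f t))"
  unfolding chord_def
  by (intro continuous_on_powr' continuous_intros assms) (use assms in auto)

lemma borel_measurable_chord [measurable]: "chord s k \<in> borel_measurable borel"
  unfolding chord_def by measurable

text \<open>Concavity of the power at 1, read off from Young's inequality with second factor
  1.\<close>

lemma powr_le_tangent:
  fixes x s :: real
  assumes "0 \<le> x" "0 < s" "s < 1"
  shows "x powr s \<le> 1 + s * (x - 1)"
proof (cases "x = 0")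
  case False
  have "x powr s * 1 powr (1 - s) \<le> s * x + (1 - s) * 1"
    by (rule Youngs_inequality_0) (use assms False in auto)
  thus ?thesis by (simp add: algebra_simps)
qed (use assms in auto)

text \<open>Along a chord of the ball the torsion function is, after normalisation, the function
  \<open>chord s k\<close> with \<open>1 + k t - t\<^sup>2 = (a - t) (b + t)\<close>. The Moebius involution
  \<open>t \<mapsto> - t / (1 + k t)\<close> fixes \<open>0\<close> and exchanges \<open>a\<close> and \<open>- b\<close>; it moves the integral over the
  left half of the chord to the right half, where the sum of both integrands is dominated by
  the derivative of an explicit function.\<close>

locale chord_roots =
  fixes s k a b :: real
  assumes s: "0 < s" "s < 1" and k: "0 \<le> k" and a: "0 < a" and b: "0 < b"
    and ab: "a * b = 1" and k_eq: "k = a - b"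
begin

lemma factor: "1 + k * t - t\<^sup>2 = (a - t) * (b + t)"
  using ab unfolding k_eq by (simp add: algebra_simps power2_eq_square)

lemma one_plus_k_a: "1 + k * a = a\<^sup>2"
  using ab unfolding k_eq by (simp add: algebra_simps power2_eq_square)

lemma chord_eq: "0 \<le> t \<Longrightarrow> t \<le> a \<Longrightarrow> chord s k t = (1 + k * t - t\<^sup>2) powr s"
  using a b unfolding chord_def factor by (simp add: max_def)

lemma pos: "0 \<le> t \<Longrightarrow> t < a \<Longrightarrow> 0 < 1 + k * t - t\<^sup>2"
  using a b unfolding factor by simp

lemma chord_zero: "a \<le> t \<Longrightarrow> chord s k t = 0"
proof -
  assume "a \<le> t"
  hence "(a - t) * (b + t) \<le> 0" using a b by (intro mult_nonpos_nonneg) auto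
  thus ?thesis using s by (simp add: chord_def factor)
qed

lemma chord_minus_zero: "b \<le> t \<Longrightarrow> chord s k (- t) = 0"
proof -
  assume "b \<le> t"
  hence "(a - (- t)) * (b + (- t)) \<le> 0" using a b by (intro mult_nonneg_nonpos) auto
  thus ?thesis using s unfolding chord_def factor by simp
qed

text \<open>Under v \<mapsto> - v / (1 + k v) the polynomial 1 + k v - v^2 pulls back to itself
  divided by (1 + k v)^2, so the left half is expressed through the same \<open>chord s k v\<close>
  as the right half. The cutoff is distorted: t on the right corresponds to t / (1 + k t) on the
  left.\<close>

lemma left_substitution:
  assumes t: "0 < t" "t < a"
  shows "((\<lambda>v. ((1 + k * v) powr (2 * s - 1) - chord s k v / (1 + k * v)) * v powr (-1 - 2 * s))
    has_integral (integral {t / (1 + k * t)..b} (\<lambda>v. (1 - chord s k (- v)) * v powr (-1 - 2 * s)))) {t..a}"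
proof -
  define g where "g v = v / (1 + k * v)" for v
  have ga: "g a = b"
    unfolding g_def one_plus_k_a using a ab by (simp add: field_simps power2_eq_square)
  have E: "1 + k * v > 0" if "v \<in> {t..a}" for v using that t k by (smt (verit) atLeastAtMost_iff mult_nonneg_nonneg)
  have mono: "g v \<le> g w" if "v \<in> {t..a}" "w \<in> {t..a}" "v \<le> w" for v w
    using E[OF that(1)] E[OF that(2)] that(3) by (simp add: g_def field_simps)
  have g0: "g t > 0" using t E[of t] by (simp add: g_def)
  have "((\<lambda>v. (1 / (1 + k * v)\<^sup>2) *\<^sub>R ((1 - chord s k (- g v)) * g v powr (-1 - 2 * s)))
    has_integral (integral {g t..g a} (\<lambda>v. (1 - chord s k (- v)) * v powr (-1 - 2 * s)))) {t..a}"
  proof (rule has_integral_substitution[where c = "g t" and d = "g a"])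
    show "g ` {t..a} \<subseteq> {g t..g a}" using mono t by auto
    show "continuous_on {g t..g a} (\<lambda>v. (1 - chord s k (- v)) * v powr (-1 - 2 * s))"
      using s g0 by (intro continuous_intros) auto
    fix v assume "v \<in> {t..a}"
    with E[OF this] show "(g has_real_derivative 1 / (1 + k * v)\<^sup>2) (at v within {t..a})"
      unfolding g_def by (auto intro!: derivative_eq_intros simp: power2_eq_square)
  qed (use mono t in auto)
  hence "((\<lambda>v. (1 / (1 + k * v)\<^sup>2) *\<^sub>R ((1 - chord s k (- g v)) * g v powr (-1 - 2 * s)))
    has_integral (integral {t / (1 + k * t)..b} (\<lambda>v. (1 - chord s k (- v)) * v powr (-1 - 2 * s)))) {t..a}"
    unfolding ga by (simp add: g_def)
  moreover have "(1 / (1 + k * v)\<^sup>2) *\<^sub>R ((1 - chord s k (- g v)) * g v powr (-1 - 2 * s)) =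
      ((1 + k * v) powr (2 * s - 1) - chord s k v / (1 + k * v)) * v powr (-1 - 2 * s)"
    if v: "v \<in> {t..a}" for v
  proof -
    define Ev where "Ev = 1 + k * v"
    have Ev: "Ev > 0" using E[OF v] by (simp add: Ev_def)
    have v0: "v > 0" using v t by auto
    have "1 + k * (- g v) - (- g v)\<^sup>2 = (1 + k * v - v\<^sup>2) / Ev\<^sup>2"
      using Ev unfolding g_def Ev_def[symmetric]
      by (simp add: field_simps power2_eq_square) (simp add: Ev_def algebra_simps)
    hence "chord s k (- g v) = (max 0 ((1 + k * v - v\<^sup>2) / Ev\<^sup>2)) powr s"
      unfolding chord_def by (simp only:)
    also have "max 0 ((1 + k * v - v\<^sup>2) / Ev\<^sup>2) = max 0 (1 + k * v - v\<^sup>2) / Ev\<^sup>2"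
      using Ev by (simp add: max_def divide_le_0_iff zero_le_divide_iff)
    also have "\<dots> powr s = chord s k v / Ev powr (2 * s)"
      using Ev by (simp add: powr_divide chord_def powr_powr flip: powr_numeral)
    finally have c: "chord s k (- g v) = chord s k v / Ev powr (2 * s)" .
    have gp: "g v powr (-1 - 2 * s) = v powr (-1-2 * s) * (Ev * Ev powr (2 * s))"
    proof -
      have "g v powr (-1 - 2 * s) = v powr (-1-2 * s) / Ev powr (-1-2 * s)"
        using v0 Ev by (simp add: g_def Ev_def powr_divide)
      also have "Ev powr (-1-2 * s) = 1 / (Ev * Ev powr (2 * s))"
        using Ev by (simp add: powr_diff powr_minus divide_simps)
      finally show ?thesis by simp
    qed
    have "Ev powr (2 * s - 1) = Ev powr (2 * s) / Ev" using Ev by (simp add: powr_diff)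
    thus ?thesis unfolding c gp Ev_def[symmetric] using Ev
      by (simp add: field_simps power2_eq_square)
  qed
  ultimately show ?thesis by (rule has_integral_eq[rotated])
qed

text \<open>The derivative is that of -(1 + E^(2s) - 2 q^s) t^(-2s) / (2s). Subtracting it from the
  two integrands leaves exactly (2 t^2 - k t^3 / E) q^(s-1) t^(-1-2s), at most 2 t^(1-2s) q^(s-1).
  As q >= t (a - t), this is at most 2 t^(-s) (a - t)^(s-1), whose integral over (0, a) does not
  depend on a: this homogeneity makes the bound uniform in k.\<close>

lemma integrand_le_derivative:
  assumes t: "0 < t" "t < a"
  defines "E \<equiv> 1 + k * t" and "q \<equiv> 1 + k * t - t\<^sup>2"
  shows "(1 - chord s k t) * t powr (-1 - 2 * s)
     + (E powr (2 * s - 1) - chord s k t / E) * t powr (-1 - 2 * s)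
   \<le> - ((2 * s * E powr (2 * s - 1) * k - 2 * (s * q powr (s - 1) * (k - 2 * t))) * t powr (- 2 * s)
         + (1 + E powr (2 * s) - 2 * q powr s) * (- 2 * s * t powr (- 2 * s - 1))) / (2 * s)
      + 2 * ((a/2) powr (s - 1) * t powr (- s) + (a/2) powr (- s) * (a - t) powr (s - 1))"
proof -
  have E: "E > 0" using k t by (simp add: E_def add_pos_nonneg)
  have q: "q > 0" using pos[of t] t by (simp add: q_def)
  define X where "X = E powr (2 * s - 1)"
  define Y where "Y = q powr (s - 1)"
  define Z where "Z = t powr (-1 - 2 * s)"
  have e: "E powr (2 * s) = E * X" "q powr s = q * Y" "t powr (- 2 * s) = t * Z" "t powr (- 2 * s - 1) = Z"
    using E q t by (auto simp: X_def Y_def Z_def powr_diff powr_minus_divide powr_add field_simps)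
  have c: "chord s k t = q * Y" using chord_eq[of t] t e by (simp add: q_def)
  have XYZ: "X > 0" "Y > 0" "Z > 0" using E q t by (auto simp: X_def Y_def Z_def)
  have main: "(1 - q * Y) * Z + (X - q * Y / E) * Z =
    - ((2 * s * X * k - 2 * (s * Y * (k - 2 * t))) * (t * Z)
         + (1 + E * X - 2 * (q * Y)) * (- 2 * s * Z)) / (2 * s) + (2 * t\<^sup>2 - k * t * t\<^sup>2 / E) * Y * Z"
  proof -
    have k: "k * t = E - 1" and q: "q = E - t\<^sup>2" by (simp_all add: E_def q_def)
    have h: "- ((2 * s * X * k - 2 * (s * Y * (k - 2 * t))) * (t * Z)
         + (1 + E * X - 2 * (q * Y)) * (- 2 * s * Z)) / (2 * s)
      = - X * (k * t) * Z + Y * (k * t) * Z - 2 * t\<^sup>2 * Y * Z + (1 + E * X - 2 * (q * Y)) * Z"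
      using s by (simp add: field_simps power2_eq_square)
    show ?thesis unfolding h unfolding k q using E by (simp add: field_simps power2_eq_square)
  qed
  have "(2 * t\<^sup>2 - k * t * t\<^sup>2 / E) * Y * Z \<le> 2 * t\<^sup>2 * Y * Z"
    using XYZ k t E by (intro mult_right_mono) auto
  also have "t\<^sup>2 * Z = t powr (1 - 2 * s)"
    using t by (simp add: Z_def powr_diff powr_minus_divide field_simps power2_eq_square)
  hence "2 * t\<^sup>2 * Y * Z = 2 * (t powr (1 - 2 * s) * Y)" by (simp add: mult_ac)
  also have "t powr (1 - 2 * s) * Y \<le> t powr (1 - 2 * s) * (t * (a - t)) powr (s - 1)"
  proof -
    have "t * (a - t) \<le> q" unfolding q_def factor using b t by (simp add: algebra_simps)
    thus ?thesis unfolding Y_def using s t by (intro mult_left_mono powr_mono2') auto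
  qed
  also have "t powr (1 - 2 * s) * (t * (a - t)) powr (s - 1) = t powr (- s) * (a - t) powr (s - 1)"
  proof -
    have "t powr (1 - 2 * s) * t powr (s - 1) = t powr (- s)"
      by (simp flip: powr_add)
    thus ?thesis using t by (simp add: powr_mult mult.assoc[symmetric])
  qed
  \<comment> \<open>On each half of (0, a) only one factor is singular; the other one is frozen at a
    / 2, which leaves terms with elementary primitives.\<close>
  also have "\<dots> \<le> (a/2) powr (s - 1) * t powr (- s) + (a/2) powr (- s) * (a - t) powr (s - 1)"
  proof (cases "t \<le> a/2")
    case True
    have "(a - t) powr (s - 1) \<le> (a/2) powr (s - 1)" using True a s by (intro powr_mono2') auto
    hence "t powr (- s) * (a - t) powr (s - 1) \<le> t powr (- s) * (a/2) powr (s - 1)"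
      by (intro mult_left_mono) auto
    thus ?thesis by (simp add: mult.commute add_increasing2)
  next
    case False
    have "t powr (- s) \<le> (a/2) powr (- s)" using False a s by (intro powr_mono2') auto
    hence "t powr (- s) * (a - t) powr (s - 1) \<le> (a/2) powr (- s) * (a - t) powr (s - 1)"
      by (intro mult_right_mono) auto
    thus ?thesis by (simp add: add_increasing)
  qed
  finally show ?thesis
    unfolding c e X_def[symmetric] Z_def[symmetric] Y_def[symmetric] main by simp
qed

text \<open>The tails of v^(-1-2s) beyond a and beyond b, added on the left, are cancelled exactly
  by the boundary value of the primitive at a, because a b = 1. This matters since b^(-2s) is
  unbounded as k grows. Only the boundary value at t and a constant depending on s alone
  survive.\<close>

lemma shifted_integrals_le:
  assumes t: "0 < t" "t < a"
  shows "integral {t..a} (\<lambda>v. (1 - chord s k v) * v powr (-1 - 2 * s))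
    + integral {t / (1 + k * t)..b} (\<lambda>v. (1 - chord s k (- v)) * v powr (-1 - 2 * s))
    + a powr (- 2 * s) / (2 * s) + b powr (- 2 * s) / (2 * s)
    \<le> (1 + (1 + k * t) powr (2 * s) - 2 * chord s k t) * t powr (- 2 * s) / (2 * s)
      + 2 * (2 powr (1 - s) / (1 - s) + 2 powr s / s)"
proof -
  define Q0 where "Q0 v = - ((1 + (1 + k * v) powr (2 * s) - 2 * (1 + k * v - v\<^sup>2) powr s) * v powr (- 2 * s)) / (2 * s)" for v
  define Q1 where "Q1 v = (a/2) powr (s - 1) * v powr (1 - s) / (1 - s) - (a/2) powr (- s) * (a - v) powr s / s" for v
  define Q' where "Q' v = - ((2 * s * (1 + k * v) powr (2 * s - 1) * k - 2 * (s * (1 + k * v - v\<^sup>2) powr (s - 1) * (k - 2 * v))) * v powr (- 2 * s)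
         + (1 + (1 + k * v) powr (2 * s) - 2 * (1 + k * v - v\<^sup>2) powr s) * (- 2 * s * v powr (- 2 * s - 1))) / (2 * s)
      + 2 * ((a/2) powr (s - 1) * v powr (- s) + (a/2) powr (- s) * (a - v) powr (s - 1))" for v
  have "((\<lambda>v. (1 - chord s k v) * v powr (-1 - 2 * s)) has_integral
      integral {t..a} (\<lambda>v. (1 - chord s k v) * v powr (-1 - 2 * s))) {t..a}"
    using s t by (intro integrable_integral integrable_continuous_interval continuous_intros) auto
  from has_integral_add[OF this left_substitution[OF t]]
  have I1: "((\<lambda>v. (1 - chord s k v) * v powr (-1 - 2 * s) + ((1 + k * v) powr (2 * s - 1) - chord s k v / (1 + k * v)) * v powr (-1 - 2 * s))
    has_integral (integral {t..a} (\<lambda>v. (1 - chord s k v) * v powr (-1 - 2 * s))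
    + integral {t / (1 + k * t)..b} (\<lambda>v. (1 - chord s k (- v)) * v powr (-1 - 2 * s)))) {t..a}" .
  have I2: "(Q' has_integral ((Q0 a + 2 * Q1 a) - (Q0 t + 2 * Q1 t))) {t..a}"
  proof (rule fundamental_theorem_of_calculus_interior)
    show "t \<le> a" using t by simp
    have nn: "0 \<le> 1 + k * v - v\<^sup>2" "0 < 1 + k * v" if "v \<in> {t..a}" for v
      using that t b k unfolding factor by (auto simp: add_pos_nonneg)
    show "continuous_on {t..a} (\<lambda>v. Q0 v + 2 * Q1 v)"
    proof -
      have "continuous_on {t..a} (\<lambda>v. (1 + k * v) powr (2 * s))"
        by (rule continuous_on_powr') (use nn in \<open>force intro!: continuous_intros\<close>)+
      moreover have "continuous_on {t..a} (\<lambda>v. (1 + k * v - v\<^sup>2) powr s)"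
        by (rule continuous_on_powr') (use nn s in \<open>auto intro!: continuous_intros\<close>)
      moreover have "continuous_on {t..a} (\<lambda>v. (a - v) powr s)"
        by (rule continuous_on_powr') (use s in \<open>auto intro!: continuous_intros\<close>)
      moreover have "continuous_on {t..a} (\<lambda>v. v powr x)" for x
        by (rule continuous_on_powr) (use t in \<open>auto intro!: continuous_intros\<close>)
      ultimately show ?thesis
        unfolding Q0_def Q1_def using s by (intro continuous_on_add continuous_on_mult continuous_on_divide
            continuous_on_minus continuous_on_diff continuous_on_const) auto
    qed
    fix v assume v: "v \<in> {t<..<a}"
    have vv: "0 < v" "v < a" using v t by auto
    have p: "0 < 1 + k * v" "0 < 1 + k * v - v\<^sup>2" using vv pos[of v] k by (auto simp: add_pos_nonneg)
    have d1: "((\<lambda>v. (1 + k * v) powr (2 * s)) has_real_derivative 2 * s * (1 + k * v) powr (2 * s - 1) * k) (at v)"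
      by (rule DERIV_fun_powr[THEN DERIV_cong]) (use p in \<open>auto intro!: derivative_eq_intros\<close>)
    have d2: "((\<lambda>v. (1 + k * v - v\<^sup>2) powr s) has_real_derivative s * (1 + k * v - v\<^sup>2) powr (s - 1) * (k - 2 * v)) (at v)"
      by (rule DERIV_fun_powr[THEN DERIV_cong]) (use p in \<open>auto intro!: derivative_eq_intros\<close>)
    have d3: "((\<lambda>v. v powr (- 2 * s)) has_real_derivative - 2 * s * v powr (- 2 * s - 1)) (at v)"
      by (rule has_real_derivative_powr[THEN DERIV_cong]) (use vv in auto)
    have d4: "((\<lambda>v. v powr (1 - s)) has_real_derivative (1 - s) * v powr (- s)) (at v)"
      by (rule has_real_derivative_powr[THEN DERIV_cong]) (use vv in auto)
    have d5: "((\<lambda>v. (a - v) powr s) has_real_derivative s * (a - v) powr (s - 1) * (- 1)) (at v)"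
      by (rule DERIV_fun_powr[THEN DERIV_cong]) (use vv in \<open>auto intro!: derivative_eq_intros\<close>)
    have D0: "(Q0 has_real_derivative - ((2 * s * (1 + k * v) powr (2 * s - 1) * k - 2 * (s * (1 + k * v - v\<^sup>2) powr (s - 1) * (k - 2 * v))) * v powr (- 2 * s)
         + (1 + (1 + k * v) powr (2 * s) - 2 * (1 + k * v - v\<^sup>2) powr s) * (- 2 * s * v powr (- 2 * s - 1))) / (2 * s)) (at v)"
      unfolding Q0_def
      by (rule d1 d2 d3 derivative_eq_intros refl)+ (use s in \<open>simp_all add: field_simps\<close>)
    have D1: "(Q1 has_real_derivative (a/2) powr (s - 1) * v powr (- s) + (a/2) powr (- s) * (a - v) powr (s - 1)) (at v)"
      unfolding Q1_def
      by (rule DERIV_cong[OF DERIV_diff[OF DERIV_cdivide[OF DERIV_cmult[OF d4]] DERIV_cdivide[OF DERIV_cmult[OF d5]]]])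
        (use s in simp)
    show "((\<lambda>v. Q0 v + 2 * Q1 v) has_vector_derivative Q' v) (at v)"
      unfolding Q'_def has_real_derivative_iff_has_vector_derivative[symmetric]
      by (rule DERIV_add[OF D0 DERIV_cmult[OF D1]])
  qed
  \<comment> \<open>The derivative bound is available only for v < a; altering the derivative at the
    two endpoints does not change its integral.\<close>
  have I2': "((\<lambda>v. if v \<in> {t,a} then (1 - chord s k v) * v powr (-1 - 2 * s) + ((1 + k * v) powr (2 * s - 1) - chord s k v / (1 + k * v)) * v powr (-1 - 2 * s) else Q' v)
      has_integral ((Q0 a + 2 * Q1 a) - (Q0 t + 2 * Q1 t))) {t..a}"
    by (rule has_integral_spike_finite[OF _ _ I2, of "{t,a}"]) auto
  have le: "integral {t..a} (\<lambda>v. (1 - chord s k v) * v powr (-1 - 2 * s))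
    + integral {t / (1 + k * t)..b} (\<lambda>v. (1 - chord s k (- v)) * v powr (-1 - 2 * s))
    \<le> (Q0 a + 2 * Q1 a) - (Q0 t + 2 * Q1 t)"
    by (rule has_integral_le[OF I1 I2']) (use t integrand_le_derivative in \<open>auto simp: Q'_def\<close>)
  have "1 + k * a - a\<^sup>2 = 0" using one_plus_k_a by simp
  moreover have "a\<^sup>2 powr (2 * s) * a powr (- 2 * s) = b powr (- 2 * s)"
  proof -
    have "b = 1 / a" using ab a by (simp add: field_simps)
    hence "b powr (- 2 * s) = a powr (2 * s)" using a by (simp add: powr_divide powr_minus_divide)
    moreover have "a\<^sup>2 powr (2 * s) = a powr (2 * s) * a powr (2 * s)" by (simp add: power2_eq_square powr_mult)
    moreover have "a powr (2 * s) * a powr (- 2 * s) = 1" using a by (simp flip: powr_add)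
    ultimately show ?thesis by (simp add: mult.assoc)
  qed
  ultimately have Q0a: "Q0 a = - (a powr (- 2 * s) / (2 * s)) - b powr (- 2 * s) / (2 * s)"
    using s unfolding Q0_def one_plus_k_a by (simp add: distrib_right add_divide_distrib diff_divide_distrib)
  have "Q1 a - Q1 0 = (a/2) powr (s - 1) * a powr (1 - s) / (1 - s) + (a/2) powr (- s) * a powr s / s"
    using s by (simp add: Q1_def)
  also have "(a/2) powr (s - 1) * a powr (1 - s) = 2 powr (1 - s)"
  proof -
    have "(a/2) powr (s - 1) = 1 / (a/2) powr (1 - s)"
      using powr_minus_divide[of "a/2" "1 - s"] by simp
    thus ?thesis using a by (simp add: powr_divide)
  qed
  also have "(a/2) powr (- s) * a powr s = 2 powr s"
    using a by (simp add: powr_minus_divide powr_divide)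
  finally have Q1a: "Q1 a - Q1 0 = 2 powr (1 - s) / (1 - s) + 2 powr s / s" .
  \<comment> \<open>Replacing Q1 t by Q1 0 makes the remaining difference free of both t and
    a.\<close>
  have "Q1 0 \<le> Q1 t"
  proof -
    have "(a - t) powr s \<le> a powr s" using t s by (intro powr_mono2) auto
    hence "(a/2) powr (- s) * (a - t) powr s / s \<le> (a/2) powr (- s) * a powr s / s"
      using s by (intro divide_right_mono mult_left_mono) auto
    moreover have "0 \<le> (a/2) powr (s - 1) * t powr (1 - s) / (1 - s)" using s by simp
    moreover have "Q1 0 = - ((a/2) powr (- s) * a powr s / s)" by (simp add: Q1_def)
    ultimately show ?thesis using Q1_def[of t] by linarith
  qed
  moreover have "- Q0 t = (1 + (1 + k * t) powr (2 * s) - 2 * chord s k t) * t powr (- 2 * s) / (2 * s)"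
    using t chord_eq[of t] by (simp add: Q0_def)
  moreover have "I + y + z \<le> B + 2 * C"
    if "q0 \<le> qt" "- Qt = B" "I \<le> Qa + 2 * qa - (Qt + 2 * qt)" "Qa = - y - z" "qa - q0 = C"
    for I y z B C q0 qt Qt Qa qa :: real using that by linarith
  ultimately show ?thesis using le Q0a Q1a by blast
qed

end

section \<open>A bound uniform over all chords and all truncations\<close>

lemma chord_bounded:
  assumes "0 < s"
  shows "chord s k t \<le> (1 + k\<^sup>2) powr s"
proof -
  have "0 \<le> (t - k / 2)\<^sup>2" by simp
  hence "1 + k * t - t\<^sup>2 \<le> 1 + k\<^sup>2 / 4" by (simp add: power2_eq_square algebra_simps)
  also have "\<dots> \<le> 1 + k\<^sup>2" by simp
  finally show ?thesis unfolding chord_def using assms by (intro powr_mono2) auto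
qed

text \<open>While both polynomials are nonnegative, concavity makes the defect nonnegative. So
  negativity means that the short side has already ended and the long side exceeds 2. The latter
  forces k > 1 + t, and then 1 + k t - t^2 does not decrease on the way to u, since t + u <
  k.\<close>

lemma chord_defect_negative:
  assumes s: "0 < s" "s < 1" and k: "0 \<le> k" and t: "0 < t" "t \<le> u" "u \<le> 1"
    and neg: "2 - chord s k t - chord s (- k) t < 0"
  shows "2 - chord s k u - chord s (- k) u < 0"
proof -
  have "1 + - k * t - t\<^sup>2 < 0"
  proof (rule ccontr)
    assume *: "\<not> ?thesis"
    have "0 \<le> 1 + k * t - t\<^sup>2"
      using k t mult_nonneg_nonneg[of k t] power_le_one[of t 2] by linarith
    with * powr_le_tangent[of "1 + k * t - t\<^sup>2" s] powr_le_tangent[of "1 + - k * t - t\<^sup>2" s] s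
    have "chord s k t + chord s (- k) t \<le> 2 - 2 * (s * t\<^sup>2)"
      by (simp add: chord_def algebra_simps)
    moreover have "0 \<le> s * t\<^sup>2" using s by simp
    ultimately show False using neg by linarith
  qed
  hence "chord s (- k) t = 0" using s by (simp add: chord_def)
  hence c: "2 < chord s k t" using neg by simp
  have v: "2 < 1 + k * t - t\<^sup>2"
  proof (rule ccontr)
    assume "\<not> ?thesis"
    hence "max 0 (1 + k * t - t\<^sup>2) \<le> 2" by auto
    hence "chord s k t \<le> 2 powr s" unfolding chord_def using s by (intro powr_mono2) auto
    also have "\<dots> \<le> 2 powr 1" using s by (intro powr_mono) auto
    finally show False using c by simp
  qed
  have "1 + t < k"
  proof (rule ccontr)
    assume "\<not> 1 + t < k"
    hence "k * t \<le> (1 + t) * t" using t by (intro mult_right_mono) auto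
    thus False using v t by (simp add: algebra_simps power2_eq_square)
  qed
  hence "0 \<le> (u - t) * (k - t - u)" using t by (intro mult_nonneg_nonneg) auto
  hence "1 + k * t - t\<^sup>2 \<le> 1 + k * u - u\<^sup>2" by (simp add: algebra_simps power2_eq_square)
  hence "chord s k t \<le> chord s k u" unfolding chord_def using s by (intro powr_mono2) auto
  thus ?thesis using c chord_nonneg[of s "- k" u] by linarith
qed

text \<open>With y = 1 + k t the numerator is (y^s - 1)^2 + 2 (y^s - \<open>chord s k t\<close>),
  and both parts are of order t^2; hence the boundary term vanishes like t^(2-2s). The constant
  depends on k, so this helps only where the truncation may be made small depending on k.\<close>

lemma boundary_term_small:
  assumes s: "0 < s" "s < 1" and k: "0 \<le> k" and t: "0 < t" "t \<le> 1"
  shows "(1 + (1 + k * t) powr (2 * s) - 2 * chord s k t) * t powr (- 2 * s) / (2 * s)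
    \<le> (k\<^sup>2 + 2) * t powr (2 - 2 * s) / (2 * s)"
proof -
  define y where "y = 1 + k * t"
  have y: "1 \<le> y" using k t by (simp add: y_def)
  have t2: "t\<^sup>2 \<le> 1" using t by (simp add: power_le_one)
  have "y powr s \<le> 1 + s * (y - 1)" using powr_le_tangent[of y s] y s by simp
  also have "\<dots> \<le> 1 + 1 * (y - 1)" using s y by (intro add_left_mono mult_right_mono) auto
  finally have "y powr s - 1 \<le> k * t" by (simp add: y_def)
  moreover have "1 \<le> y powr s" using y s by (simp add: ge_one_powr_ge_zero)
  ultimately have A: "(y powr s - 1)\<^sup>2 \<le> (k * t)\<^sup>2" by (intro power_mono) auto
  have "y powr s - t\<^sup>2 \<le> (y - t\<^sup>2) powr s"
  proof -
    define w where "w = t\<^sup>2 / y"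
    have w: "0 \<le> w" "w \<le> 1" using t2 y by (auto simp: w_def field_simps)
    have "1 - w \<le> (1 - w) powr s"
    proof (cases "w = 1")
      case False
      thus ?thesis using powr_mono'[of s 1 "1 - w"] w s by simp
    qed simp
    hence "y powr s * (1 - w) \<le> y powr s * (1 - w) powr s" by (intro mult_left_mono) auto
    also have "\<dots> = (y - t\<^sup>2) powr s" using y w by (simp add: powr_mult[symmetric] w_def right_diff_distrib)
    finally have "y powr s - y powr s * w \<le> (y - t\<^sup>2) powr s" by (simp add: algebra_simps)
    moreover have "y powr s \<le> y powr 1" using y s by (intro powr_mono) auto
    hence "y powr s * w \<le> y * w" using w y by (intro mult_right_mono) auto
    hence "y powr s * w \<le> t\<^sup>2" using y by (simp add: w_def)
    ultimately show ?thesis by linarith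
  qed
  moreover have "chord s k t = (y - t\<^sup>2) powr s" using t2 y by (simp add: chord_def y_def max_def)
  ultimately have B: "y powr s - chord s k t \<le> t\<^sup>2" by simp
  have "y powr (2 * s) = (y powr s)\<^sup>2" using y by (simp add: powr_powr mult.commute flip: powr_numeral)
  hence "1 + y powr (2 * s) - 2 * chord s k t = (y powr s - 1)\<^sup>2 + 2 * (y powr s - chord s k t)"
    by (simp add: power2_eq_square algebra_simps)
  also have "\<dots> \<le> (k\<^sup>2 + 2) * t\<^sup>2" using A B by (simp add: power_mult_distrib algebra_simps)
  finally have "(1 + y powr (2 * s) - 2 * chord s k t) * t powr (- 2 * s) \<le> (k\<^sup>2 + 2) * t\<^sup>2 * t powr (- 2 * s)"
    by (intro mult_right_mono) auto
  also have "\<dots> = (k\<^sup>2 + 2) * t powr (2 - 2 * s)"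
    using t by (simp add: powr_diff powr_minus_divide)
  finally show ?thesis using s by (simp add: y_def divide_right_mono)
qed

lemma chord_tail_integrable:
  assumes "0 < s" "0 < t"
  shows "integrable lborel (\<lambda>v. if t \<le> v then chord s k v * v powr (-1 - 2 * s) else 0)"
    and "integrable lborel (\<lambda>v. if t \<le> v then v powr (-1 - 2 * s) else 0)"
    and "(\<integral>v. (if t \<le> v then v powr (-1 - 2 * s) else 0) \<partial>lborel) = t powr (- 2 * s) / (2 * s)"
proof -
  have H: "((\<lambda>v. v powr (-1 - 2 * s)) has_integral (t powr (- 2 * s) / (2 * s))) {t..}"
    using has_integral_powr_to_inf[of "-1 - 2 * s" t] assms by simp
  have "(\<integral>\<^sup>+v. ennreal (if t \<le> v then v powr (-1 - 2 * s) else 0) \<partial>lborel)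
      = (\<integral>\<^sup>+v. ennreal (v powr (-1 - 2 * s)) * indicator {t..} v \<partial>lborel)"
    by (intro nn_integral_cong) (auto simp: indicator_def)
  also have "\<dots> = ennreal (t powr (- 2 * s) / (2 * s))"
    using nn_integral_has_integral_lebesgue'[OF _ H] by simp
  finally have nn: "(\<integral>\<^sup>+v. ennreal (if t \<le> v then v powr (-1 - 2 * s) else 0) \<partial>lborel)
      = ennreal (t powr (- 2 * s) / (2 * s))" .
  show I: "integrable lborel (\<lambda>v. if t \<le> v then v powr (-1 - 2 * s) else 0)"
    by (rule integrableI_nonneg) (use nn in auto)
  show "(\<integral>v. (if t \<le> v then v powr (-1 - 2 * s) else 0) \<partial>lborel) = t powr (- 2 * s) / (2 * s)"
    by (subst integral_eq_nn_integral) (use nn assms in auto)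
  show "integrable lborel (\<lambda>v. if t \<le> v then chord s k v * v powr (-1 - 2 * s) else 0)"
    by (rule Bochner_Integration.integrable_bound[OF integrable_mult_right[OF I, of "(1 + k\<^sup>2) powr s"]])
      (use chord_bounded[OF assms(1)] in \<open>auto simp: chord_nonneg abs_mult intro!: mult_right_mono\<close>)
qed

text \<open>The truncated integral is monotone in the truncation as long as the integrand is
  nonnegative; once the integrand has become negative it stays so up to \<open>1\<close>.\<close>

lemma chord_defect_integral_nonneg_k:
  assumes s: "0 < s" "s < 1" and k: "0 \<le> k" and t: "0 < t"
  shows "integral {t..} (\<lambda>v. (2 - chord s k v - chord s (- k) v) * v powr (-1 - 2 * s))
     \<le> 1 / s + 1 + 2 * (2 powr (1 - s) / (1 - s) + 2 powr s / s)"
proof -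
  define A where "A v = (1 - chord s k v) * v powr (-1 - 2 * s)" for v
  define B where "B v = (1 - chord s (- k) v) * v powr (-1 - 2 * s)" for v
  define D where "D v = (2 - chord s k v - chord s (- k) v) * v powr (-1 - 2 * s)" for v
  have DAB: "D v = A v + B v" for v by (simp add: A_def B_def D_def algebra_simps)
  have pw: "((\<lambda>v. v powr (-1 - 2 * s)) has_integral (x powr (- 2 * s) / (2 * s))) {x..}" if "0 < x" for x
    using has_integral_powr_to_inf[of "-1 - 2 * s" x] that s by simp
  have ch: "(\<lambda>v. chord s k v * v powr (-1 - 2 * s)) integrable_on {x..}" if "0 < x" for x k
  proof -
    have "(\<lambda>v. if v \<in> {x..} then chord s k v * v powr (-1 - 2 * s) else 0) integrable_on UNIV"
      using integrable_on_lborel[OF chord_tail_integrable(1)[OF s(1) that, of k]] by simp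
    thus ?thesis by (simp only: integrable_restrict_UNIV)
  qed
  have I: "A integrable_on {x..}" "B integrable_on {x..}" if "0 < x" for x
    using integrable_diff[OF has_integral_integrable[OF pw[OF that]] ch[OF that, of k]]
      integrable_diff[OF has_integral_integrable[OF pw[OF that]] ch[OF that, of "- k"]]
    unfolding A_def B_def left_diff_distrib by simp_all
  have ID: "D integrable_on {x..}" if "0 < x" for x
    using integrable_add[OF I[OF that]] by (simp add: DAB[abs_def])
  have split: "integral {x..} f = integral {x..y} f + integral {y..} f"
    if "0 < x" "x \<le> y" and f: "\<And>x. 0 < x \<Longrightarrow> f integrable_on {x..}" for x y and f :: "real \<Rightarrow> real"
  proof -
    have 1: "f integrable_on {x..y}" by (rule integrable_on_subinterval[OF f[OF that(1)]]) auto
    have 2: "(f has_integral (integral {x..y} f + integral {y..} f)) ({x..y} \<union> {y..})"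
      using that by (intro has_integral_Un integrable_integral 1 f) (auto intro: negligible_subset[of "{y}"])
    have "{x..y} \<union> {y..} = {x..}" using that by auto
    thus ?thesis using 2 by (metis integral_unique)
  qed
  have nonpos: "integral {x..y} f \<le> 0"
    if "f integrable_on {x..y}" "\<And>v. v \<in> {x..y} \<Longrightarrow> f v \<le> 0" for x y and f :: "real \<Rightarrow> real"
    using integral_le[OF that(1) integrable_0 that(2)] by simp
  \<comment> \<open>Past 1 both chords can simply be dropped: 2 v^(-1-2s) integrates to 1 / s over v
    >= 1.\<close>
  have J1: "integral {x..} D \<le> 1 / s" if x: "1 \<le> x" for x
  proof -
    have le: "2 - chord s k v - chord s (- k) v \<le> 2" for v
      using chord_nonneg[of s k v] chord_nonneg[of s "- k" v] by linarith
    have "integral {x..} D \<le> integral {x..} (\<lambda>v. 2 * v powr (-1 - 2 * s))"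
    proof (rule integral_le)
      show "(\<lambda>v. 2 * v powr (-1 - 2 * s)) integrable_on {x..}"
        using has_integral_mult_right[OF pw[of x], of 2] x by (auto simp: integrable_on_def)
    qed (use x ID[of x] mult_right_mono[OF le] in \<open>auto simp: D_def\<close>)
    also have "\<dots> = x powr (- 2 * s) / s"
      using integral_unique[OF has_integral_mult_right[OF pw[of x], of 2]] x s by simp
    also have "\<dots> \<le> 1 / s"
      using x s powr_mono2'[of "- 2 * s" 1 x] by (intro divide_right_mono) auto
    finally show ?thesis .
  qed
  have posC: "1 / s > 0" "2 * (2 powr (1 - s) / (1 - s) + 2 powr s / s) > 0" using s by (auto intro: add_pos_pos)
  \<comment> \<open>A defect negative at t is negative on [t, 1], leaving only the part past 1. A
    defect nonnegative at t is nonnegative on (0, t], so the truncation may be lowered to any point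
    that suits the estimate.\<close>
  consider "1 \<le> t" | "t < 1" "2 - chord s k t - chord s (- k) t < 0" | "t < 1" "2 - chord s k t - chord s (- k) t \<ge> 0"
    by linarith
  hence "integral {t..} D \<le> 1 / s + 1 + 2 * (2 powr (1 - s) / (1 - s) + 2 powr s / s)"
  proof cases
    case 1
    thus ?thesis using J1[of t] posC by linarith
  next
    case 2
    have "integral {t..1} D \<le> 0"
    proof (rule nonpos)
      show "D integrable_on {t..1}" by (rule integrable_on_subinterval[OF ID[OF t]]) auto
      show "D v \<le> 0" if "v \<in> {t..1}" for v
        unfolding D_def using chord_defect_negative[OF s k t _ _ 2(2), of v] that
        by (intro mult_nonpos_nonneg) auto
    qed
    thus ?thesis using split[of t 1 D] ID J1[of 1] t 2 posC by fastforce
  next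
    case 3
    define a where "a = (k + sqrt (k\<^sup>2 + 4)) / 2"
    define b where "b = (sqrt (k\<^sup>2 + 4) - k) / 2"
    have "k < sqrt (k\<^sup>2 + 4)" by (rule real_less_rsqrt) simp
    hence roots: "0 < a" "0 < b" "a * b = 1" "k = a - b"
      using k by (auto simp: a_def b_def field_simps power2_eq_square add_nonneg_pos)
    interpret chord_roots s k a b by unfold_locales (use s k roots in auto)
    \<comment> \<open>The new truncation u may depend on k: it is taken so small that the boundary
      term falls below 1, which is the summand 1 of the bound, and below k (unless k = 0) for the
      shift of the truncation in \<open>A\<close>.\<close>
    have "((\<lambda>u. (k\<^sup>2 + 2) * u powr (2 - 2 * s) / (2 * s)) \<longlongrightarrow> (k\<^sup>2 + 2) * 0 / (2 * s)) (at_right 0)"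
      using s by (intro tendsto_intros tendsto_zero_powrI[where b = "2 - 2 * s"]) (auto simp: eventually_at_filter)
    hence "\<forall>\<^sub>F u in at_right 0. (k\<^sup>2 + 2) * u powr (2 - 2 * s) / (2 * s) < 1"
      by (rule order_tendstoD) simp
    moreover have ev: "\<forall>\<^sub>F u in at_right 0. (u::real) < c" if "0 < c" for c
      using eventually_at_right_real[OF that] by eventually_elim simp
    have "\<forall>\<^sub>F u in at_right 0. k = 0 \<or> u < k"
      using ev[of k] k by (cases "k = 0") auto
    ultimately have "\<forall>\<^sub>F u in at_right 0. (k\<^sup>2 + 2) * u powr (2 - 2 * s) / (2 * s) < 1 \<and>
      (k = 0 \<or> u < k) \<and> u < t \<and> u < a \<and> u < 1 \<and> 0 < u"
      using ev[OF t] ev[OF roots(1)] ev[of 1] by (auto simp: eventually_at_right_less eventually_conj_iff)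
    then obtain u where u: "(k\<^sup>2 + 2) * u powr (2 - 2 * s) / (2 * s) < 1" "k = 0 \<or> u < k" "u < t" "u < a" "u < 1" "0 < u"
      using eventually_happens'[of "at_right (0::real)"] by (auto simp: trivial_limit_at_right_real)
    \<comment> \<open>The involution pairs the cutoff u on the right with w on the left. Both halves
      are started at w, and the right one is then moved up to u, at no cost because \<open>A\<close>
      is nonpositive in between.\<close>
    define w where "w = u / (1 + k * u)"
    have w: "0 < w" "w \<le> u" using u k by (auto simp: w_def field_simps add_pos_nonneg)
    have "w \<le> b"
    proof -
      have "u \<le> b * (1 + k * u)"
      proof -
        have "1 - k * b = (a - k) * b" using roots(3) by (simp add: algebra_simps)
        hence kb: "1 - k * b = b * b" using roots(4) by simp
        have "u * (1 - k * b) \<le> a * (1 - k * b)"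
          by (rule mult_right_mono) (use u kb in auto)
        also have "\<dots> = a * b * b" unfolding kb by simp
        also have "\<dots> = b" using roots(3) by simp
        finally show ?thesis by (simp add: algebra_simps)
      qed
      thus ?thesis using u k by (simp add: w_def field_simps add_pos_nonneg)
    qed
    have e1: "integral {t..} D \<le> integral {w..} D"
    proof -
      have "0 \<le> integral {w..t} D"
      proof (rule integral_nonneg)
        show "D integrable_on {w..t}" by (rule integrable_on_subinterval[OF ID[OF w(1)]]) auto
        fix v assume v: "v \<in> {w..t}"
        have "2 - chord s k v - chord s (- k) v \<ge> 0"
          using chord_defect_negative[OF s k, of v t] v w 3 by fastforce
        thus "0 \<le> D v" by (simp add: D_def)
      qed
      thus ?thesis using split[of w t D] w u ID by fastforce
    qed
    have e2: "integral {w..} D = integral {w..} A + integral {w..} B"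
      unfolding DAB[abs_def] by (rule integral_add) (use I w in auto)
    have e3: "integral {w..} A \<le> integral {u..} A"
    proof -
      have "integral {w..u} A \<le> 0"
      proof (cases "k = 0")
        case True
        thus ?thesis by (simp add: w_def)
      next
        case False
        show ?thesis
        proof (rule nonpos)
          show "A integrable_on {w..u}" by (rule integrable_on_subinterval[OF I(1)[OF w(1)]]) auto
          fix v assume v: "v \<in> {w..u}"
          have "v * v \<le> k * v" using v w u(2) False by (intro mult_right_mono) auto
          hence "1 \<le> max 0 (1 + k * v - v\<^sup>2)" by (simp add: power2_eq_square)
          hence "1 \<le> chord s k v" unfolding chord_def using s by (simp add: ge_one_powr_ge_zero)
          thus "A v \<le> 0" unfolding A_def by (intro mult_nonpos_nonneg) auto
        qed
      qed
      thus ?thesis using split[of w u A] w u I by fastforce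
    qed
    have e4: "integral {u..} A = integral {u..a} A + a powr (- 2 * s) / (2 * s)"
    proof -
      have "integral {a..} A = integral {a..} (\<lambda>v. v powr (-1 - 2 * s))"
        by (rule integral_cong) (simp add: A_def chord_zero)
      thus ?thesis using split[of u a A] u I pw[OF roots(1)] by (simp add: integral_unique)
    qed
    have e5: "integral {w..} B = integral {w..b} B + b powr (- 2 * s) / (2 * s)"
    proof -
      have "integral {b..} B = integral {b..} (\<lambda>v. v powr (-1 - 2 * s))"
        by (rule integral_cong) (use chord_minus_zero in \<open>simp add: B_def chord_minus\<close>)
      thus ?thesis using split[of w b B] w \<open>w \<le> b\<close> I pw[OF roots(2)] by (simp add: integral_unique)
    qed
    have e6: "integral {u..a} A + a powr (- 2 * s) / (2 * s) + (integral {w..b} B + b powr (- 2 * s) / (2 * s))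
      \<le> (1 + (1 + k * u) powr (2 * s) - 2 * chord s k u) * u powr (- 2 * s) / (2 * s)
        + 2 * (2 powr (1 - s) / (1 - s) + 2 powr s / s)"
      using shifted_integrals_le[of u] u unfolding A_def B_def w_def by (simp add: chord_minus)
    have e7: "(1 + (1 + k * u) powr (2 * s) - 2 * chord s k u) * u powr (- 2 * s) / (2 * s) \<le> 1"
      using boundary_term_small[OF s k, of u] u by linarith
    from e6 e7 have "integral {u..a} A + a powr (- 2 * s) / (2 * s) + (integral {w..b} B + b powr (- 2 * s) / (2 * s))
      \<le> 1 + 2 * (2 powr (1 - s) / (1 - s) + 2 powr s / s)" by (rule order_trans[OF _ add_right_mono])
    thus ?thesis using e1 e2 e3 e4 e5 posC by linarith
  qed
  thus ?thesis by (simp add: D_def[abs_def])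
qed

text \<open>The defect is even in k, which reduces the bound to k >= 0.\<close>

lemma chord_defect_integral_le:
  assumes s: "0 < s" "s < 1" and t: "0 < t"
  shows "(\<integral>v. (if t \<le> v then (2 - chord s k v - chord s k (- v)) * v powr (-1 - 2 * s) else 0) \<partial>lborel)
     \<le> 1 / s + 1 + 2 * (2 powr (1 - s) / (1 - s) + 2 powr s / s)" (is "?I \<le> ?C")
    and "integrable lborel (\<lambda>v. if t \<le> v then (2 - chord s k v - chord s k (- v)) * v powr (-1 - 2 * s) else 0)"
proof -
  note i = chord_tail_integrable[OF s(1) t]
  have eq: "(if t \<le> v then (2 - chord s k v - chord s k (- v)) * v powr (-1 - 2 * s) else 0) =
    2 * (if t \<le> v then v powr (-1 - 2 * s) else 0) - (if t \<le> v then chord s k v * v powr (-1 - 2 * s) else 0)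
     - (if t \<le> v then chord s (- k) v * v powr (-1 - 2 * s) else 0)" for v
    by (simp add: chord_minus algebra_simps)
  show int: "integrable lborel (\<lambda>v. if t \<le> v then (2 - chord s k v - chord s k (- v)) * v powr (-1 - 2 * s) else 0)"
    unfolding eq using i(1)[of k] i(1)[of "- k"] i(2) by (intro Bochner_Integration.integrable_diff integrable_mult_right) auto
  have "((\<lambda>v. if v \<in> {t..} then (2 - chord s k v - chord s k (- v)) * v powr (-1 - 2 * s) else 0) has_integral ?I) UNIV"
    using has_integral_integral_lborel[OF int] by simp
  hence "((\<lambda>v. (2 - chord s k v - chord s k (- v)) * v powr (-1 - 2 * s)) has_integral ?I) {t..}"
    by (simp only: has_integral_restrict_UNIV)
  hence "?I = integral {t..} (\<lambda>v. (2 - chord s k v - chord s (- k) v) * v powr (-1 - 2 * s))"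
    by (simp add: chord_minus integral_unique)
  also have "\<dots> \<le> ?C"
  proof (cases "0 \<le> k")
    case True
    thus ?thesis by (rule chord_defect_integral_nonneg_k[OF s _ t])
  next
    case False
    have "(\<lambda>v. (2 - chord s k v - chord s (- k) v) * v powr (-1 - 2 * s)) = (\<lambda>v. (2 - chord s (- k) v - chord s k v) * v powr (-1 - 2 * s))"
      by (simp add: fun_eq_iff)
    thus ?thesis using chord_defect_integral_nonneg_k[OF s _ t, of "- k"] False by simp
  qed
  finally show "?I \<le> ?C" .
qed

section \<open>Truncated fractional Laplacians of the test functions\<close>

text \<open>For fixed s, t > 0 the kernel is integrable, so bounded functions need no principal
  value; the bounds for the test functions below are uniform in t.\<close>

definition tkern :: "real \<Rightarrow> real \<Rightarrow> 'a::euclidean_space \<Rightarrow> real" where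
  "tkern s t z = (if t \<le> norm z then norm z powr - (real DIM('a) + 2 * s) else 0)"

definition flap :: "real \<Rightarrow> real \<Rightarrow> ('a::euclidean_space \<Rightarrow> real) \<Rightarrow> 'a \<Rightarrow> real" where
  "flap s t w x = (\<integral>z. (w x - w (x + z)) * tkern s t z \<partial>lborel)"

lemma borel_measurable_tkern [measurable]: "tkern s t \<in> borel_measurable borel"
  unfolding tkern_def by measurable

lemma tkern_nonneg: "0 \<le> tkern s t z"
  by (simp add: tkern_def)

lemma tkern_minus: "tkern s t (- z) = tkern s t z"
  by (simp add: tkern_def)

lemma tkern_scale:
  "0 < r \<Longrightarrow> tkern s t (r *\<^sub>R z :: 'a) = r powr - (real DIM('a::euclidean_space) + 2 * s) * tkern s (t / r) z"
  by (simp add: tkern_def powr_mult field_simps)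

lemma integrable_tkern:
  assumes "0 < s" "0 < t"
  shows "integrable lborel (tkern s t :: 'a::euclidean_space \<Rightarrow> real)"
proof (rule Bochner_Integration.integrable_bound)
  let ?e = "- (real DIM('a) + 2 * s)"
  have "integrable lborel (indicat_real (ball (0::'a) 1))"
    using emeasure_lborel_ball_finite by (intro integrable_real_indicator) auto
  thus "integrable lborel (\<lambda>z::'a. (if 1 \<le> norm z then norm z powr ?e else 0) + t powr ?e * indicator (ball 0 1) z)"
    using assms by (intro Bochner_Integration.integrable_add integrable_mult_right integrable_norm_powr_outside) auto
  show "AE z in lborel. norm (tkern s t z) \<le> norm ((if 1 \<le> norm z then norm z powr ?e else 0) + t powr ?e * indicator (ball (0::'a) 1) z)"
    using assms by (auto simp: tkern_def indicator_def intro!: powr_mono2')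
qed measurable

lemma flap_integrable:
  fixes w :: "'a::euclidean_space \<Rightarrow> real"
  assumes "0 < s" "0 < t" and [measurable]: "w \<in> borel_measurable borel" and B: "\<And>y. \<bar>w y\<bar> \<le> B"
  shows "integrable lborel (\<lambda>z. w (x + z) * tkern s t z)"
    and "integrable lborel (\<lambda>z. (w x - w (x + z)) * tkern s t z)"
proof -
  show i: "integrable lborel (\<lambda>z. w (x + z) * tkern s t z)"
    by (rule Bochner_Integration.integrable_bound[OF integrable_mult_right[OF integrable_tkern[OF assms(1,2)], of B]])
      (use B in \<open>auto simp: abs_mult tkern_nonneg intro!: mult_right_mono order_trans[OF B abs_ge_self]\<close>)
  show "integrable lborel (\<lambda>z. (w x - w (x + z)) * tkern s t z)"
    unfolding left_diff_distrib
    by (intro Bochner_Integration.integrable_diff integrable_mult_right integrable_tkern i assms)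
qed

text \<open>Pairing z with -z removes the first-order part, so that only second differences have to
  be controlled near z = 0.\<close>

lemma flap_symmetric:
  fixes w :: "'a::euclidean_space \<Rightarrow> real"
  assumes "0 < s" "0 < t" and [measurable]: "w \<in> borel_measurable borel"
    and i: "integrable lborel (\<lambda>z. w (x + z) * tkern s t z)"
  shows "2 * flap s t w x = (\<integral>z. (2 * w x - w (x + z) - w (x - z)) * tkern s t z \<partial>lborel)"
    and "integrable lborel (\<lambda>z. (2 * w x - w (x + z) - w (x - z)) * tkern s t z)"
proof -
  let ?f = "\<lambda>z. (w x - w (x + z)) * tkern s t z"
  have f: "integrable lborel ?f"
    unfolding left_diff_distrib
    by (intro Bochner_Integration.integrable_diff integrable_mult_right integrable_tkern i assms)
  have g: "integrable lborel (\<lambda>z. ?f (- z))"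
    using lborel_integral_reflect(2)[of ?f] f by simp
  have eq: "?f z + ?f (- z) = (2 * w x - w (x + z) - w (x - z)) * tkern s t z" for z
    by (simp add: tkern_minus algebra_simps)
  show "integrable lborel (\<lambda>z. (2 * w x - w (x + z) - w (x - z)) * tkern s t z)"
    using Bochner_Integration.integrable_add[OF f g] unfolding eq .
  have "2 * flap s t w x = (\<integral>z. ?f z \<partial>lborel) + (\<integral>z. ?f (- z) \<partial>lborel)"
    using lborel_integral_reflect(1)[of ?f] by (simp add: flap_def)
  also have "\<dots> = (\<integral>z. ?f z + ?f (- z) \<partial>lborel)"
    using f g by (rule Bochner_Integration.integral_add[symmetric])
  finally show "2 * flap s t w x = (\<integral>z. (2 * w x - w (x + z) - w (x - z)) * tkern s t z \<partial>lborel)"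
    unfolding eq .
qed

text \<open>Raising a function away from x while keeping its value at x lowers the integrand. This
  comparison is what admits positive parts as test functions.\<close>

lemma flap_antimono:
  fixes w :: "'a::euclidean_space \<Rightarrow> real"
  assumes "0 < s" "0 < t"
    and "w \<in> borel_measurable borel" "\<And>y. \<bar>w y\<bar> \<le> B"
    and "w' \<in> borel_measurable borel" "\<And>y. \<bar>w' y\<bar> \<le> B'"
    and "w' x = w x" "\<And>y. w y \<le> w' y"
  shows "flap s t w' x \<le> flap s t w x"
  unfolding flap_def
proof (rule integral_mono)
  show "integrable lborel (\<lambda>z. (w' x - w' (x + z)) * tkern s t z)"
    by (rule flap_integrable(2)[OF assms(1,2,5,6)])
  show "integrable lborel (\<lambda>z. (w x - w (x + z)) * tkern s t z)"
    by (rule flap_integrable(2)[OF assms(1-4)])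
qed (use assms(7,8) in \<open>auto intro!: mult_right_mono tkern_nonneg\<close>)

text \<open>The truncation turns into t / r, which is harmless because the bounds for the two
  profiles hold for every truncation.\<close>

lemma flap_scale:
  fixes w :: "'a::euclidean_space \<Rightarrow> real"
  assumes [measurable]: "w \<in> borel_measurable borel" and r: "0 < r"
  shows "flap s t (\<lambda>y. w (y /\<^sub>R r)) x = r powr (- 2 * s) * flap s (t / r) w (x /\<^sub>R r)"
proof -
  have "flap s t (\<lambda>y. w (y /\<^sub>R r)) x
    = r ^ DIM('a) * (\<integral>z. (w (x /\<^sub>R r) - w ((x + r *\<^sub>R z) /\<^sub>R r)) * tkern s t (r *\<^sub>R z) \<partial>lborel)"
    unfolding flap_def using r by (subst lborel_integral_scale[of _ r]) auto
  also have "(\<lambda>z. (w (x /\<^sub>R r) - w ((x + r *\<^sub>R z) /\<^sub>R r)) * tkern s t (r *\<^sub>R z))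
    = (\<lambda>z. r powr - (real DIM('a) + 2 * s) * ((w (x /\<^sub>R r) - w (x /\<^sub>R r + z)) * tkern s (t / r) z))"
    using r by (simp add: tkern_scale scaleR_add_right fun_eq_iff)
  also have "r ^ DIM('a) * (\<integral>z. r powr - (real DIM('a) + 2 * s) * ((w (x /\<^sub>R r) - w (x /\<^sub>R r + z)) * tkern s (t / r) z) \<partial>lborel)
     = (r ^ DIM('a) * r powr - (real DIM('a) + 2 * s)) * flap s (t / r) w (x /\<^sub>R r)"
    by (simp add: flap_def)
  also have "r ^ DIM('a) * r powr - (real DIM('a) + 2 * s) = r powr (- 2 * s)"
    using r by (simp add: powr_realpow[symmetric] flip: powr_add)
  finally show ?thesis .
qed

section \<open>The torsion function of the unit ball\<close>

definition torsion :: "real \<Rightarrow> 'a::euclidean_space \<Rightarrow> real" where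
  "torsion s x = max 0 (1 - (norm x)\<^sup>2) powr s"

lemma borel_measurable_torsion [measurable]: "torsion s \<in> borel_measurable borel"
  unfolding torsion_def by measurable

lemma torsion_nonneg: "0 \<le> torsion s x"
  by (simp add: torsion_def)

lemma torsion_le_one: "0 < s \<Longrightarrow> torsion s x \<le> 1"
proof -
  assume "0 < s"
  have "max 0 (1 - (norm x)\<^sup>2) \<le> 1" by simp
  with \<open>0 < s\<close> show ?thesis unfolding torsion_def using powr_mono2[of s _ 1] by fastforce
qed

text \<open>By the power of a point, the two pieces of any chord through x have product 1 - |x|^2 =
  m^2. Measuring lengths in units of m thus brings every chord into normalised form, and only k
  depends on the direction.\<close>

lemma torsion_chord:
  fixes x z :: "'a::euclidean_space"
  assumes x: "norm x < 1" and z: "z \<noteq> 0"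
  defines "m \<equiv> sqrt (1 - (norm x)\<^sup>2)"
  shows "torsion s (x + (m / norm z * v) *\<^sub>R z) = m powr (2 * s) * chord s (- 2 * (x \<bullet> z) / (m * norm z)) v"
proof -
  have "(norm x)\<^sup>2 < 1\<^sup>2" using x by (intro power_strict_mono) auto
  hence m: "0 < m" "m\<^sup>2 = 1 - (norm x)\<^sup>2" by (auto simp: m_def)
  have "1 - (norm (x + (m / norm z * v) *\<^sub>R z))\<^sup>2
    = m\<^sup>2 - 2 * (m / norm z * v) * (x \<bullet> z) - (m / norm z * v)\<^sup>2 * (norm z)\<^sup>2"
    unfolding m(2) power2_norm_eq_inner by (simp add: inner_add_left inner_add_right inner_commute power2_eq_square algebra_simps)
  also have "\<dots> = m\<^sup>2 * (1 + (- 2 * (x \<bullet> z) / (m * norm z)) * v - v\<^sup>2)"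
    using m(1) z by (simp add: field_simps power2_eq_square)
  finally have e: "1 - (norm (x + (m / norm z * v) *\<^sub>R z))\<^sup>2 = m\<^sup>2 * (1 + (- 2 * (x \<bullet> z) / (m * norm z)) * v - v\<^sup>2)" .
  have "max 0 (m\<^sup>2 * y) = m\<^sup>2 * max 0 y" for y
    using m(1) by (simp add: max_def zero_le_mult_iff mult_le_0_iff)
  hence "torsion s (x + (m / norm z * v) *\<^sub>R z) = (m\<^sup>2 * max 0 (1 + (- 2 * (x \<bullet> z) / (m * norm z)) * v - v\<^sup>2)) powr s"
    unfolding torsion_def e by simp
  also have "\<dots> = m powr (2 * s) * chord s (- 2 * (x \<bullet> z) / (m * norm z)) v"
    using m(1) by (simp add: powr_mult chord_def powr_powr flip: powr_numeral)
  finally show ?thesis .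
qed

text \<open>In units of m the factor m^(2s) of the torsion function cancels the m^(-2s) of the
  kernel, so each line contributes the one-dimensional defect integral with truncation t / m. Its
  bound depends neither on the direction nor on x, so nothing degenerates as |x| -> 1.\<close>

lemma flap_torsion_bounded:
  assumes s: "0 < s" "s < 1"
  obtains C where "0 \<le> C" "\<And>t (x::'a::euclidean_space). 0 < t \<Longrightarrow> norm x < 1 \<Longrightarrow> flap s t (torsion s) x \<le> C"
proof
  define C1 where "C1 = 1 / s + 1 + 2 * (2 powr (1 - s) / (1 - s) + 2 powr s / s)"
  have C1: "0 \<le> C1" using s by (simp add: C1_def)
  let ?M = "measure lborel {z::'a. 1 \<le> norm z \<and> norm z < 2}"
  \<comment> \<open>The factor \<open>?M / ln 2\<close> comes from averaging over dilations, the
    last 2 from the symmetrised form of the operator.\<close>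
  show "0 \<le> C1 * ?M / ln 2 / 2" using C1 by simp
  fix t :: real and x :: 'a assume t: "0 < t" and x: "norm x < 1"
  define m where "m = sqrt (1 - (norm x)\<^sup>2)"
  have "(norm x)\<^sup>2 < 1\<^sup>2" using x by (intro power_strict_mono) auto
  hence m: "0 < m" "m\<^sup>2 = 1 - (norm x)\<^sup>2" by (auto simp: m_def)
  have tx: "torsion s x = m powr (2 * s)"
  proof -
    have "(m\<^sup>2) powr s = m powr (2 * s)" using m(1) by (simp add: powr_powr flip: powr_numeral)
    moreover have "max 0 (m\<^sup>2) = m\<^sup>2" by simp
    ultimately show ?thesis unfolding torsion_def m(2)[symmetric] by (simp only:)
  qed
  define H where "H z = (2 * torsion s x - torsion s (x + z) - torsion s (x - z)) * tkern s t z" for z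
  have [measurable]: "H \<in> borel_measurable borel" unfolding H_def by measurable
  have bd: "\<bar>torsion s y\<bar> \<le> 1" for y :: 'a using torsion_nonneg[of s y] torsion_le_one[OF s(1), of y] by simp
  note sym = flap_symmetric[OF s(1) t borel_measurable_torsion[of s] flap_integrable(1)[OF s(1) t borel_measurable_torsion[of s] bd], of x, folded H_def]
  have "(\<integral>z. H z \<partial>lborel) \<le> C1 * ?M / ln 2"
  proof (rule lborel_integral_le_radial)
    show "integrable lborel H" using sym(2) by (simp add: H_def[abs_def])
    fix z :: 'a assume z12: "1 \<le> norm z" "norm z < 2"
    have "0 < norm z" using z12 by linarith
    hence z: "1 \<le> norm z" "0 < norm z" "z \<noteq> 0" using z12 by auto
    define c where "c = m / norm z"
    have c: "0 < c" using m z by (auto simp: c_def)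
    define k where "k = - 2 * (x \<bullet> z) / (m * norm z)"
    let ?D = "\<lambda>v. if t / m \<le> v then (2 - chord s k v - chord s k (- v)) * v powr (-1 - 2 * s) else 0"
    have "(\<integral>l. (if 0 < l then l powr (real DIM('a) - 1) else 0) * H (l *\<^sub>R z) \<partial>lborel)
      = c * (\<integral>v. (if 0 < c * v then (c * v) powr (real DIM('a) - 1) else 0) * H ((c * v) *\<^sub>R z) \<partial>lborel)"
      using c by (subst lborel_integral_scale[of _ c]) (auto cong: if_cong)
    also have "(\<lambda>v. (if 0 < c * v then (c * v) powr (real DIM('a) - 1) else 0) * H ((c * v) *\<^sub>R z))
      = (\<lambda>v. (norm z powr - real DIM('a) / c) * ?D v)"
    proof
      fix v
      show "(if 0 < c * v then (c * v) powr (real DIM('a) - 1) else 0) * H ((c * v) *\<^sub>R z)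
        = (norm z powr - real DIM('a) / c) * ?D v"
      proof (cases "t / m \<le> v")
        case True
        have v: "0 < v" using True t m by (smt (verit) divide_pos_pos)
        have nz: "norm ((c * v) *\<^sub>R z) = m * v" using v c z m by (simp add: c_def)
        have T: "torsion s (x + (c * v) *\<^sub>R z) = m powr (2 * s) * chord s k v"
          using torsion_chord[OF x, of z s v] z by (simp add: c_def k_def m_def)
        have T': "torsion s (x - (c * v) *\<^sub>R z) = m powr (2 * s) * chord s k (- v)"
          using torsion_chord[OF x, of z s "- v"] z by (simp add: c_def k_def m_def)
        have tk: "tkern s t ((c * v) *\<^sub>R z) = (m * v) powr - (real DIM('a) + 2 * s)"
          unfolding tkern_def nz using True m by (simp add: field_simps)
        have "(c * v) powr (real DIM('a) - 1) * (m powr (2 * s) * (m * v) powr - (real DIM('a) + 2 * s))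
          = norm z powr - real DIM('a) / c * v powr (-1 - 2 * s)"
        proof -
          have a: "(m * v) powr - (real DIM('a) + 2 * s) = m powr - real DIM('a) * m powr (- (2 * s)) * (v powr - real DIM('a) * v powr (- (2 * s)))"
            using m v by (simp add: powr_mult powr_diff powr_minus_divide powr_add)
          have b: "m = c * norm z" using z by (auto simp: c_def)
          have d: "m powr - real DIM('a) = c powr - real DIM('a) * norm z powr - real DIM('a)"
            unfolding b using c by (simp add: powr_mult)
          have e: "m powr (2 * s) * m powr (- (2 * s)) = 1" using m by (simp flip: powr_add)
          have f: "(c * v) powr (real DIM('a) - 1) = c powr real DIM('a) / c * (v powr real DIM('a) / v)"
            using c v by (simp add: powr_mult powr_diff)
          have g: "y powr real DIM('a) * y powr - real DIM('a) = 1" if "0 < y" for y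
            using that by (simp flip: powr_add)
          have h: "v powr (-1 - 2 * s) = v powr (- (2 * s)) / v" using v by (simp add: powr_diff powr_minus_divide)
          have "(c * v) powr (real DIM('a) - 1) * (m powr (2 * s) * (m * v) powr - (real DIM('a) + 2 * s))
            = (c powr real DIM('a) * c powr - real DIM('a)) * (v powr real DIM('a) * v powr - real DIM('a))
              * (m powr (2 * s) * m powr (- (2 * s))) * norm z powr - real DIM('a) / c * (v powr (- (2 * s)) / v)"
            unfolding a f d by (simp add: mult_ac)
          thus ?thesis unfolding e g[OF c] g[OF v] h by simp
        qed
        moreover have "(if 0 < c * v then (c * v) powr (real DIM('a) - 1) else 0) * H ((c * v) *\<^sub>R z)
          = (2 - chord s k v - chord s k (- v)) * ((c * v) powr (real DIM('a) - 1) * (m powr (2 * s) * (m * v) powr - (real DIM('a) + 2 * s)))"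
          unfolding H_def T T' tk tx using c v by (simp add: algebra_simps)
        ultimately show ?thesis using True by simp
      next
        case False
        have "tkern s t ((c * v) *\<^sub>R z) = 0" if "0 < c * v"
        proof -
          have "norm ((c * v) *\<^sub>R z) = m * v" using that c z m by (simp add: c_def zero_less_mult_iff zero_less_divide_iff)
          thus ?thesis using False m by (simp add: tkern_def field_simps)
        qed
        thus ?thesis using False by (simp add: H_def)
      qed
    qed
    also have "c * (\<integral>v. norm z powr - real DIM('a) / c * ?D v \<partial>lborel) = norm z powr - real DIM('a) * (\<integral>v. ?D v \<partial>lborel)"
      using c by simp
    also have "\<dots> \<le> norm z powr - real DIM('a) * C1"
      using chord_defect_integral_le(1)[OF s, of "t / m" k] t m unfolding C1_def by (intro mult_left_mono) auto
    also have "\<dots> \<le> 1 * C1" using C1 z powr_mono2'[of "- real DIM('a)" 1 "norm z"] by (intro mult_right_mono) auto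
    finally show "(\<integral>l. (if 0 < l then l powr (real DIM('a) - 1) else 0) * H (l *\<^sub>R z) \<partial>lborel) \<le> C1" by simp
  qed
  thus "flap s t (torsion s) x \<le> C1 * ?M / ln 2 / 2"
    using sym(1) by (simp add: H_def[abs_def])
qed

section \<open>The plug around the origin\<close>

definition plug :: "'a::euclidean_space \<Rightarrow> real" where
  "plug x = min 1 ((max 0 (4 - (norm x)\<^sup>2))\<^sup>2)"

lemma borel_measurable_plug [measurable]: "plug \<in> borel_measurable borel"
  unfolding plug_def by measurable

lemma plug_nonneg: "0 \<le> plug x"
  by (simp add: plug_def)

lemma plug_le_one: "plug x \<le> 1"
  by (simp add: plug_def)

lemma plug_eq_one: "norm x \<le> 1 \<Longrightarrow> plug x = 1"
proof -
  assume "norm x \<le> 1"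
  hence "(norm x)\<^sup>2 \<le> 1" by (simp add: power_le_one)
  hence "1 \<le> max 0 (4 - (norm x)\<^sup>2)" by simp
  hence "1 \<le> (max 0 (4 - (norm x)\<^sup>2))\<^sup>2" by (rule one_le_power)
  thus ?thesis by (simp add: plug_def)
qed

lemma plug_eq_zero: "2 \<le> norm x \<Longrightarrow> plug x = 0"
proof -
  assume "2 \<le> norm x"
  hence "2\<^sup>2 \<le> (norm x)\<^sup>2" by (intro power_mono) auto
  thus ?thesis by (simp add: plug_def)
qed

text \<open>The square turns the positive part into a function with second derivative at most 2, and
  the minimum with 1 is inactive at x and only lowers the values at x + z and x - z; both effects
  bound the second difference from above. With |x| <= 3 the linear term satisfies h^2 <= 36 r, and
  74 = 2 * 36 + 2.\<close>

lemma plug_second_difference: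
  fixes x z :: "'a::euclidean_space"
  assumes x: "norm x \<le> 3" "plug x < 1" and z: "norm z \<le> 1"
  shows "plug (x + z) + plug (x - z) - 2 * plug x \<le> 74 * (norm z)\<^sup>2"
proof -
  let ?e = "\<lambda>a::real. (max 0 a)\<^sup>2"
  define a where "a = 4 - (norm x)\<^sup>2"
  define h where "h = 2 * (x \<bullet> z)"
  define r where "r = (norm z)\<^sup>2"
  have taylor: "?e b \<le> ?e a + 2 * max 0 a * (b - a) + (b - a)\<^sup>2" for b
  proof (cases "0 \<le> a")
    case True
    hence "?e a + 2 * max 0 a * (b - a) + (b - a)\<^sup>2 = b\<^sup>2" by (simp add: power2_eq_square algebra_simps)
    thus ?thesis by (simp add: max_def)
  next
    case False
    hence "max 0 b \<le> \<bar>b - a\<bar>" by auto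
    hence "?e b \<le> \<bar>b - a\<bar>\<^sup>2" by (intro power_mono) auto
    thus ?thesis using False by simp
  qed
  have n: "4 - (norm (x + z))\<^sup>2 = a - h - r" "4 - (norm (x - z))\<^sup>2 = a + h - r"
    unfolding a_def h_def r_def power2_norm_eq_inner
    by (simp_all add: inner_add_left inner_add_right inner_diff_left inner_diff_right inner_commute)
  have "plug x = ?e a" using x(2) by (simp add: plug_def a_def min_def split: if_splits)
  moreover have "plug (x + z) \<le> ?e (a - h - r)" "plug (x - z) \<le> ?e (a + h - r)"
    by (simp_all add: plug_def n)
  ultimately have "plug (x + z) + plug (x - z) - 2 * plug x
    \<le> 2 * max 0 a * (- h - r) + (- h - r)\<^sup>2 + (2 * max 0 a * (h - r) + (h - r)\<^sup>2)"
    using taylor[of "a - h - r"] taylor[of "a + h - r"] by (simp add: algebra_simps)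
  also have "\<dots> = 2 * h\<^sup>2 + 2 * r\<^sup>2 - 4 * (max 0 a * r)" by (simp add: power2_eq_square algebra_simps)
  also have "\<dots> \<le> 2 * h\<^sup>2 + 2 * r\<^sup>2" by (simp add: r_def)
  also have "h\<^sup>2 \<le> 36 * r"
  proof -
    have "\<bar>x \<bullet> z\<bar> \<le> norm x * norm z" by (rule Cauchy_Schwarz_ineq2)
    also have "\<dots> \<le> 3 * norm z" using x by (intro mult_right_mono) auto
    finally have "\<bar>x \<bullet> z\<bar>\<^sup>2 \<le> (3 * norm z)\<^sup>2" by (intro power_mono) auto
    thus ?thesis by (simp add: h_def r_def power_mult_distrib)
  qed
  also have "r\<^sup>2 \<le> r"
  proof -
    have "r \<le> 1" using z by (simp add: r_def power_le_one)
    hence "r * r \<le> r * 1" by (intro mult_left_mono) (auto simp: r_def)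
    thus ?thesis by (simp add: power2_eq_square)
  qed
  finally show ?thesis by (simp add: r_def)
qed

lemma norm_powr_second_order:
  fixes z :: "'a::euclidean_space"
  assumes "z \<noteq> 0"
  shows "(norm z)\<^sup>2 * norm z powr - (real DIM('a) + 2 * s) = norm z powr (2 - real DIM('a) - 2 * s)"
proof -
  have "(norm z)\<^sup>2 = norm z powr 2" using assms by simp
  thus ?thesis by (simp only: powr_add[symmetric]) (simp add: algebra_simps)
qed

text \<open>For |x| <= 3 the second differences give a constant, which the factor 3^(N+2s) converts
  into decay. For |x| > 3 the plug vanishes at x, and its support, of volume at most
  \<open>V\<close>, is seen from a distance of at least |x| - 2 >= |x| / 3.\<close>

lemma flap_plug_bounded:
  assumes s: "0 < s" "s < 1"
  obtains C where "0 \<le> C" "\<And>t (x::'a::euclidean_space). 0 < t \<Longrightarrow> 1 \<le> norm x \<Longrightarrow> plug x < 1 \<Longrightarrow>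
    - flap s t plug x \<le> C * norm x powr - (real DIM('a) + 2 * s)"
proof
  let ?e = "- (real DIM('a) + 2 * s)"
  define G where "G z = 74 * (if norm z \<le> 1 then norm z powr (2 - real DIM('a) - 2 * s) else 0) + 2 * tkern s 1 z" for z :: 'a
  have G: "integrable lborel G" unfolding G_def
    using s by (intro Bochner_Integration.integrable_add integrable_mult_right integrable_norm_powr_inside integrable_tkern) auto
  have Gn: "0 \<le> G z" for z unfolding G_def using tkern_nonneg[of s 1 z] by auto
  define K where "K = (\<integral>z. G z \<partial>lborel)"
  have K: "0 \<le> K" unfolding K_def using Gn by simp
  define V where "V = measure lborel (ball (0::'a) 2)"
  show "0 \<le> 3 powr (- ?e) * (K + V)" using K by (simp add: V_def)
  fix t :: real and x :: 'a assume t: "0 < t" and x: "1 \<le> norm x" "plug x < 1"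
  have bd: "\<bar>plug y\<bar> \<le> 1" for y :: 'a using plug_nonneg[of y] plug_le_one[of y] by simp
  note int = flap_integrable[OF s(1) t borel_measurable_plug bd, of x]
  show "- flap s t plug x \<le> 3 powr (- ?e) * (K + V) * norm x powr ?e"
  proof (cases "norm x \<le> 3")
    case True
    note sym = flap_symmetric[OF s(1) t borel_measurable_plug int(1)]
    have "- (2 * flap s t plug x) = (\<integral>z. - ((2 * plug x - plug (x + z) - plug (x - z)) * tkern s t z) \<partial>lborel)"
      unfolding sym(1) by simp
    also have "\<dots> \<le> (\<integral>z. G z \<partial>lborel)"
    proof (rule integral_mono)
      show "integrable lborel (\<lambda>z. - ((2 * plug x - plug (x + z) - plug (x - z)) * tkern s t z))" using sym(2) by simp
      fix z :: 'a
      show "- ((2 * plug x - plug (x + z) - plug (x - z)) * tkern s t z) \<le> G z"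
      proof (cases "norm z \<le> 1")
        case z: True
        show ?thesis
        proof (cases "t \<le> norm z")
          case tz: True
          have z0: "0 < norm z" using tz t by linarith
          have "- ((2 * plug x - plug (x + z) - plug (x - z)) * tkern s t z)
            = (plug (x + z) + plug (x - z) - 2 * plug x) * norm z powr ?e"
            using tz by (simp add: tkern_def algebra_simps)
          also have "\<dots> \<le> 74 * (norm z)\<^sup>2 * norm z powr ?e"
            using plug_second_difference[OF True x(2) z] by (intro mult_right_mono) auto
          also have "\<dots> = 74 * norm z powr (2 - real DIM('a) - 2 * s)"
            using norm_powr_second_order[of z s] z0 by simp
          also have "\<dots> \<le> G z" using z tkern_nonneg[of s 1 z] by (simp add: G_def)
          finally show ?thesis .
        next
          case False
          thus ?thesis using Gn[of z] by (simp add: tkern_def)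
        qed
      next
        case False
        have "- ((2 * plug x - plug (x + z) - plug (x - z)) * tkern s t z)
          = (plug (x + z) + plug (x - z) - 2 * plug x) * tkern s t z" by (simp add: algebra_simps)
        also have "\<dots> \<le> 2 * tkern s t z"
          using plug_le_one[of "x + z"] plug_le_one[of "x - z"] plug_nonneg[of x] tkern_nonneg[of s t z]
          by (intro mult_right_mono) auto
        also have "\<dots> \<le> 2 * tkern s 1 z" using False by (simp add: tkern_def)
        finally show ?thesis using False by (simp add: G_def)
      qed
    qed (rule G)
    finally have "- flap s t plug x \<le> K" using K by (simp add: K_def)
    also have "K \<le> (K + V) * (3 powr (- ?e) * norm x powr ?e)"
    proof -
      have "3 powr ?e \<le> norm x powr ?e" using True x s by (intro powr_mono2') auto
      hence "3 powr (- ?e) * 3 powr ?e \<le> 3 powr (- ?e) * norm x powr ?e" by (intro mult_left_mono) auto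
      moreover have "3 powr (- ?e) * 3 powr ?e = 1" by (simp flip: powr_add)
      ultimately have "1 \<le> 3 powr (- ?e) * norm x powr ?e" by linarith
      hence "(K + V) * 1 \<le> (K + V) * (3 powr (- ?e) * norm x powr ?e)"
        using K by (intro mult_left_mono) (auto simp: V_def)
      moreover have "K \<le> (K + V) * 1" by (simp add: V_def)
      ultimately show ?thesis by (rule order_trans[rotated])
    qed
    finally show ?thesis by (simp add: mult_ac)
  next
    case False
    have px: "plug x = 0" by (rule plug_eq_zero) (use False in simp)
    have "- flap s t plug x = (\<integral>z. plug (x + z) * tkern s t z \<partial>lborel)"
      unfolding flap_def px by simp
    also have "\<dots> \<le> (\<integral>z. (norm x / 3) powr ?e * indicator (ball (- x) 2) z \<partial>lborel)"
    proof (rule integral_mono)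
      show "integrable lborel (\<lambda>z. (norm x / 3) powr ?e * indicator (ball (- x) 2) z)"
        using emeasure_lborel_ball_finite by (intro integrable_mult_right integrable_real_indicator) auto
      fix z
      show "plug (x + z) * tkern s t z \<le> (norm x / 3) powr ?e * indicator (ball (- x) 2) z"
      proof (cases "norm (x + z) < 2")
        case True
        have "norm x \<le> norm (x + z) + norm z" using norm_triangle_ineq[of "x + z" "- z"] by simp
        hence z: "norm x / 3 \<le> norm z" using True False by simp
        have "plug (x + z) * tkern s t z \<le> 1 * norm z powr ?e"
          using plug_le_one[of "x + z"] tkern_nonneg by (intro mult_mono) (auto simp: tkern_def)
        also have "\<dots> \<le> (norm x / 3) powr ?e" using z False s by (simp, intro powr_mono2') auto
        finally show ?thesis using True by (simp add: dist_norm norm_minus_commute[of "- x" z] add.commute)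
      next
        case False
        thus ?thesis using plug_eq_zero[of "x + z"] by simp
      qed
    qed (rule int(1))
    also have "\<dots> = (norm x / 3) powr ?e * measure lborel (ball (- x) 2)" by simp
    also have "measure lborel (ball (- x) 2) = V"
      using content_ball_conv_unit_ball[of 2 "- x"] content_ball_conv_unit_ball[of 2 "0::'a"] by (simp add: V_def)
    also have "(norm x / 3) powr ?e * V = V * (3 powr (- ?e) * norm x powr ?e)"
    proof -
      have "(norm x / 3) powr ?e = norm x powr ?e / 3 powr ?e" by (simp add: powr_divide)
      also have "\<dots> = norm x powr ?e * 3 powr (- ?e)" by (simp only: powr_minus divide_inverse)
      finally show ?thesis by (simp only: mult_ac)
    qed
    also have "\<dots> \<le> (K + V) * (3 powr (- ?e) * norm x powr ?e)"
      using K by (intro mult_right_mono) auto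
    finally show ?thesis by (simp add: mult_ac)
  qed
qed

section \<open>Duality\<close>

definition cutoff :: "real \<Rightarrow> real \<Rightarrow> real \<Rightarrow> 'a::euclidean_space \<Rightarrow> real" where
  "cutoff s R e x = max 0 (torsion s (x /\<^sub>R R) - plug (x /\<^sub>R e))"

lemma borel_measurable_cutoff [measurable]: "cutoff s R e \<in> borel_measurable borel"
  unfolding cutoff_def by measurable

lemma cutoff_bounds:
  assumes "0 < s"
  shows "0 \<le> cutoff s R e x" "cutoff s R e x \<le> 1"
  using torsion_le_one[OF assms, of "x /\<^sub>R R"] plug_nonneg[of "x /\<^sub>R e"] by (auto simp: cutoff_def)

text \<open>Where the cutoff is positive, x / R lies in the open unit ball, x / e outside it, and
  the plug is below 1: these are the side conditions of the two profile bounds.\<close>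

lemma cutoff_pos:
  assumes "0 < s" "0 < R" "0 < e" "cutoff s R e x \<noteq> 0"
  shows "e < norm x" "norm x < R" "plug (x /\<^sub>R e) < 1"
proof -
  have *: "plug (x /\<^sub>R e) < torsion s (x /\<^sub>R R)" using assms(4) by (simp add: cutoff_def max_def split: if_splits)
  hence "0 < torsion s (x /\<^sub>R R)" using plug_nonneg[of "x /\<^sub>R e"] by linarith
  hence "(norm (x /\<^sub>R R))\<^sup>2 < 1\<^sup>2" by (simp add: torsion_def)
  hence "norm (x /\<^sub>R R) < 1" by (rule power_less_imp_less_base) simp
  thus "norm x < R" using assms by (simp add: field_simps)
  show p: "plug (x /\<^sub>R e) < 1" using * torsion_le_one[OF assms(1), of "x /\<^sub>R R"] by linarith
  have "\<not> norm (x /\<^sub>R e) \<le> 1" using plug_eq_one[of "x /\<^sub>R e"] p by linarith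
  thus "e < norm x" using assms by (simp add: field_simps)
qed

lemma flap_diff:
  fixes w :: "'a::euclidean_space \<Rightarrow> real"
  assumes "0 < s" "0 < t"
    and "w \<in> borel_measurable borel" "\<And>y. \<bar>w y\<bar> \<le> B"
    and "w' \<in> borel_measurable borel" "\<And>y. \<bar>w' y\<bar> \<le> B'"
  shows "flap s t (\<lambda>y. w y - w' y) x = flap s t w x - flap s t w' x"
proof -
  have "(\<lambda>z. (w x - w' x - (w (x + z) - w' (x + z))) * tkern s t z)
    = (\<lambda>z. (w x - w (x + z)) * tkern s t z - (w' x - w' (x + z)) * tkern s t z)"
    by (simp add: fun_eq_iff algebra_simps)
  thus ?thesis unfolding flap_def
    using Bochner_Integration.integral_diff[OF flap_integrable(2)[OF assms(1-4)] flap_integrable(2)[OF assms(1,2,5,6)]]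
    by simp
qed

lemma flap_cutoff_bounded:
  assumes s: "0 < s" "s < 1"
  obtains C where "0 < C" "\<And>t R e (x::'a::euclidean_space). 0 < t \<Longrightarrow> 0 < R \<Longrightarrow> 0 < e \<Longrightarrow> cutoff s R e x \<noteq> 0 \<Longrightarrow>
    flap s t (cutoff s R e) x \<le> C * (R powr (- 2 * s) + e powr (- 2 * s) * (norm x / e) powr - (real DIM('a) + 2 * s))"
proof -
  obtain C1 where C1: "0 \<le> C1" "\<And>t (x::'a::euclidean_space). 0 < t \<Longrightarrow> norm x < 1 \<Longrightarrow> flap s t (torsion s) x \<le> C1"
    using flap_torsion_bounded[OF s, where 'a = 'a] by metis
  obtain C2 where C2: "0 \<le> C2" "\<And>t (x::'a::euclidean_space). 0 < t \<Longrightarrow> 1 \<le> norm x \<Longrightarrow> plug x < 1 \<Longrightarrow>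
    - flap s t plug x \<le> C2 * norm x powr - (real DIM('a) + 2 * s)"
    using flap_plug_bounded[OF s, where 'a = 'a] by metis
  show thesis
  proof (rule that)
    show "0 < C1 + C2 + 1" using C1 C2 by simp
    fix t R e :: real and x :: 'a
    assume t: "0 < t" and R: "0 < R" and e: "0 < e" and x: "cutoff s R e x \<noteq> 0"
    note p = cutoff_pos[OF s(1) R e x]
    define w1 where "w1 = (\<lambda>y::'a. torsion s (y /\<^sub>R R))"
    define w2 where "w2 = (\<lambda>y::'a. plug (y /\<^sub>R e))"
    have [measurable]: "w1 \<in> borel_measurable borel" "w2 \<in> borel_measurable borel"
      unfolding w1_def w2_def by measurable
    have b1: "\<bar>w1 y\<bar> \<le> 1" and b2: "\<bar>w2 y\<bar> \<le> 1" for y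
      using torsion_nonneg[of s "y /\<^sub>R R"] torsion_le_one[OF s(1), of "y /\<^sub>R R"] plug_nonneg[of "y /\<^sub>R e"] plug_le_one[of "y /\<^sub>R e"]
      by (simp_all add: w1_def w2_def)
    have b3: "\<bar>w1 y - w2 y\<bar> \<le> 2" and b4: "\<bar>cutoff s R e y\<bar> \<le> 1" for y :: 'a
      using b1[of y] b2[of y] cutoff_bounds[OF s(1), of R e y] by linarith+
    let ?T = "R powr (- 2 * s)" and ?P = "e powr (- 2 * s) * (norm x / e) powr - (real DIM('a) + 2 * s)"
    \<comment> \<open>At x the positive part is active and elsewhere it lies above the difference,
      so comparison leaves one rescaled torsion term and one rescaled plug term.\<close>
    have "flap s t (cutoff s R e) x \<le> flap s t (\<lambda>y. w1 y - w2 y) x"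
      by (rule flap_antimono[OF s(1) t _ b3 _ b4])
        (use x in \<open>auto simp: cutoff_def w1_def w2_def max_def split: if_splits\<close>)
    also have "\<dots> = flap s t w1 x - flap s t w2 x"
      by (rule flap_diff[OF s(1) t _ b1 _ b2]) auto
    also have "flap s t w1 x = ?T * flap s (t / R) (torsion s) (x /\<^sub>R R)"
      unfolding w1_def by (rule flap_scale) (use R in auto)
    also have "\<dots> \<le> ?T * C1"
      using p t R by (intro mult_left_mono C1) (auto simp: field_simps)
    also have "flap s t w2 x = e powr (- 2 * s) * flap s (t / e) plug (x /\<^sub>R e)"
      unfolding w2_def by (rule flap_scale) (use e in auto)
    also have "?T * C1 - e powr (- 2 * s) * flap s (t / e) plug (x /\<^sub>R e)
       = ?T * C1 + e powr (- 2 * s) * (- flap s (t / e) plug (x /\<^sub>R e))" by simp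
    also have "\<dots> \<le> ?T * C1 + e powr (- 2 * s) * (C2 * norm (x /\<^sub>R e) powr - (real DIM('a) + 2 * s))"
      using p t e by (intro add_left_mono mult_left_mono C2) (auto simp: field_simps)
    also have "\<dots> = C1 * ?T + C2 * ?P"
      using e by (simp add: divide_inverse_commute)
    also have "\<dots> \<le> (C1 + C2 + 1) * ?T + (C1 + C2 + 1) * ?P"
      using C1 C2 by (intro add_mono mult_right_mono) auto
    finally show "flap s t (cutoff s R e) x \<le> (C1 + C2 + 1) * (?T + ?P)"
      by (simp add: algebra_simps)
  qed
qed

section \<open>Symmetry of the truncated operator against weighted L^1 functions\<close>

lemma integrable_lborel_product:
  fixes f g :: "'a::euclidean_space \<Rightarrow> real"
  assumes f: "integrable lborel f" and g: "integrable lborel g"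
  shows "integrable (lborel \<Otimes>\<^sub>M lborel) (\<lambda>(x, y). f x * g y)"
proof (rule lborel_pair.Fubini_integrable)
  show "(\<lambda>(x, y). f x * g y) \<in> borel_measurable (lborel \<Otimes>\<^sub>M lborel)"
    using borel_measurable_integrable[OF f] borel_measurable_integrable[OF g] by measurable
  show "integrable lborel (\<lambda>x. \<integral>y. norm (case (x, y) of (x, y) \<Rightarrow> f x * g y) \<partial>lborel)"
    using f by (simp add: abs_mult)
  show "AE x in lborel. integrable lborel (\<lambda>y. case (x, y) of (x, y) \<Rightarrow> f x * g y)"
    using g by simp
qed

text \<open>For |x| <= 1 one has 1 + |y| <= 2 + |y - x|, and 2 <= (2 / t) |y - x| where the kernel
  does not vanish. So the weighted L^1 norm controls all truncated integrals; the factor blows up as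
  t -> 0, but it is only used at a fixed truncation.\<close>

lemma tkern_le_weight:
  fixes x y :: "'a::euclidean_space"
  assumes "0 < s" "0 < t" "norm x \<le> 1"
  shows "tkern s t (y - x) \<le> (1 + 2 / t) powr (real DIM('a) + 2 * s) * (1 + norm y) powr - (real DIM('a) + 2 * s)"
proof (cases "t \<le> norm (y - x)")
  case True
  let ?e = "real DIM('a) + 2 * s"
  have "norm y \<le> norm (y - x) + norm x" using norm_triangle_ineq[of "y - x" x] by simp
  moreover have "2 \<le> 2 / t * norm (y - x)" using True assms by (simp add: field_simps)
  ultimately have "1 + norm y \<le> (1 + 2 / t) * norm (y - x)" using assms by (simp add: algebra_simps)
  hence "((1 + 2 / t) * norm (y - x)) powr - ?e \<le> (1 + norm y) powr - ?e"
    using assms norm_ge_zero[of y] by (intro powr_mono2') (auto simp: add_pos_nonneg)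
  hence "(1 + 2 / t) powr ?e * ((1 + 2 / t) powr - ?e * norm (y - x) powr - ?e) \<le> (1 + 2 / t) powr ?e * (1 + norm y) powr - ?e"
    using assms by (intro mult_left_mono) (auto simp: powr_mult)
  moreover have "(1 + 2 / t) powr ?e * (1 + 2 / t) powr - ?e = 1"
    using assms by (simp add: add_pos_pos less_imp_neq[symmetric] flip: powr_add)
  ultimately have "norm (y - x) powr - ?e \<le> (1 + 2 / t) powr ?e * (1 + norm y) powr - ?e"
    by (simp only: mult.assoc[symmetric])
  thus ?thesis using True by (simp add: tkern_def)
qed (simp add: tkern_def)

lemma flap_translate:
  fixes v :: "'a::euclidean_space \<Rightarrow> real"
  assumes [measurable]: "v \<in> borel_measurable borel"
  shows "flap s t v x = (\<integral>y. (v x - v y) * tkern s t (y - x) \<partial>lborel)"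
  using lborel_integral_translate(1)[of "\<lambda>y. (v x - v y) * tkern s t (y - x)" x]
  by (simp add: flap_def)

locale weighted_L1 =
  fixes s :: real and v :: "'a::euclidean_space \<Rightarrow> real"
  assumes s: "0 < s" and v_measurable [measurable]: "v \<in> borel_measurable borel"
    and v_weight: "integrable lborel (\<lambda>x. v x * (1 + norm x) powr - (real DIM('a) + 2 * s))"
begin

lemma tkern_integrable:
  assumes "0 < t" "norm x \<le> 1"
  shows "integrable lborel (\<lambda>y. v y * tkern s t (y - x))"
    and "integrable lborel (\<lambda>z. v (x + z) * tkern s t z)"
proof -
  let ?e = "real DIM('a) + 2 * s"
  show i: "integrable lborel (\<lambda>y. v y * tkern s t (y - x))"
  proof (rule Bochner_Integration.integrable_bound)
    show "integrable lborel (\<lambda>y. (1 + 2 / t) powr ?e * (v y * (1 + norm y) powr - ?e))"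
      using v_weight by simp
    show "AE y in lborel. norm (v y * tkern s t (y - x)) \<le> norm ((1 + 2 / t) powr ?e * (v y * (1 + norm y) powr - ?e))"
    proof (rule AE_I2)
      fix y
      have "\<bar>v y\<bar> * tkern s t (y - x) \<le> \<bar>v y\<bar> * ((1 + 2 / t) powr ?e * (1 + norm y) powr - ?e)"
        using tkern_le_weight[OF s assms] by (intro mult_left_mono) auto
      thus "norm (v y * tkern s t (y - x)) \<le> norm ((1 + 2 / t) powr ?e * (v y * (1 + norm y) powr - ?e))"
        by (simp add: abs_mult tkern_nonneg mult_ac)
    qed
  qed measurable
  show "integrable lborel (\<lambda>z. v (x + z) * tkern s t z)"
    using lborel_integral_translate(2)[of "\<lambda>y. v y * tkern s t (y - x)" x] i by simp
qed

lemma integrable_unit_ball: "integrable lborel (\<lambda>x. if norm x < 1 then v x else 0)"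
proof (rule Bochner_Integration.integrable_bound)
  let ?e = "real DIM('a) + 2 * s"
  show "integrable lborel (\<lambda>x. 2 powr ?e * (v x * (1 + norm x) powr - ?e))" using v_weight by simp
  show "AE x in lborel. norm (if norm x < 1 then v x else 0) \<le> norm (2 powr ?e * (v x * (1 + norm x) powr - ?e))"
  proof (rule AE_I2)
    fix x :: 'a
    have "1 \<le> 2 powr ?e * (1 + norm x) powr - ?e" if "norm x < 1"
    proof -
      have "2 powr - ?e \<le> (1 + norm x) powr - ?e" using that s norm_ge_zero[of x] by (intro powr_mono2') (auto simp: add_pos_nonneg)
      hence "2 powr ?e * 2 powr - ?e \<le> 2 powr ?e * (1 + norm x) powr - ?e" by (intro mult_left_mono) auto
      thus ?thesis by (simp flip: powr_add)
    qed
    hence "\<bar>v x\<bar> * 1 \<le> \<bar>v x\<bar> * (2 powr ?e * (1 + norm x) powr - ?e)" if "norm x < 1"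
      using that by (intro mult_left_mono) auto
    thus "norm (if norm x < 1 then v x else 0) \<le> norm (2 powr ?e * (v x * (1 + norm x) powr - ?e))"
      by (auto simp: abs_mult mult_ac)
  qed
qed measurable

text \<open>Truncation makes the parts with \<open>v x\<close> and with \<open>v y\<close> of the
  double integral separately integrable, one through the integral of the kernel, the other through
  the weight. Exchanging x and y in the second part moves the operator from v to \<psi>, the kernel
  being even.\<close>

lemma flap_duality:
  assumes [measurable]: "\<psi> \<in> borel_measurable borel"
    and \<psi>: "\<And>x. \<bar>\<psi> x\<bar> \<le> 1" "\<And>x. \<psi> x \<noteq> 0 \<Longrightarrow> norm x < 1" and t: "0 < t"
  shows "integrable lborel (\<lambda>x. \<psi> x * flap s t v x)" "integrable lborel (\<lambda>x. v x * flap s t \<psi> x)"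
    and "(\<integral>x. \<psi> x * flap s t v x \<partial>lborel) = (\<integral>x. v x * flap s t \<psi> x \<partial>lborel)"
proof -
  let ?e = "real DIM('a) + 2 * s"
  let ?P = "lborel \<Otimes>\<^sub>M lborel :: ('a \<times> 'a) measure"
  have \<psi>i: "integrable lborel \<psi>"
  proof (rule Bochner_Integration.integrable_bound)
    show "integrable lborel (indicat_real (ball (0::'a) 1))"
      using emeasure_lborel_ball_finite by (intro integrable_real_indicator) auto
    show "AE x in lborel. norm (\<psi> x) \<le> norm (indicat_real (ball 0 1) x)"
      using \<psi> by (force simp: indicator_def)
  qed measurable
  have \<psi>v: "integrable lborel (\<lambda>x. \<psi> x * v x)"
  proof (rule Bochner_Integration.integrable_bound[OF integrable_unit_ball])
    show "AE x in lborel. norm (\<psi> x * v x) \<le> norm (if norm x < 1 then v x else 0)"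
    proof (rule AE_I2)
      fix x
      show "norm (\<psi> x * v x) \<le> norm (if norm x < 1 then v x else 0)"
        using \<psi>(1)[of x] \<psi>(2)[of x] mult_right_mono[OF \<psi>(1)[of x], of "\<bar>v x\<bar>"]
        by (cases "\<psi> x = 0") (auto simp: abs_mult)
    qed
  qed measurable
  define F1 where "F1 = (\<lambda>(x, y). \<psi> x * v x * tkern s t (y - x))"
  define F2 where "F2 = (\<lambda>(x, y). \<psi> x * v y * tkern s t (y - x))"
  have [measurable]: "F1 \<in> borel_measurable ?P" "F2 \<in> borel_measurable ?P"
    unfolding F1_def F2_def by measurable
  have tk: "integrable lborel (\<lambda>y. tkern s t (y - x))" "(\<integral>y. tkern s t (y - x) \<partial>lborel) = (\<integral>y. tkern s t (y::'a) \<partial>lborel)" for x :: 'a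
    using lborel_integral_translate[of "tkern s t" "- x"] integrable_tkern[OF s t] by (auto simp: add.commute[of "- x"])
  have F1: "integrable ?P F1"
  proof (rule lborel_pair.Fubini_integrable)
    have "(\<integral>y. norm (F1 (x, y)) \<partial>lborel) = \<bar>\<psi> x * v x\<bar> * (\<integral>y. tkern s t (y::'a) \<partial>lborel)" for x
      using tk(2)[of x] by (simp add: F1_def abs_mult tkern_nonneg)
    thus "integrable lborel (\<lambda>x. \<integral>y. norm (F1 (x, y)) \<partial>lborel)" using \<psi>v by simp
    show "AE x in lborel. integrable lborel (\<lambda>y. F1 (x, y))" using tk(1) by (simp add: F1_def)
  qed measurable
  have F2: "integrable ?P F2"
  proof (rule Bochner_Integration.integrable_bound)
    show "integrable ?P (\<lambda>(x, y). \<psi> x * ((1 + 2 / t) powr ?e * (v y * (1 + norm y) powr - ?e)))"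
      using \<psi>i v_weight by (intro integrable_lborel_product) auto
    have "norm (F2 (x, y)) \<le> norm (\<psi> x * ((1 + 2 / t) powr ?e * (v y * (1 + norm y) powr - ?e)))" for x y
    proof (cases "\<psi> x = 0")
      case False
      have "\<bar>\<psi> x * v y\<bar> * tkern s t (y - x) \<le> \<bar>\<psi> x * v y\<bar> * ((1 + 2 / t) powr ?e * (1 + norm y) powr - ?e)"
        using tkern_le_weight[OF s t, of x y] \<psi>(2)[OF False] by (intro mult_left_mono) auto
      thus ?thesis by (simp add: F2_def abs_mult tkern_nonneg mult_ac)
    qed (simp add: F2_def)
    thus "AE x in ?P. norm (F2 x) \<le> norm (case x of (x, y) \<Rightarrow> \<psi> x * ((1 + 2 / t) powr ?e * (v y * (1 + norm y) powr - ?e)))"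
      by (auto simp: split_beta)
  qed measurable
  have F2s: "integrable ?P (\<lambda>(x, y). F2 (y, x))"
    using F2 by (rule lborel_pair.integrable_product_swap)
  have e1: "\<psi> x * flap s t v x = (\<integral>y. F1 (x, y) - F2 (x, y) \<partial>lborel)" for x
    unfolding flap_translate[OF v_measurable] by (simp add: F1_def F2_def left_diff_distrib right_diff_distrib mult_ac flip: integral_mult_right_zero)
  have e2: "v x * flap s t \<psi> x = (\<integral>y. F1 (x, y) - (case (x, y) of (x, y) \<Rightarrow> F2 (y, x)) \<partial>lborel)" for x
  proof -
    have "tkern s t (x - y) = tkern s t (y - x)" for y using tkern_minus[of s t "x - y"] by simp
    thus ?thesis unfolding flap_translate[OF assms(1)]
      by (simp add: F1_def F2_def left_diff_distrib right_diff_distrib mult_ac flip: integral_mult_right_zero)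
  qed
  have d1: "integrable ?P (\<lambda>p. F1 p - F2 p)" using F1 F2 by simp
  have d2: "integrable ?P (\<lambda>p. F1 p - (case p of (x, y) \<Rightarrow> F2 (y, x)))" using F1 F2s by simp
  show "integrable lborel (\<lambda>x. \<psi> x * flap s t v x)" unfolding e1
    using lborel_pair.integrable_fst'[OF d1] .
  show "integrable lborel (\<lambda>x. v x * flap s t \<psi> x)" unfolding e2
    using lborel_pair.integrable_fst'[OF d2] .
  have "(\<integral>x. \<psi> x * flap s t v x \<partial>lborel) = (\<integral>p. F1 p - F2 p \<partial>?P)"
    unfolding e1 using lborel_pair.integral_fst'[OF d1] .
  also have "\<dots> = (\<integral>p. F1 p - (case p of (x, y) \<Rightarrow> F2 (y, x)) \<partial>?P)"
    using F1 F2 F2s lborel_pair.integral_product_swap[of F2] by simp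
  also have "\<dots> = (\<integral>x. v x * flap s t \<psi> x \<partial>lborel)"
    unfolding e2 using lborel_pair.integral_fst'[OF d2] by simp
  finally show "(\<integral>x. \<psi> x * flap s t v x \<partial>lborel) = (\<integral>x. v x * flap s t \<psi> x \<partial>lborel)" .
qed

text \<open>Inside radius \<delta> the second differences tame the kernel because s < 1; outside,
  the kernel is at most the one truncated at \<delta>, whose integrals the weighted norm controls. L
  depends on v and serves as the constant for dominated convergence.\<close>

lemma flap_uniformly_bounded:
  assumes s1: "s < 1" and \<delta>: "0 < \<delta>" "\<delta> \<le> 1"
    and K: "\<And>x. x \<in> K \<Longrightarrow> norm x \<le> 1" "\<And>x. x \<in> K \<Longrightarrow> \<bar>v x\<bar> \<le> B"
    and M: "\<And>x z. x \<in> K \<Longrightarrow> norm z < \<delta> \<Longrightarrow> \<bar>2 * v x - v (x + z) - v (x - z)\<bar> \<le> M * (norm z)\<^sup>2"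
  obtains L where "\<And>t x. 0 < t \<Longrightarrow> x \<in> K \<Longrightarrow> \<bar>flap s t v x\<bar> \<le> L"
proof
  let ?e = "real DIM('a) + 2 * s"
  let ?I = "\<integral>z. (if norm z \<le> 1 then norm (z::'a) powr (2 - real DIM('a) - 2 * s) else 0) \<partial>lborel"
  let ?W = "\<integral>y. (1 + 2 / \<delta>) powr ?e * \<bar>v y * (1 + norm y) powr - ?e\<bar> \<partial>lborel"
  let ?T = "\<integral>z. tkern s \<delta> (z::'a) \<partial>lborel"
  fix t :: real and x assume t: "0 < t" and x: "x \<in> K"
  interpret abs: weighted_L1 s "\<lambda>x. \<bar>v x\<bar>"
  proof
    show "integrable lborel (\<lambda>x. \<bar>v x\<bar> * (1 + norm x) powr - (real DIM('a) + 2 * s))"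
      using integrable_abs[OF v_weight] by (simp add: abs_mult)
  qed (use s in auto)
  have nx: "norm x \<le> 1" using K x by simp
  note i1 = abs.tkern_integrable(2)[OF \<delta>(1) nx]
  have W: "(\<integral>z. \<bar>v (x + z)\<bar> * tkern s \<delta> z \<partial>lborel) \<le> ?W"
  proof -
    have "(\<integral>z. \<bar>v (x + z)\<bar> * tkern s \<delta> z \<partial>lborel) = (\<integral>y. \<bar>v y\<bar> * tkern s \<delta> (y - x) \<partial>lborel)"
      using lborel_integral_translate(1)[of "\<lambda>y. \<bar>v y\<bar> * tkern s \<delta> (y - x)" x] by simp
    also have "\<dots> \<le> ?W"
    proof (rule integral_mono[OF abs.tkern_integrable(1)[OF \<delta>(1) nx]])
      show "integrable lborel (\<lambda>y. (1 + 2 / \<delta>) powr ?e * \<bar>v y * (1 + norm y) powr - ?e\<bar>)"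
        using v_weight by auto
      fix y
      have "\<bar>v y\<bar> * tkern s \<delta> (y - x) \<le> \<bar>v y\<bar> * ((1 + 2 / \<delta>) powr ?e * (1 + norm y) powr - ?e)"
        using tkern_le_weight[OF s \<delta>(1) nx] by (intro mult_left_mono) auto
      thus "\<bar>v y\<bar> * tkern s \<delta> (y - x) \<le> (1 + 2 / \<delta>) powr ?e * \<bar>v y * (1 + norm y) powr - ?e\<bar>"
        by (simp add: abs_mult mult_ac)
    qed
    finally show ?thesis .
  qed
  have i2: "integrable lborel (\<lambda>z. \<bar>v (x - z)\<bar> * tkern s \<delta> z)"
    and e2: "(\<integral>z. \<bar>v (x - z)\<bar> * tkern s \<delta> z \<partial>lborel) = (\<integral>z. \<bar>v (x + z)\<bar> * tkern s \<delta> z \<partial>lborel)"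
    using lborel_integral_reflect[of "\<lambda>z. \<bar>v (x + z)\<bar> * tkern s \<delta> z"] i1 by (auto simp: tkern_minus)
  note sym = flap_symmetric[OF s t v_measurable tkern_integrable(2)[OF t nx]]
  let ?G = "\<lambda>z. \<bar>M\<bar> * (if norm z \<le> 1 then norm (z::'a) powr (2 - real DIM('a) - 2 * s) else 0)
    + (2 * \<bar>B\<bar> * tkern s \<delta> z + (\<bar>v (x + z)\<bar> * tkern s \<delta> z + \<bar>v (x - z)\<bar> * tkern s \<delta> z))"
  have iI: "integrable lborel (\<lambda>z::'a. if norm z \<le> 1 then norm z powr (2 - real DIM('a) - 2 * s) else 0)"
    by (rule integrable_norm_powr_inside) (use s1 in simp)
  have iG: "integrable lborel ?G"
    using i1 i2 iI integrable_tkern[OF s \<delta>(1)] by (intro Bochner_Integration.integrable_add integrable_mult_right) auto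
  have "2 * \<bar>flap s t v x\<bar> = \<bar>\<integral>z. (2 * v x - v (x + z) - v (x - z)) * tkern s t z \<partial>lborel\<bar>"
    using sym(1) by (simp flip: sym(1))
  also have "\<dots> \<le> (\<integral>z. \<bar>(2 * v x - v (x + z) - v (x - z)) * tkern s t z\<bar> \<partial>lborel)"
    by (rule integral_abs_bound)
  also have "\<dots> \<le> (\<integral>z. ?G z \<partial>lborel)"
  proof (rule integral_mono[OF integrable_abs[OF sym(2)] iG])
    fix z :: 'a
    have tn: "0 \<le> tkern s \<delta> z" by (rule tkern_nonneg)
    have Gn: "0 \<le> ?G z" using tn by (auto intro!: add_nonneg_nonneg mult_nonneg_nonneg)
    show "\<bar>(2 * v x - v (x + z) - v (x - z)) * tkern s t z\<bar> \<le> ?G z"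
    proof (cases "t \<le> norm z")
      case tz: True
      show ?thesis
      proof (cases "norm z < \<delta>")
        case True
        have z0: "0 < norm z" using tz t by linarith
        have "\<bar>(2 * v x - v (x + z) - v (x - z)) * tkern s t z\<bar> \<le> (\<bar>M\<bar> * (norm z)\<^sup>2) * norm z powr - ?e"
          using M[OF x True] tz by (auto simp: tkern_def abs_mult intro!: mult_right_mono elim!: order_trans)
        also have "\<dots> = \<bar>M\<bar> * norm z powr (2 - real DIM('a) - 2 * s)"
          using norm_powr_second_order[of z s] z0 by simp
        finally show ?thesis using True \<delta> tn by (simp add: add_increasing2)
      next
        case False
        have "\<bar>(2 * v x - v (x + z) - v (x - z)) * tkern s t z\<bar> \<le> (2 * \<bar>B\<bar> + \<bar>v (x + z)\<bar> + \<bar>v (x - z)\<bar>) * tkern s \<delta> z"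
          using K(2)[OF x] tz False by (auto simp: tkern_def abs_mult intro!: mult_right_mono)
        also have "\<dots> = 2 * \<bar>B\<bar> * tkern s \<delta> z + (\<bar>v (x + z)\<bar> * tkern s \<delta> z + \<bar>v (x - z)\<bar> * tkern s \<delta> z)"
          by (simp add: algebra_simps)
        finally show ?thesis by (simp add: add_increasing)
      qed
    next
      case False
      thus ?thesis using Gn by (simp add: tkern_def)
    qed
  qed
  also have "\<dots> = \<bar>M\<bar> * ?I + (2 * \<bar>B\<bar> * ?T + ((\<integral>z. \<bar>v (x + z)\<bar> * tkern s \<delta> z \<partial>lborel) + (\<integral>z. \<bar>v (x - z)\<bar> * tkern s \<delta> z \<partial>lborel)))"
    using i1 i2 iI integrable_tkern[OF s \<delta>(1), where 'a = 'a]
    by (simp only: Bochner_Integration.integral_add Bochner_Integration.integrable_add integrable_mult_right integral_mult_right_zero)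
  also have "\<dots> \<le> \<bar>M\<bar> * ?I + (2 * \<bar>B\<bar> * ?T + (?W + ?W))"
    unfolding e2 using W by simp
  finally show "\<bar>flap s t v x\<bar> \<le> (\<bar>M\<bar> * ?I + (2 * \<bar>B\<bar> * ?T + (?W + ?W))) / 2" by simp
qed

text \<open>Duality holds at every truncation. The majorant on the right is free of t, so only the
  left side has to converge, which it does dominated by a multiple of the indicator of the unit
  ball.\<close>

lemma test_function_inequality:
  assumes v0: "\<And>x. 0 \<le> v x"
    and [measurable]: "\<psi> \<in> borel_measurable borel"
    and \<psi>: "\<And>x. 0 \<le> \<psi> x" "\<And>x. \<psi> x \<le> 1" "\<And>x. \<psi> x \<noteq> 0 \<Longrightarrow> norm x < 1"
    and L: "\<And>t x. 0 < t \<Longrightarrow> \<psi> x \<noteq> 0 \<Longrightarrow> \<bar>flap s t v x\<bar> \<le> L"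
    and lim: "\<And>x. \<psi> x \<noteq> 0 \<Longrightarrow> ((\<lambda>t. flap s t v x) \<longlongrightarrow> f x) (at_right 0)"
    and G: "\<And>t x. 0 < t \<Longrightarrow> \<psi> x \<noteq> 0 \<Longrightarrow> flap s t \<psi> x \<le> G x"
    and int: "integrable lborel (\<lambda>x. if \<psi> x \<noteq> 0 then v x * G x else 0)"
  shows "integrable lborel (\<lambda>x. \<psi> x * f x)"
    and "(\<integral>x. \<psi> x * f x \<partial>lborel) \<le> (\<integral>x. (if \<psi> x \<noteq> 0 then v x * G x else 0) \<partial>lborel)"
proof -
  define t where "t n = inverse (real (Suc n))" for n
  have t: "0 < t n" for n by (simp add: t_def)
  have \<psi>': "\<bar>\<psi> x\<bar> \<le> 1" for x using \<psi> by simp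
  note dual = flap_duality[OF assms(2) \<psi>' \<psi>(3) t]
  have t0: "filterlim t (at_right 0) sequentially"
    unfolding t_def[abs_def] filterlim_at using LIMSEQ_inverse_real_of_nat by (auto simp: filterlim_at)
  have conv: "(\<lambda>n. \<psi> x * flap s (t n) v x) \<longlonglongrightarrow> \<psi> x * f x" for x
    by (cases "\<psi> x = 0") (auto intro!: tendsto_intros filterlim_compose[OF lim t0])
  have m: "(\<lambda>x. \<psi> x * flap s (t n) v x) \<in> borel_measurable lborel" for n
    using dual(1) by auto
  have m': "(\<lambda>x. \<psi> x * f x) \<in> borel_measurable lborel"
    by (rule borel_measurable_LIMSEQ_real[OF conv m])
  have iw: "integrable lborel (\<lambda>x. \<bar>L\<bar> * indicat_real (ball (0::'a) 1) x)"
    using emeasure_lborel_ball_finite by (intro integrable_mult_right integrable_real_indicator) auto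
  have bd: "AE x in lborel. norm (\<psi> x * flap s (t n) v x) \<le> \<bar>L\<bar> * indicat_real (ball (0::'a) 1) x" for n
  proof (rule AE_I2)
    fix x
    show "norm (\<psi> x * flap s (t n) v x) \<le> \<bar>L\<bar> * indicat_real (ball (0::'a) 1) x"
    proof (cases "\<psi> x = 0")
      case False
      have "\<bar>\<psi> x\<bar> * \<bar>flap s (t n) v x\<bar> \<le> 1 * \<bar>L\<bar>"
        using \<psi>' order_trans[OF L[OF t False] abs_ge_self] by (intro mult_mono) auto
      thus ?thesis using \<psi>(3)[OF False] by (simp add: abs_mult)
    qed simp
  qed
  show "integrable lborel (\<lambda>x. \<psi> x * f x)"
    by (rule integrable_dominated_convergence[OF m' m iw _ bd]) (rule AE_I2, rule conv)
  have "(\<lambda>n. \<integral>x. \<psi> x * flap s (t n) v x \<partial>lborel) \<longlonglongrightarrow> (\<integral>x. \<psi> x * f x \<partial>lborel)"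
    by (rule integral_dominated_convergence[OF m' m iw _ bd]) (rule AE_I2, rule conv)
  moreover have "(\<integral>x. \<psi> x * flap s (t n) v x \<partial>lborel) \<le> (\<integral>x. (if \<psi> x \<noteq> 0 then v x * G x else 0) \<partial>lborel)" for n
  proof -
    have "(\<integral>x. v x * flap s (t n) \<psi> x \<partial>lborel) \<le> (\<integral>x. (if \<psi> x \<noteq> 0 then v x * G x else 0) \<partial>lborel)"
    proof (rule Bochner_Integration.integral_mono[OF dual(2) int])
      fix x
      show "v x * flap s (t n) \<psi> x \<le> (if \<psi> x \<noteq> 0 then v x * G x else 0)"
      proof (cases "\<psi> x = 0")
        case True
        have "flap s (t n) \<psi> x = - (\<integral>z. \<psi> (x + z) * tkern s (t n) z \<partial>lborel)"
          unfolding flap_def True by simp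
        also have "\<dots> \<le> 0" by (simp, intro Bochner_Integration.integral_nonneg mult_nonneg_nonneg \<psi>(1) tkern_nonneg)
        finally show ?thesis using v0[of x] True by (simp add: mult_nonneg_nonpos)
      next
        case False
        thus ?thesis using G[OF t False] v0[of x] by (simp add: mult_left_mono)
      qed
    qed
    thus ?thesis by (subst dual(3))
  qed
  ultimately show "(\<integral>x. \<psi> x * f x \<partial>lborel) \<le> (\<integral>x. (if \<psi> x \<noteq> 0 then v x * G x else 0) \<partial>lborel)"
    by (intro LIMSEQ_le_const2) auto
qed

end

section \<open>The energy estimate\<close>

lemma integrable_lborel_scale:
  fixes H :: "'a::euclidean_space \<Rightarrow> real"
  assumes H: "integrable lborel H" and c: "c \<noteq> 0"
  shows "integrable lborel (\<lambda>x. H (c *\<^sub>R x))"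
proof -
  have [measurable]: "H \<in> borel_measurable borel" using H by auto
  have "integrable (density (distr lborel borel (\<lambda>x. 0 + c *\<^sub>R x)) (\<lambda>_. ennreal (\<bar>c\<bar>^DIM('a)))) H"
    using lborel_affine[OF c, of "0::'a"] H by simp
  hence "integrable (distr lborel borel (\<lambda>x. 0 + c *\<^sub>R x)) (\<lambda>x. \<bar>c\<bar>^DIM('a) *\<^sub>R H x)"
    by (subst (asm) integrable_density) auto
  hence "integrable (distr lborel borel (\<lambda>x. c *\<^sub>R x)) H" using c by simp
  thus ?thesis by (subst (asm) integrable_distr_eq) auto
qed

lemma norm_powr_inside_scaled:
  fixes a R :: real
  assumes "a > - real DIM('a::euclidean_space)" and R: "0 < R"
  shows "integrable lborel (\<lambda>x::'a. if norm x \<le> R then norm x powr a else 0)"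
    and "(\<integral>x. (if norm (x::'a) \<le> R then norm x powr a else 0) \<partial>lborel)
      = R powr (real DIM('a) + a) * (\<integral>x. (if norm (x::'a) \<le> 1 then norm x powr a else 0) \<partial>lborel)"
proof -
  define g where "g x = (if norm x \<le> 1 then norm x powr a else 0)" for x :: 'a
  have [measurable]: "g \<in> borel_measurable borel" unfolding g_def by measurable
  have eq: "(if norm x \<le> R then norm x powr a else 0) = R powr a * g ((1 / R) *\<^sub>R x)" for x :: 'a
    using R by (simp add: g_def powr_divide)
  have "integrable lborel g" unfolding g_def[abs_def] by (rule integrable_norm_powr_inside) fact
  from integrable_lborel_scale[OF this, of "1 / R"] R
  show "integrable lborel (\<lambda>x::'a. if norm x \<le> R then norm x powr a else 0)"
    unfolding eq by simp
  have "(\<integral>x. g ((1 / R) *\<^sub>R x) \<partial>lborel) = R ^ DIM('a) * (\<integral>x. g x \<partial>lborel)"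
    using R by (subst lborel_integral_scale[of _ R]) auto
  thus "(\<integral>x. (if norm (x::'a) \<le> R then norm x powr a else 0) \<partial>lborel)
      = R powr (real DIM('a) + a) * (\<integral>x. (if norm (x::'a) \<le> 1 then norm x powr a else 0) \<partial>lborel)"
    unfolding eq using R by (simp add: g_def[symmetric] powr_add powr_realpow)
qed

lemma norm_powr_outside_scaled:
  fixes a R :: real
  assumes "a < - real DIM('a::euclidean_space)" and R: "0 < R"
  shows "integrable lborel (\<lambda>x::'a. if R \<le> norm x then norm x powr a else 0)"
    and "(\<integral>x. (if R \<le> norm (x::'a) then norm x powr a else 0) \<partial>lborel)
      = R powr (real DIM('a) + a) * (\<integral>x. (if 1 \<le> norm (x::'a) then norm x powr a else 0) \<partial>lborel)"
proof -
  define g where "g x = (if 1 \<le> norm x then norm x powr a else 0)" for x :: 'a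
  have [measurable]: "g \<in> borel_measurable borel" unfolding g_def by measurable
  have eq: "(if R \<le> norm x then norm x powr a else 0) = R powr a * g ((1 / R) *\<^sub>R x)" for x :: 'a
    using R by (simp add: g_def powr_divide)
  have "integrable lborel g" unfolding g_def[abs_def] by (rule integrable_norm_powr_outside) fact
  from integrable_lborel_scale[OF this, of "1 / R"] R
  show "integrable lborel (\<lambda>x::'a. if R \<le> norm x then norm x powr a else 0)"
    unfolding eq by simp
  have "(\<integral>x. g ((1 / R) *\<^sub>R x) \<partial>lborel) = R ^ DIM('a) * (\<integral>x. g x \<partial>lborel)"
    using R by (subst lborel_integral_scale[of _ R]) auto
  thus "(\<integral>x. (if R \<le> norm (x::'a) then norm x powr a else 0) \<partial>lborel)
      = R powr (real DIM('a) + a) * (\<integral>x. (if 1 \<le> norm (x::'a) then norm x powr a else 0) \<partial>lborel)"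
    unfolding eq using R by (simp add: g_def[symmetric] powr_add powr_realpow)
qed

text \<open>Fatou's lemma, arranged so that a uniform bound also yields integrability of the
  limit.\<close>

lemma integral_bound_limit:
  fixes f :: "nat \<Rightarrow> 'b \<Rightarrow> real"
  assumes f: "\<And>n. integrable M (f n)" "\<And>n x. 0 \<le> f n x" "\<And>n. (\<integral>x. f n x \<partial>M) \<le> C"
    and lim: "\<And>x. (\<lambda>n. f n x) \<longlonglongrightarrow> g x"
  shows "integrable M g" "(\<integral>x. g x \<partial>M) \<le> C"
proof -
  have [measurable]: "f n \<in> borel_measurable M" for n using f(1) by auto
  have [measurable]: "g \<in> borel_measurable M" by (rule borel_measurable_LIMSEQ_real[OF lim]) auto
  have g0: "0 \<le> g x" for x by (rule LIMSEQ_le_const[OF lim]) (use f(2) in auto)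
  have C: "0 \<le> C" by (rule order_trans[OF Bochner_Integration.integral_nonneg f(3)[of 0]]) (rule f(2))
  have "(\<integral>\<^sup>+x. ennreal (g x) \<partial>M) = (\<integral>\<^sup>+x. liminf (\<lambda>n. ennreal (f n x)) \<partial>M)"
  proof (rule nn_integral_cong)
    fix x
    have "(\<lambda>n. ennreal (f n x)) \<longlonglongrightarrow> ennreal (g x)" using lim by (intro tendsto_ennrealI)
    thus "ennreal (g x) = liminf (\<lambda>n. ennreal (f n x))" by (rule lim_imp_Liminf[symmetric, rotated]) simp
  qed
  also have "\<dots> \<le> liminf (\<lambda>n. \<integral>\<^sup>+x. ennreal (f n x) \<partial>M)" by (rule nn_integral_liminf) auto
  also have "\<dots> \<le> liminf (\<lambda>n. ennreal C)"
    by (intro Liminf_mono always_eventually allI) (use f in \<open>auto simp: nn_integral_eq_integral intro!: ennreal_leI\<close>)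
  also have "\<dots> = ennreal C" by (simp add: Liminf_const)
  finally have le: "(\<integral>\<^sup>+x. ennreal (g x) \<partial>M) \<le> ennreal C" .
  show i: "integrable M g" by (rule integrableI_nonneg) (use le g0 in \<open>auto simp: le_less_trans\<close>)
  have "ennreal (\<integral>x. g x \<partial>M) \<le> ennreal C" using nn_integral_eq_integral[OF i] g0 le by simp
  thus "(\<integral>x. g x \<partial>M) \<le> C" using C by (simp add: ennreal_le_iff)
qed

text \<open>Convexity of the m-th power is concavity of its inverse: the tangent bound for the
  exponent 1 / m is applied to (b / a)^m.\<close>

lemma powr_tangent_le:
  fixes a b m :: real
  assumes "0 < a" "0 \<le> b" "1 < m"
  shows "a powr m - b powr m \<le> m * a powr (m - 1) * (a - b)"
proof -
  define y where "y = (b / a) powr m"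
  have "y powr (1 / m) \<le> 1 + (1 / m) * (y - 1)" using assms by (intro powr_le_tangent) (auto simp: y_def)
  moreover have "y powr (1 / m) = b / a" using assms by (simp add: y_def powr_powr)
  ultimately have "m * (b / a - 1) \<le> y - 1" using assms by (simp add: field_simps)
  hence "a powr m * (m * (b / a - 1)) \<le> a powr m * (y - 1)" using assms by (intro mult_left_mono) auto
  moreover have "a powr m * y = b powr m" using assms by (simp add: y_def powr_divide)
  moreover have "a powr m = a powr (m - 1) * a" using assms by (simp add: powr_diff)
  ultimately have "a powr (m - 1) * a * (m * (b / a - 1)) \<le> b powr m - a powr m"
    by (simp add: right_diff_distrib)
  moreover have "a powr (m - 1) * a * (m * (b / a - 1)) = - (m * a powr (m - 1) * (a - b))"
    using assms by (simp add: field_simps)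
  ultimately show ?thesis by linarith
qed

text \<open>The convexity inequality of Cordoba and Cordoba, valid at each truncation because the
  kernel is nonnegative. The factor w^(m-1) it leaves is the one that Young's inequality will
  need.\<close>

lemma flap_powr_le:
  fixes w :: "'a::euclidean_space \<Rightarrow> real"
  assumes s: "0 < s" "0 < t" and [measurable]: "w \<in> borel_measurable borel"
    and w: "\<And>y. 0 \<le> w y" "\<And>y. w y \<le> 1" and x: "w x \<noteq> 0" and m: "1 < m"
  shows "flap s t (\<lambda>y. w y powr m) x \<le> m * w x powr (m - 1) * flap s t w x"
proof -
  have b: "\<bar>w y\<bar> \<le> 1" for y using w by simp
  have b': "\<bar>w y powr m\<bar> \<le> 1" for y using w[of y] m powr_mono2[of m "w y" 1] by simp
  have i1: "integrable lborel (\<lambda>z. (w x powr m - w (x + z) powr m) * tkern s t z)"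
    by (rule flap_integrable(2)[OF s _ b']) measurable
  have i2: "integrable lborel (\<lambda>z. m * w x powr (m - 1) * ((w x - w (x + z)) * tkern s t z))"
    by (rule integrable_mult_right[OF flap_integrable(2)[OF s _ b]]) measurable
  have "flap s t (\<lambda>y. w y powr m) x \<le> (\<integral>z. m * w x powr (m - 1) * ((w x - w (x + z)) * tkern s t z) \<partial>lborel)"
    unfolding flap_def
  proof (rule Bochner_Integration.integral_mono[OF i1 i2])
    fix z
    have "w x powr m - w (x + z) powr m \<le> m * w x powr (m - 1) * (w x - w (x + z))"
      by (rule powr_tangent_le) (use w(1)[of x] x w(1) m in \<open>auto simp: less_le\<close>)
    hence "(w x powr m - w (x + z) powr m) * tkern s t z \<le> m * w x powr (m - 1) * (w x - w (x + z)) * tkern s t z"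
      by (rule mult_right_mono[OF _ tkern_nonneg])
    thus "(w x powr m - w (x + z) powr m) * tkern s t z \<le> m * w x powr (m - 1) * ((w x - w (x + z)) * tkern s t z)"
      by (simp add: mult.assoc)
  qed
  thus ?thesis by (simp add: flap_def)
qed

text \<open>Here \<open>c\<close> is the normalisation constant of the fractional Laplacian, which \<open>flap\<close> omits.\<close>

locale punctured_ball_solution = weighted_L1 s v
  for s :: real and v :: "'a::euclidean_space \<Rightarrow> real" +
  fixes \<theta> p c :: real
  assumes s1: "s < 1" and c: "0 < c" and v_nonneg: "\<And>x. 0 \<le> v x"
    and second_difference: "\<And>e R. 0 < e \<Longrightarrow> R < 1 \<Longrightarrow> \<exists>\<delta> M B. 0 < \<delta> \<and> \<delta> \<le> 1 \<and>
      (\<forall>x. e \<le> norm x \<and> norm x \<le> R \<longrightarrow> \<bar>v x\<bar> \<le> B \<and>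
        (\<forall>z. norm z < \<delta> \<longrightarrow> \<bar>2 * v x - v (x + z) - v (x - z)\<bar> \<le> M * (norm z)\<^sup>2))"
    and equation: "\<And>x. 0 < norm x \<Longrightarrow> norm x < 1 \<Longrightarrow>
      ((\<lambda>t. flap s t v x) \<longlongrightarrow> norm x powr \<theta> * v x powr p / c) (at_right 0)"
begin

section \<open>Testing the equation\<close>

definition source :: "'a \<Rightarrow> real" where
  "source x = norm x powr \<theta> * v x powr p"

lemma source_nonneg: "0 \<le> source x"
  by (simp add: source_def)

lemma borel_measurable_source [measurable]: "source \<in> borel_measurable borel"
  unfolding source_def by measurable

text \<open>The support of \<psi> lies in a compact annulus of the punctured ball, where second
  differences of v are bounded, so the limit of the truncated operators is legitimate. The bound
  \<open>B\<close> is qualitative: what enters the final inequality is G itself.\<close>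

lemma source_test:
  assumes e: "0 < e" and R: "R < 1" and [measurable]: "\<psi> \<in> borel_measurable borel" "G \<in> borel_measurable borel"
    and \<psi>: "\<And>x. 0 \<le> \<psi> x" "\<And>x. \<psi> x \<le> 1" "\<And>x. \<psi> x \<noteq> 0 \<Longrightarrow> e \<le> norm x \<and> norm x \<le> R"
    and G: "\<And>t x. 0 < t \<Longrightarrow> \<psi> x \<noteq> 0 \<Longrightarrow> flap s t \<psi> x \<le> G x"
    and Gb: "\<And>x. \<psi> x \<noteq> 0 \<Longrightarrow> \<bar>G x\<bar> \<le> B"
  shows "integrable lborel (\<lambda>x. \<psi> x * source x)"
    and "integrable lborel (\<lambda>x. if \<psi> x \<noteq> 0 then v x * G x else 0)"
    and "(\<integral>x. \<psi> x * source x \<partial>lborel) \<le> c * (\<integral>x. (if \<psi> x \<noteq> 0 then v x * G x else 0) \<partial>lborel)"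
proof -
  obtain \<delta> M A where d: "0 < \<delta>" "\<delta> \<le> 1" and A: "\<And>x. e \<le> norm x \<Longrightarrow> norm x \<le> R \<Longrightarrow> \<bar>v x\<bar> \<le> A"
    and M: "\<And>x z. e \<le> norm x \<Longrightarrow> norm x \<le> R \<Longrightarrow> norm z < \<delta> \<Longrightarrow> \<bar>2 * v x - v (x + z) - v (x - z)\<bar> \<le> M * (norm z)\<^sup>2"
    using second_difference[OF e R] by blast
  obtain L where L: "\<And>t x. 0 < t \<Longrightarrow> x \<in> {x. e \<le> norm x \<and> norm x \<le> R} \<Longrightarrow> \<bar>flap s t v x\<bar> \<le> L"
    by (rule flap_uniformly_bounded[OF s1 d, of "{x. e \<le> norm x \<and> norm x \<le> R}" A M]) (use R A M in auto)
  show int: "integrable lborel (\<lambda>x. if \<psi> x \<noteq> 0 then v x * G x else 0)"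
  proof (rule Bochner_Integration.integrable_bound[OF integrable_mult_right[OF integrable_unit_ball, of "\<bar>B\<bar>"]])
    show "AE x in lborel. norm (if \<psi> x \<noteq> 0 then v x * G x else 0) \<le> norm (\<bar>B\<bar> * (if norm x < 1 then v x else 0))"
    proof (rule AE_I2)
      fix x
      show "norm (if \<psi> x \<noteq> 0 then v x * G x else 0) \<le> norm (\<bar>B\<bar> * (if norm x < 1 then v x else 0))"
      proof (cases "\<psi> x = 0")
        case False
        have "\<bar>v x\<bar> * \<bar>G x\<bar> \<le> \<bar>v x\<bar> * \<bar>B\<bar>" using Gb[OF False] by (intro mult_left_mono) auto
        thus ?thesis using False \<psi>(3)[OF False] R by (simp add: abs_mult mult.commute)
      qed simp
    qed
  qed measurable
  note T = test_function_inequality[OF v_nonneg assms(3) \<psi>(1,2), of L "\<lambda>x. source x / c" G, OF _ _ _ G int]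
  have T1: "norm x < 1" if "\<psi> x \<noteq> 0" for x using \<psi>(3)[OF that] R by simp
  have T2: "\<bar>flap s t v x\<bar> \<le> L" if "0 < t" "\<psi> x \<noteq> 0" for t x using L[OF that(1)] \<psi>(3)[OF that(2)] by simp
  have T3: "((\<lambda>t. flap s t v x) \<longlongrightarrow> source x / c) (at_right 0)" if "\<psi> x \<noteq> 0" for x
    unfolding source_def using \<psi>(3)[OF that] e R by (intro equation) auto
  have "integrable lborel (\<lambda>x. \<psi> x * (source x / c))" using T(1)[OF T1 T2 T3] by blast
  from integrable_mult_right[OF this, of c] show "integrable lborel (\<lambda>x. \<psi> x * source x)" using c by simp
  have "(\<integral>x. \<psi> x * (source x / c) \<partial>lborel) \<le> (\<integral>x. (if \<psi> x \<noteq> 0 then v x * G x else 0) \<partial>lborel)"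
    using T(2)[OF T1 T2 T3] by blast
  thus "(\<integral>x. \<psi> x * source x \<partial>lborel) \<le> c * (\<integral>x. (if \<psi> x \<noteq> 0 then v x * G x else 0) \<partial>lborel)"
    using c by (simp add: field_simps)
qed

text \<open>On the supports of the approximating cutoffs the operator is bounded by one constant K,
  so the tested energies are at most c K times the integral of v over the unit ball. This depends on
  v, which is enough for a qualitative statement; Fatou's lemma then reaches R = 1.\<close>

lemma source_weighted_integrable_aux:
  "integrable lborel (\<lambda>x. cutoff s 1 (1/8) x * source x)"
proof -
  obtain C where C: "0 < C" "\<And>t R e (x::'a). 0 < t \<Longrightarrow> 0 < R \<Longrightarrow> 0 < e \<Longrightarrow> cutoff s R e x \<noteq> 0 \<Longrightarrow>
    flap s t (cutoff s R e) x \<le> C * (R powr (- 2 * s) + e powr (- 2 * s) * (norm x / e) powr - (real DIM('a) + 2 * s))"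
    by (rule flap_cutoff_bounded[OF s s1, where 'a = 'a]) blast
  define K where "K = C * (2 powr (2 * s) + 8 powr (2 * s))"
  have K: "0 \<le> K" using C by (simp add: K_def)
  \<comment> \<open>Starting at 1/2 keeps \<open>R n powr (- 2 * s)\<close> below 2^(2s); the
    summand 8^(2s) in \<open>K\<close> belongs to the plug of scale 1/8.\<close>
  define R where "R n = 1 - inverse (real (Suc (Suc n)))" for n
  have R: "1/2 \<le> R n" "R n < 1" for n by (auto simp: R_def field_simps)
  note cb = cutoff_bounds[OF s] and cp = cutoff_pos[OF s]
  have fl: "flap s t (cutoff s (R n) (1/8)) x \<le> K" if "0 < t" "cutoff s (R n) (1/8) x \<noteq> 0" for t n and x :: 'a
  proof -
    have "0 < R n" using R[of n] by simp
    note q = cp[OF this _ that(2)]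
    have "flap s t (cutoff s (R n) (1/8)) x \<le> C * (R n powr (- 2 * s) + (1/8) powr (- 2 * s) * (norm x / (1/8)) powr - (real DIM('a) + 2 * s))"
      by (rule C(2)) (use that R[of n] in auto)
    also have "\<dots> \<le> C * ((1/2) powr (- 2 * s) + (1/8) powr (- 2 * s) * 1)"
    proof (intro mult_left_mono add_mono)
      show "R n powr (- 2 * s) \<le> (1/2) powr (- 2 * s)" using R[of n] s by (intro powr_mono2') auto
      have "(norm x / (1/8)) powr - (real DIM('a) + 2 * s) \<le> 1 powr - (real DIM('a) + 2 * s)"
        using q s by (intro powr_mono2') auto
      thus "(norm x / (1/8)) powr - (real DIM('a) + 2 * s) \<le> 1" by simp
    qed (use C in auto)
    also have "\<dots> = K" by (simp add: K_def powr_divide powr_minus_divide)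
    finally show ?thesis .
  qed
  have sup: "1/8 \<le> norm x \<and> norm x \<le> R n" if "cutoff s (R n) (1/8) x \<noteq> 0" for n and x :: 'a
    using cp[OF _ _ that] R[of n] by simp
  have m: "(cutoff s (R n) (1/8) :: 'a \<Rightarrow> real) \<in> borel_measurable borel" "(\<lambda>_::'a. K) \<in> borel_measurable borel" for n
    by measurable
  have T: "integrable lborel (\<lambda>x. cutoff s (R n) (1/8) x * source x)"
    "integrable lborel (\<lambda>x. if cutoff s (R n) (1/8) x \<noteq> 0 then v x * K else 0)"
    "(\<integral>x. cutoff s (R n) (1/8) x * source x \<partial>lborel) \<le> c * (\<integral>x. (if cutoff s (R n) (1/8) x \<noteq> 0 then v x * K else 0) \<partial>lborel)" for n
    subgoal by (rule source_test(1)[where e = "1/8" and R = "R n" and \<psi> = "cutoff s (R n) (1/8)" and G = "\<lambda>_. K" and B = "\<bar>K\<bar>", OF _ R(2) m]; (rule cb | erule sup | erule (1) fl | simp))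
    subgoal by (rule source_test(2)[where e = "1/8" and R = "R n" and \<psi> = "cutoff s (R n) (1/8)" and G = "\<lambda>_. K" and B = "\<bar>K\<bar>", OF _ R(2) m]; (rule cb | erule sup | erule (1) fl | simp))
    subgoal by (rule source_test(3)[where e = "1/8" and R = "R n" and \<psi> = "cutoff s (R n) (1/8)" and G = "\<lambda>_. K" and B = "\<bar>K\<bar>", OF _ R(2) m]; (rule cb | erule sup | erule (1) fl | simp))
    done
  have bound: "(\<integral>x. cutoff s (R n) (1/8) x * source x \<partial>lborel) \<le> c * (\<integral>x. K * (if norm x < 1 then v x else 0) \<partial>lborel)" for n
  proof (rule order_trans[OF T(3) mult_left_mono])
    show "(\<integral>x. (if cutoff s (R n) (1/8) x \<noteq> 0 then v x * K else 0) \<partial>lborel) \<le> (\<integral>x. K * (if norm x < 1 then v x else 0) \<partial>lborel)"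
    proof (rule Bochner_Integration.integral_mono[OF T(2) integrable_mult_right[OF integrable_unit_ball]])
      fix x :: 'a
      have "norm x < 1" if "cutoff s (R n) (1/8) x \<noteq> 0" using cp(2)[OF _ _ that] R[of n] by simp
      thus "(if cutoff s (R n) (1/8) x \<noteq> 0 then v x * K else 0) \<le> K * (if norm x < 1 then v x else 0)"
        using K v_nonneg[of x] by (simp add: mult.commute)
    qed
  qed (use c in simp)
  have Rl: "R \<longlonglongrightarrow> 1"
    unfolding R_def using tendsto_diff[OF tendsto_const[of 1] LIMSEQ_Suc[OF LIMSEQ_inverse_real_of_nat]] by simp
  have lim: "(\<lambda>n. cutoff s (R n) (1/8) x * source x) \<longlonglongrightarrow> cutoff s 1 (1/8) x * source x" for x
  proof -
    have "(\<lambda>n. x /\<^sub>R R n) \<longlonglongrightarrow> x /\<^sub>R 1" by (intro tendsto_intros Rl) simp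
    moreover have "continuous_on UNIV (torsion s :: 'a \<Rightarrow> real)"
      unfolding torsion_def by (rule continuous_on_powr') (use s in \<open>auto intro!: continuous_intros\<close>)
    ultimately have "(\<lambda>n. torsion s (x /\<^sub>R R n)) \<longlonglongrightarrow> torsion s (x /\<^sub>R 1)"
      by (auto intro: continuous_on_tendsto_compose)
    thus ?thesis unfolding cutoff_def by (intro tendsto_intros)
  qed
  show ?thesis
    by (rule integral_bound_limit(1)[OF T(1) _ bound lim]) (simp add: cb source_nonneg)
qed

end

text \<open>C is fixed before v, R and e, and no norm of v occurs: Young's inequality trades the
  linear occurrence of v on the right for a fraction 1 / p of the energy on the left plus a pure
  power integral.\<close>

lemma source_energy_bound:
  fixes s \<theta> p c :: real
  assumes s: "0 < s" "s < 1" and N: "2 * s < real DIM('a::euclidean_space)" and \<theta>: "- 2 * s < \<theta>"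
    and p: "(real DIM('a) + \<theta>) / (real DIM('a) - 2 * s) \<le> p" and c: "0 < c"
  defines "m \<equiv> p / (p - 1)" and "\<gamma> \<equiv> real DIM('a) - (\<theta> + 2 * s * p) / (p - 1)"
  obtains C where "0 < C"
    "\<And>(v::'a \<Rightarrow> real) R e. punctured_ball_solution s v \<theta> p c \<Longrightarrow> 0 < e \<Longrightarrow> e < R \<Longrightarrow> R < 1 \<Longrightarrow>
      integrable lborel (\<lambda>x. cutoff s R e x powr m * punctured_ball_solution.source v \<theta> p x) \<and>
      (\<integral>x. cutoff s R e x powr m * punctured_ball_solution.source v \<theta> p x \<partial>lborel) \<le> C * R powr \<gamma>"
proof -
  obtain C where C: "0 < C" "\<And>t R e (x::'a). 0 < t \<Longrightarrow> 0 < R \<Longrightarrow> 0 < e \<Longrightarrow> cutoff s R e x \<noteq> 0 \<Longrightarrow>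
    flap s t (cutoff s R e) x \<le> C * (R powr (- 2 * s) + e powr (- 2 * s) * (norm x / e) powr - (real DIM('a) + 2 * s))"
    by (rule flap_cutoff_bounded[OF s, where 'a = 'a]) blast
  have Np: "real DIM('a) + \<theta> \<le> p * (real DIM('a) - 2 * s)" using p N by (simp add: field_simps)
  have p1: "1 < p"
  proof -
    have "1 < (real DIM('a) + \<theta>) / (real DIM('a) - 2 * s)" using N \<theta> by (simp add: field_simps)
    thus ?thesis using p by linarith
  qed
  have m1: "1 < m" and m: "m - 1 = 1 / (p - 1)" "m / p = m - 1" "1 / p + 1 / m = 1"
    using p1 by (simp_all add: m_def field_simps)
  \<comment> \<open>Young's inequality will raise |x|^(-\<theta>/p) to the power m, which produces
    |x|^(-a).\<close>
  define a where "a = \<theta> / (p - 1)"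
  have \<gamma>0: "0 \<le> \<gamma>" using Np p1 by (simp add: \<gamma>_def field_simps)
  have \<gamma>_eq: "\<gamma> = real DIM('a) - a - 2 * s * m"
    using p1 by (simp add: \<gamma>_def a_def m_def add_divide_distrib)
  have a1: "- a > - real DIM('a)"
  proof -
    have "0 < 2 * s * m" using s m1 by simp
    thus ?thesis using \<gamma>0 \<gamma>_eq by linarith
  qed
  \<comment> \<open>The exponent of the plug term after Young's inequality. It has to be integrable
    at infinity, which rests on \<theta> + 2 s p > 0, whereas -a has to be integrable at 0, which
    rests on \<gamma> >= 0.\<close>
  define b where "b = - ((real DIM('a) + 2 * s) * m) - a"
  have b1: "b < - real DIM('a)"
  proof -
    have "0 < a + 2 * s * m"
    proof -
      have "a + 2 * s * m = (\<theta> + 2 * s * p) / (p - 1)" using p1 by (simp add: a_def m_def add_divide_distrib)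
      moreover have "2 * s * 1 < 2 * s * p" using p1 s by (intro mult_strict_left_mono) auto
      ultimately show ?thesis using \<theta> p1 by simp
    qed
    moreover have "real DIM('a) \<le> real DIM('a) * m" using m1 by simp
    moreover have "b = - (real DIM('a) * m) - 2 * s * m - a" by (simp add: b_def algebra_simps)
    ultimately show ?thesis by linarith
  qed
  define I1 where "I1 = (\<integral>x. (if norm (x::'a) \<le> 1 then norm x powr (- a) else 0) \<partial>lborel)"
  define I2 where "I2 = (\<integral>x. (if 1 \<le> norm (x::'a) then norm x powr b else 0) \<partial>lborel)"
  have I: "0 \<le> I1" "0 \<le> I2" unfolding I1_def I2_def by (auto intro!: Bochner_Integration.integral_nonneg)
  \<comment> \<open>The 2 comes from (A1 + A2)^m <= 2^m (A1^m + A2^m); the other factors are the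
    normalisation c, the m of the convexity inequality and the C of the cutoff bound.\<close>
  define D where "D = (2 * c * m * C) powr m"
  show thesis
  proof (rule that)
    show "0 < D * (I1 + I2) + 1" using I by (simp add: D_def add_nonneg_pos)
    fix v :: "'a \<Rightarrow> real" and R e :: real
    assume sol: "punctured_ball_solution s v \<theta> p c" and e: "0 < e" "e < R" and R: "R < 1"
    interpret punctured_ball_solution s v \<theta> p c by (rule sol)
    have R0: "0 < R" using e by simp
    define w where "w = (cutoff s R e :: 'a \<Rightarrow> real)"
    have [measurable]: "w \<in> borel_measurable borel" by (simp add: w_def)
    have w: "0 \<le> w x" "w x \<le> 1" for x using cutoff_bounds[OF s(1)] by (auto simp: w_def)
    have wp: "e < norm x" "norm x < R" if "w x \<noteq> 0" for x
      using cutoff_pos[OF s(1) R0 e(1)] that by (auto simp: w_def)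
    define E where "E x = R powr (- 2 * s) + e powr (- 2 * s) * (norm x / e) powr - (real DIM('a) + 2 * s)" for x :: 'a
    have E0: "0 \<le> E x" for x by (simp add: E_def)
    define G where "G x = m * w x powr (m - 1) * (C * E x)" for x
    have [measurable]: "G \<in> borel_measurable borel" unfolding G_def E_def by measurable
    have Eb: "E x \<le> R powr (- 2 * s) + e powr (- 2 * s)" if "w x \<noteq> 0" for x
    proof -
      have "(norm x / e) powr - (real DIM('a) + 2 * s) \<le> 1 powr - (real DIM('a) + 2 * s)"
        using wp[OF that] e s by (intro powr_mono2') auto
      hence "e powr (- 2 * s) * (norm x / e) powr - (real DIM('a) + 2 * s) \<le> e powr (- 2 * s) * 1"
        by (intro mult_left_mono) auto
      thus ?thesis by (simp add: E_def)
    qed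
    have G0: "0 \<le> G x" for x unfolding G_def using m1 C E0[of x] by simp
    have Gb: "\<bar>G x\<bar> \<le> m * (C * (R powr (- 2 * s) + e powr (- 2 * s)))" if "w x powr m \<noteq> 0" for x
    proof -
      have x: "w x \<noteq> 0" using that by auto
      have "w x powr (m - 1) \<le> 1" using w[of x] m1 powr_mono2[of "m - 1" "w x" 1] by simp
      hence "G x \<le> m * 1 * (C * (R powr (- 2 * s) + e powr (- 2 * s)))"
        unfolding G_def using m1 C(1) Eb[OF x] E0[of x] by (intro mult_mono) auto
      thus ?thesis using G0[of x] by simp
    qed
    have Gf: "flap s t (\<lambda>x. w x powr m) x \<le> G x" if t: "0 < t" and x: "w x powr m \<noteq> 0" for t x
    proof -
      have x: "w x \<noteq> 0" using x by auto
      have "flap s t (\<lambda>y. w y powr m) x \<le> m * w x powr (m - 1) * flap s t w x"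
        by (rule flap_powr_le[where w = w and x = x]) (use s t w x m1 in auto)
      also have "\<dots> \<le> m * w x powr (m - 1) * (C * E x)"
        using C(2)[OF t R0 e(1), of x] x m1 by (intro mult_left_mono) (auto simp: w_def E_def)
      finally show ?thesis by (simp add: G_def)
    qed
    have wm: "0 \<le> w x powr m" "w x powr m \<le> 1" "w x powr m \<noteq> 0 \<Longrightarrow> e \<le> norm x \<and> norm x \<le> R" for x
      using w[of x] wp[of x] m1 powr_mono2[of m "w x" 1] by auto
    have mw: "(\<lambda>x. w x powr m) \<in> borel_measurable borel" and mG: "G \<in> borel_measurable borel" by measurable
    note T = source_test[where \<psi> = "\<lambda>x. w x powr m" and G = G
        and B = "m * (C * (R powr (- 2 * s) + e powr (- 2 * s)))" and e = e and R = R, OF e(1) R mw mG]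
    have T1: "integrable lborel (\<lambda>x. w x powr m * source x)"
      by (rule T(1)) (use wm Gf Gb in blast)+
    have T2: "integrable lborel (\<lambda>x. if w x powr m \<noteq> 0 then v x * G x else 0)"
      by (rule T(2)) (use wm Gf Gb in blast)+
    have T3: "(\<integral>x. w x powr m * source x \<partial>lborel) \<le> c * (\<integral>x. (if w x powr m \<noteq> 0 then v x * G x else 0) \<partial>lborel)"
      by (rule T(3)) (use wm Gf Gb in blast)+
    \<comment> \<open>The support of w lies between the radii e and R. Each power is kept on the
      larger set on which it is integrable, so both integrals are given by scaling alone.\<close>
    define J where "J x = R powr (- 2 * s * m) * (if norm x \<le> R then norm x powr (- a) else 0)
      + e powr (- 2 * s * m + (real DIM('a) + 2 * s) * m) * (if e \<le> norm x then norm x powr b else 0)" for x :: 'a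
    have Ji: "integrable lborel J" unfolding J_def
      by (intro Bochner_Integration.integrable_add integrable_mult_right norm_powr_inside_scaled(1)[OF a1 R0] norm_powr_outside_scaled(1)[OF b1 e(1)])
    have Jn: "0 \<le> J x" for x by (simp add: J_def)
    have "(\<integral>x. J x \<partial>lborel) = R powr (- 2 * s * m) * (R powr (real DIM('a) + - a) * I1)
        + e powr (- 2 * s * m + (real DIM('a) + 2 * s) * m) * (e powr (real DIM('a) + b) * I2)"
      unfolding J_def I1_def I2_def norm_powr_inside_scaled(2)[OF a1 R0, symmetric] norm_powr_outside_scaled(2)[OF b1 e(1), symmetric]
      using norm_powr_inside_scaled(1)[OF a1 R0] norm_powr_outside_scaled(1)[OF b1 e(1)]
      by (simp only: Bochner_Integration.integral_add integrable_mult_right integral_mult_right_zero)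
    also have "\<dots> = R powr \<gamma> * I1 + e powr \<gamma> * I2"
    proof -
      have "R powr (- 2 * s * m) * R powr (real DIM('a) + - a) = R powr \<gamma>"
        by (simp only: powr_add[symmetric] \<gamma>_eq) (simp add: algebra_simps)
      moreover have "e powr (- 2 * s * m + (real DIM('a) + 2 * s) * m) * e powr (real DIM('a) + b) = e powr \<gamma>"
        by (simp only: powr_add[symmetric] \<gamma>_eq b_def) (simp add: algebra_simps)
      ultimately show ?thesis by (simp only: mult.assoc[symmetric])
    qed
    \<comment> \<open>From here on e has disappeared from the bound, thanks to e < R and \<gamma> >=
      0.\<close>
    also have "\<dots> \<le> R powr \<gamma> * I1 + R powr \<gamma> * I2"
      using e \<gamma>0 I by (intro add_left_mono mult_right_mono powr_mono2) auto
    finally have J_le: "(\<integral>x. J x \<partial>lborel) \<le> R powr \<gamma> * (I1 + I2)" by (simp add: algebra_simps)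
    have young: "c * (if w x powr m \<noteq> 0 then v x * G x else 0) \<le> (w x powr m * source x) / p + D * J x / m" for x
    proof (cases "w x = 0")
      case True
      thus ?thesis using Jn[of x] m1 by (simp add: D_def)
    next
      case False
      note x = wp[OF False]
      have x0: "0 < norm x" using x e by linarith
      have w0: "0 < w x" using w[of x] False by simp
      \<comment> \<open>The split is forced: as (m - 1) p = m, \<open>\<alpha> powr p\<close> is
        exactly the tested energy density, and \<beta> contains no v.\<close>
      define \<alpha> where "\<alpha> = norm x powr (\<theta> / p) * v x * w x powr (m - 1)"
      define \<beta> where "\<beta> = c * m * C * E x * norm x powr (- \<theta> / p)"
      have "\<alpha> * \<beta> \<le> \<alpha> powr p / p + \<beta> powr m / m"
        by (rule Youngs_inequality) (use p1 m1 m v_nonneg c C E0 in \<open>auto simp: \<alpha>_def \<beta>_def\<close>)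
      moreover have "\<alpha> * \<beta> = c * (v x * G x)"
      proof -
        have "norm x powr (\<theta> / p) * norm x powr (- \<theta> / p) = 1" using x0 by (simp flip: powr_add)
        hence "\<alpha> * \<beta> = v x * w x powr (m - 1) * (c * m * C * E x)" unfolding \<alpha>_def \<beta>_def by (simp add: mult_ac)
        thus ?thesis by (simp add: G_def mult_ac)
      qed
      moreover have "\<alpha> powr p = w x powr m * source x"
      proof -
        have "(m - 1) * p = m" using m p1 by (simp add: field_simps)
        thus ?thesis using p1 v_nonneg[of x] by (simp add: \<alpha>_def powr_mult powr_powr source_def mult_ac)
      qed
      moreover have "\<beta> powr m \<le> D * J x"
      proof -
        have am: "- \<theta> / p * m = - a" using p1 by (simp add: a_def m_def field_simps)
        have "\<beta> powr m = (c * m * C * E x) powr m * norm x powr (- a)"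
          unfolding \<beta>_def using c m1 C E0[of x] by (simp add: powr_mult powr_powr am[symmetric])
        also have "(c * m * C * E x) powr m \<le> D * (R powr (- 2 * s * m) + e powr (- 2 * s * m) * (norm x / e) powr (- (real DIM('a) + 2 * s) * m))"
        proof -
          define A1 where "A1 = R powr (- 2 * s)"
          define A2 where "A2 = e powr (- 2 * s) * (norm x / e) powr - (real DIM('a) + 2 * s)"
          have A: "0 \<le> A1" "0 \<le> A2" by (simp_all add: A1_def A2_def)
          have "(A1 + A2) powr m \<le> (2 * max A1 A2) powr m" using A m1 by (intro powr_mono2) auto
          also have "\<dots> = 2 powr m * max A1 A2 powr m" using A by (simp add: powr_mult)
          also have "\<dots> \<le> 2 powr m * (A1 powr m + A2 powr m)"
            by (intro mult_left_mono) (auto simp: max_def)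
          finally have AA: "(A1 + A2) powr m \<le> 2 powr m * (A1 powr m + A2 powr m)" .
          have "(c * m * C * E x) powr m = (c * m * C) powr m * (A1 + A2) powr m"
            using c m1 C A by (simp add: E_def A1_def A2_def powr_mult)
          also have "\<dots> \<le> (c * m * C) powr m * (2 powr m * (A1 powr m + A2 powr m))"
            using AA by (intro mult_left_mono) auto
          also have "\<dots> = D * (A1 powr m + A2 powr m)"
            unfolding D_def using c m1 C by (simp add: powr_mult mult_ac)
          also have "A1 powr m = R powr (- 2 * s * m)" by (simp add: A1_def powr_powr)
          also have "A2 powr m = e powr (- 2 * s * m) * (norm x / e) powr (- (real DIM('a) + 2 * s) * m)"
            using e x0 by (simp add: A2_def powr_mult powr_powr)
          finally show ?thesis .
        qed
        also have "D * (R powr (- 2 * s * m) + e powr (- 2 * s * m) * (norm x / e) powr (- (real DIM('a) + 2 * s) * m)) * norm x powr (- a) = D * J x"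
        proof -
          have "(norm x / e) powr (- (real DIM('a) + 2 * s) * m) = norm x powr (- (real DIM('a) + 2 * s) * m) * e powr ((real DIM('a) + 2 * s) * m)"
          proof -
            have "(norm x / e) powr - k = norm x powr - k * e powr k" for k
            proof -
              have "(norm x / e) powr - k = norm x powr - k / e powr - k" using e by (simp add: powr_divide)
              thus ?thesis by (simp only: powr_minus divide_inverse inverse_inverse_eq)
            qed
            from this[of "(real DIM('a) + 2 * s) * m"] show ?thesis by (simp only: minus_mult_left)
          qed
          moreover have "norm x powr b = norm x powr (- (real DIM('a) + 2 * s) * m) * norm x powr (- a)"
            by (simp only: powr_add[symmetric] b_def minus_mult_left diff_conv_add_uminus)
          moreover have "J x = R powr (- 2 * s * m) * norm x powr (- a)
              + e powr (- 2 * s * m) * e powr ((real DIM('a) + 2 * s) * m) * norm x powr b"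
            unfolding J_def powr_add[of e "- 2 * s * m"] using x e by simp
          ultimately show ?thesis by (simp only: distrib_left distrib_right mult_ac)
        qed
        finally show ?thesis by (simp add: mult_right_mono)
      qed
      ultimately have "c * (v x * G x) \<le> (w x powr m * source x) / p + D * J x / m"
        using m1 by (smt (verit) divide_right_mono)
      thus ?thesis using False by simp
    qed
    \<comment> \<open>By \<open>T1\<close> this is a genuine integral, so that A / p can be absorbed
      into A.\<close>
    define A where "A = (\<integral>x. w x powr m * source x \<partial>lborel)"
    have "A \<le> (\<integral>x. c * (if w x powr m \<noteq> 0 then v x * G x else 0) \<partial>lborel)"
      using T3 by (simp add: A_def)
    also have "\<dots> \<le> (\<integral>x. (w x powr m * source x) / p + D * J x / m \<partial>lborel)"
      by (rule Bochner_Integration.integral_mono[OF integrable_mult_right[OF T2] _ young]) (use T1 Ji in auto)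
    also have "\<dots> = A / p + D * (\<integral>x. J x \<partial>lborel) / m"
      using T1 Ji by (simp add: A_def)
    also have "\<dots> \<le> A / p + D * (R powr \<gamma> * (I1 + I2)) / m"
      using J_le m1 by (intro add_left_mono divide_right_mono mult_left_mono) (auto simp: D_def)
    finally have "A - A / p \<le> D * (R powr \<gamma> * (I1 + I2)) / m" by simp
    moreover have "A - A / p = A / m"
    proof -
      have "A * (1 / p + 1 / m) = A" using m by simp
      thus ?thesis by (simp add: distrib_left)
    qed
    ultimately have "A \<le> D * (R powr \<gamma> * (I1 + I2))" using m1 by (simp add: divide_le_cancel)
    also have "\<dots> \<le> (D * (I1 + I2) + 1) * R powr \<gamma>" by (simp add: algebra_simps)
    finally show "integrable lborel (\<lambda>x. cutoff s R e x powr m * source x) \<and>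
      (\<integral>x. cutoff s R e x powr m * source x \<partial>lborel) \<le> (D * (I1 + I2) + 1) * R powr \<gamma>"
      using T1 by (simp add: A_def w_def)
  qed
qed

section \<open>Classical solutions\<close>

lemma frac_laplacian_const_pos:
  assumes "0 < s" "s < 1"
  shows "0 < frac_laplacian_const N s"
  using assms
  by (auto simp: frac_laplacian_const_def Gamma_real_pos_exp intro!: mult_pos_pos divide_pos_pos)

text \<open>Up to sign the second difference is g (x + z) - g x with g y = u y - u (y - z). The mean
  value inequality for D bounds the derivative of g by M |z|, and applied to g it gives M |z|^2.
  Both applications take place in balls around x, since the annulus is not convex.\<close>

lemma C2_on_second_difference:
  fixes u :: "real ^ 'n \<Rightarrow> real"
  assumes u: "C2_on (ball 0 1 - {0}) u" and e: "0 < e" and R: "R < 1"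
  obtains \<delta> M B where "0 < \<delta>" "\<delta> \<le> 1" "\<delta> \<le> e / 2" "\<delta> \<le> (1 - R) / 2"
    "\<And>x. e \<le> norm x \<Longrightarrow> norm x \<le> R \<Longrightarrow> \<bar>u x\<bar> \<le> B"
    "\<And>x z. e \<le> norm x \<Longrightarrow> norm x \<le> R \<Longrightarrow> norm z < \<delta> \<Longrightarrow> \<bar>2 * u x - u (x + z) - u (x - z)\<bar> \<le> M * (norm z)\<^sup>2"
proof -
  let ?S = "ball 0 1 - {0 :: real ^ 'n}"
  obtain D :: "real ^ 'n \<Rightarrow> (real ^ 'n) \<Rightarrow>\<^sub>L real" and H :: "real ^ 'n \<Rightarrow> (real ^ 'n) \<Rightarrow>\<^sub>L (real ^ 'n) \<Rightarrow>\<^sub>L real"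
    where D: "\<And>x. x \<in> ?S \<Longrightarrow> (u has_derivative blinfun_apply (D x)) (at x)"
      and H: "\<And>x. x \<in> ?S \<Longrightarrow> (D has_derivative blinfun_apply (H x)) (at x)"
      and Hc: "continuous_on ?S H"
    using u unfolding C2_on_def by blast
  define K where "K = {x :: real ^ 'n. e / 2 \<le> norm x \<and> norm x \<le> (1 + R) / 2}"
  have K: "compact K"
  proof -
    have "closed K" unfolding K_def by (intro closed_Collect_conj closed_Collect_le continuous_intros)
    moreover have "bounded K" unfolding K_def by (rule boundedI[of _ "(1 + R) / 2"]) simp
    ultimately show ?thesis by (simp add: compact_eq_bounded_closed)
  qed
  have KS: "K \<subseteq> ?S" using e R by (auto simp: K_def)
  have "compact (H ` K)" by (rule compact_continuous_image[OF continuous_on_subset[OF Hc KS] K])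
  then obtain M where M: "\<And>x. x \<in> K \<Longrightarrow> norm (H x) \<le> M"
    using compact_imp_bounded[of "H ` K"] unfolding bounded_iff by auto
  have "continuous_on ?S u"
    by (intro continuous_at_imp_continuous_on ballI has_derivative_continuous[OF D])
  hence "compact (u ` K)" by (intro compact_continuous_image[OF _ K] continuous_on_subset[OF _ KS])
  then obtain B where B: "\<And>x. x \<in> K \<Longrightarrow> \<bar>u x\<bar> \<le> B"
    using compact_imp_bounded[of "u ` K"] unfolding bounded_iff by auto
  \<comment> \<open>A quarter of each margin: for y within \<delta> of x both y and y - z lie within
    2 \<delta> of x, hence in \<open>K\<close>, which exhausts half the margin.\<close>
  define \<delta> where "\<delta> = min (e / 4) ((1 - R) / 4)"
  define \<delta>' where "\<delta>' = min 1 \<delta>"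
  have "0 < \<delta>" using e R by (simp add: \<delta>_def)
  moreover have "\<delta> \<le> e / 4" "\<delta> \<le> (1 - R) / 4" unfolding \<delta>_def by (rule min.cobounded1 min.cobounded2)+
  ultimately have dl: "0 < \<delta>" "\<delta> \<le> e / 4" "\<delta> \<le> (1 - R) / 4" by blast+
  hence dle: "0 < \<delta>'" "\<delta>' \<le> 1" "\<delta>' \<le> e / 4" "\<delta>' \<le> (1 - R) / 4" unfolding \<delta>'_def by linarith+
  show thesis
  proof (rule that[of \<delta>' B M])
    show "0 < \<delta>'" "\<delta>' \<le> 1" "\<delta>' \<le> e / 2" "\<delta>' \<le> (1 - R) / 2" using e R dle by auto
    fix x :: "real ^ 'n" assume x: "e \<le> norm x" "norm x \<le> R"
    show "\<bar>u x\<bar> \<le> B" by (rule B) (use x e R in \<open>auto simp: K_def\<close>)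
    have bK: "ball x (2 * \<delta>) \<subseteq> K"
    proof
      fix y assume "y \<in> ball x (2 * \<delta>)"
      hence "norm (y - x) < 2 * \<delta>" by (simp add: dist_norm norm_minus_commute)
      hence "norm (y - x) < e / 2" "norm (y - x) < (1 - R) / 2" using dl by linarith+
      moreover have "norm x \<le> norm y + norm (y - x)" "norm y \<le> norm x + norm (y - x)"
        using norm_triangle_ineq[of "y - x" x] norm_triangle_ineq4[of y "y - x"] by auto
      ultimately show "y \<in> K" using x by (auto simp: K_def)
    qed
    fix z :: "real ^ 'n" assume "norm z < \<delta>'"
    hence z: "norm z < \<delta>" by (simp add: \<delta>'_def)
    have onorm_eq: "onorm (blinfun_apply f) = norm f" for f :: "(real ^ 'n) \<Rightarrow>\<^sub>L 'b::real_normed_vector"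
      by (simp add: norm_blinfun.rep_eq)
    have lip: "norm (D y - D (y - z)) \<le> M * norm z" if "y \<in> ball x \<delta>" for y
    proof -
      have "dist x (y - z) \<le> dist x y + norm z"
        using norm_triangle_ineq[of "x - y" z] by (simp add: dist_norm algebra_simps)
      hence yz: "y \<in> ball x (2 * \<delta>)" "y - z \<in> ball x (2 * \<delta>)" using that z dl(1) by auto
      have "norm (D y - D (y - z)) \<le> M * norm (y - (y - z))"
      proof (rule differentiable_bound[OF convex_ball[of x "2 * \<delta>"] _ _ yz])
        fix w assume w: "w \<in> ball x (2 * \<delta>)"
        show "(D has_derivative blinfun_apply (H w)) (at w within ball x (2 * \<delta>))"
          by (rule has_derivative_at_withinI[OF H]) (use w bK KS in blast)
        show "onorm (blinfun_apply (H w)) \<le> M" using M[of w] w bK by (auto simp: onorm_eq)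
      qed
      thus ?thesis by simp
    qed
    define g where "g y = u y - u (y - z)" for y
    have "norm (g (x + z) - g x) \<le> (M * norm z) * norm (x + z - x)"
    proof (rule differentiable_bound[OF convex_ball[of x \<delta>]])
      show "x + z \<in> ball x \<delta>" "x \<in> ball x \<delta>" using z by (auto simp: dist_norm intro: le_less_trans[OF norm_ge_zero])
      fix y assume y: "y \<in> ball x \<delta>"
      have "dist x (y - z) \<le> dist x y + norm z"
        using norm_triangle_ineq[of "x - y" z] by (simp add: dist_norm algebra_simps)
      hence yz: "y \<in> ball x (2 * \<delta>)" "y - z \<in> ball x (2 * \<delta>)" using y z dl(1) by auto
      have d1: "(u has_derivative blinfun_apply (D y)) (at y)" by (rule D) (use yz bK KS in blast)
      have d2: "(u has_derivative blinfun_apply (D (y - z))) (at (y - z))" by (rule D) (use yz bK KS in blast)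
      have "((\<lambda>y. y - z) has_derivative (\<lambda>h. h)) (at y)" by (auto intro!: derivative_eq_intros)
      from has_derivative_compose[OF this d2]
      have "((\<lambda>y. u (y - z)) has_derivative blinfun_apply (D (y - z))) (at y)" by simp
      from has_derivative_diff[OF d1 this]
      have "(g has_derivative blinfun_apply (D y - D (y - z))) (at y)"
        by (simp add: g_def[abs_def] minus_blinfun.rep_eq)
      thus "(g has_derivative blinfun_apply (D y - D (y - z))) (at y within ball x \<delta>)"
        by (rule has_derivative_at_withinI)
      show "onorm (blinfun_apply (D y - D (y - z))) \<le> M * norm z"
        using lip[OF y] by (simp add: onorm_eq)
    qed
    thus "\<bar>2 * u x - u (x + z) - u (x - z)\<bar> \<le> M * (norm z)\<^sup>2"
      by (simp add: g_def power2_eq_square mult.assoc algebra_simps abs_minus_commute)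
  qed
qed

lemma AE_lborel_translate:
  fixes x :: "'a::euclidean_space"
  assumes "AE y in lborel. P y"
  shows "AE z in lborel. P (x + z)"
proof -
  obtain N where N: "\<And>y. y \<notin> N \<Longrightarrow> P y" "N \<in> null_sets lborel"
    using AE_E3[OF assms] by auto
  have "{z. z - (- x) \<in> N} \<in> null_sets lborel" by (rule null_sets_translation[OF N(2)])
  thus ?thesis by (rule AE_I') (use N(1) in \<open>auto simp: add.commute\<close>)
qed

text \<open>A solution is only Lebesgue measurable, whereas the Fubini arguments need Borel functions.\<close>

lemma classical_solution_borel_version:
  fixes u :: "real ^ 'n \<Rightarrow> real"
  assumes s: "0 < s" "s < 1" and sol: "classical_solution s \<theta> p h u" and u0: "\<And>x. x \<noteq> 0 \<Longrightarrow> 0 \<le> u x"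
  obtains v where "punctured_ball_solution s v \<theta> p (frac_laplacian_const CARD('n) s)"
    "\<And>x. x \<in> ball 0 1 - {0} \<Longrightarrow> v x = u x"
proof -
  let ?S = "ball 0 1 - {0 :: real ^ 'n}"
  let ?e = "real CARD('n) + 2 * s"
  let ?c = "frac_laplacian_const CARD('n) s"
  have L1: "integrable lebesgue (\<lambda>x. u x / (1 + norm x) powr ?e)"
    and C2: "C2_on ?S u"
    and eqn: "\<And>x. x \<in> ?S \<Longrightarrow> has_frac_laplacian s u x (norm x powr \<theta> * u x powr p)"
    using sol by (auto simp: classical_solution_def in_L1s_def)
  have n1: "0 < 1 + norm (x :: real ^ 'n)" for x by (simp add: add_pos_nonneg)
  have "(\<lambda>x :: real ^ 'n. (1 + norm x) powr ?e) \<in> borel_measurable lebesgue"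
    by (intro measurable_completion) measurable
  hence "(\<lambda>x. u x / (1 + norm x) powr ?e * (1 + norm x) powr ?e) \<in> borel_measurable lebesgue"
    using borel_measurable_integrable[OF L1] by (intro borel_measurable_times)
  hence um: "u \<in> borel_measurable lebesgue" using n1 by (simp add: less_imp_neq[symmetric])
  then obtain g where g: "g \<in> borel_measurable lborel" "AE x in lborel. u x = g x"
    using completion_ex_borel_measurable_real by blast
  have gm [measurable]: "g \<in> borel_measurable borel" using g(1) by simp
  \<comment> \<open>On the punctured ball v has to be u itself, because the equation and the second
    differences are pointwise statements. Elsewhere a Borel representative suffices; taking its
    positive part makes v nonnegative everywhere and alters it only on a null set.\<close>
  define v where "v x = (if x \<in> ?S then u x else max 0 (g x))" for x
  have vS: "v x = u x" if "x \<in> ?S" for x using that by (simp add: v_def)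
  have v0: "0 \<le> v x" for x using u0[of x] by (auto simp: v_def)
  have Sb [measurable]: "?S \<in> sets borel" by measurable
  obtain D :: "real ^ 'n \<Rightarrow> (real ^ 'n) \<Rightarrow>\<^sub>L real" where D: "\<And>x. x \<in> ?S \<Longrightarrow> (u has_derivative blinfun_apply (D x)) (at x)"
    using C2 unfolding C2_on_def by blast
  have "continuous_on ?S u"
    by (intro continuous_at_imp_continuous_on ballI has_derivative_continuous[OF D])
  hence "(\<lambda>x. indicator ?S x *\<^sub>R u x) \<in> borel_measurable borel"
    by (rule borel_measurable_continuous_on_indicator[OF Sb])
  hence "(\<lambda>x. if x \<in> ?S then indicator ?S x *\<^sub>R u x else max 0 (g x)) \<in> borel_measurable borel"
    by (intro measurable_If_set) auto
  hence vm [measurable]: "v \<in> borel_measurable borel"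
    by (rule measurable_cong[THEN iffD1, rotated]) (auto simp: v_def)
  have "AE x in lborel. x \<noteq> (0 :: real ^ 'n)" by (rule AE_lborel_singleton)
  with g(2) have ae: "AE x in lborel. v x = u x"
    by eventually_elim (use u0 in \<open>auto simp: v_def max_def\<close>, force)
  have c: "0 < ?c"
    using s by (rule frac_laplacian_const_pos)
  have weighted: "integrable lborel (\<lambda>x. v x * (1 + norm x) powr - (real DIM(real ^ 'n) + 2 * s))"
  proof -
    have "integrable lebesgue (\<lambda>x. v x * (1 + norm x) powr - ?e)"
    proof (rule integrable_cong_AE_imp[OF L1])
      show "(\<lambda>x. v x * (1 + norm x) powr - ?e) \<in> borel_measurable lebesgue"
        by (intro measurable_completion) measurable
      show "AE x in lebesgue. u x / (1 + norm x) powr ?e = v x * (1 + norm x) powr - ?e"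
        using AE_completion[OF ae] by eventually_elim (simp only: powr_minus divide_inverse)
    qed
    thus ?thesis by (subst (asm) integrable_completion) auto
  qed
  have tk: "tkern s t z = (if t \<le> norm z then inverse (norm z powr ?e) else 0)" for t and z :: "real ^ 'n"
    unfolding tkern_def powr_minus by simp
  have flap_eq: "(LINT z : - ball 0 t | lebesgue. (u x - u (x + z)) / norm z powr ?e) = flap s t v x"
    if x: "x \<in> ?S" for t x
  proof -
    have "(LINT z : - ball 0 t | lebesgue. (u x - u (x + z)) / norm z powr ?e)
      = (\<integral>z. (v x - v (x + z)) * tkern s t z \<partial>lebesgue)"
      unfolding set_lebesgue_integral_def
    proof (rule integral_cong_AE)
      have "AE z in lborel. v (x + z) = u (x + z)" by (rule AE_lborel_translate[OF ae])
      from AE_completion[OF this]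
      show *: "AE z in lebesgue. indicat_real (- ball 0 t) z *\<^sub>R ((u x - u (x + z)) / norm z powr ?e) = (v x - v (x + z)) * tkern s t z"
        by eventually_elim (auto simp: vS[OF x] tk indicator_def divide_inverse)
      show m: "(\<lambda>z. (v x - v (x + z)) * tkern s t z) \<in> borel_measurable lebesgue"
        by (intro measurable_completion) measurable
      show "(\<lambda>z. indicat_real (- ball 0 t) z *\<^sub>R ((u x - u (x + z)) / norm z powr ?e)) \<in> borel_measurable lebesgue"
        by (rule borel_measurable_AE[OF m]) (use * in eventually_elim, simp)
    qed
    also have "\<dots> = flap s t v x"
      unfolding flap_def by (rule integral_completion) measurable
    finally show ?thesis .
  qed
  have "punctured_ball_solution s v \<theta> p ?c"
  proof
    show "0 < s" "s < 1" "0 < ?c" "v \<in> borel_measurable borel" by (fact s c vm)+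
    show "0 \<le> v x" for x by (rule v0)
    show "integrable lborel (\<lambda>x. v x * (1 + norm x) powr - (real DIM(real ^ 'n) + 2 * s))" by (rule weighted)
  next
    fix e R :: real assume e: "0 < e" and R: "R < 1"
    obtain \<delta> M B where d: "0 < \<delta>" "\<delta> \<le> 1" "\<delta> \<le> e / 2" "\<delta> \<le> (1 - R) / 2"
      and B: "\<And>x. e \<le> norm x \<Longrightarrow> norm x \<le> R \<Longrightarrow> \<bar>u x\<bar> \<le> B"
      and M: "\<And>x z. e \<le> norm x \<Longrightarrow> norm x \<le> R \<Longrightarrow> norm z < \<delta> \<Longrightarrow> \<bar>2 * u x - u (x + z) - u (x - z)\<bar> \<le> M * (norm z)\<^sup>2"
      by (rule C2_on_second_difference[OF C2 e R], rule that)
    \<comment> \<open>By the choice of \<delta> the points x, x + z and x - z all stay in this open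
      annulus.\<close>
    have vu: "v x = u x" if "e / 2 < norm x" "norm x < (1 + R) / 2" for x
      by (rule vS) (use that e R in auto)
    have "\<bar>v x\<bar> \<le> B \<and> (\<forall>z. norm z < \<delta> \<longrightarrow> \<bar>2 * v x - v (x + z) - v (x - z)\<bar> \<le> M * (norm z)\<^sup>2)"
      if x: "e \<le> norm x" "norm x \<le> R" for x
    proof (intro conjI allI impI)
      have vx: "v x = u x" by (rule vu) (use x e R in auto)
      show "\<bar>v x\<bar> \<le> B" unfolding vx by (rule B[OF x])
      fix z :: "real ^ 'n" assume z: "norm z < \<delta>"
      have "norm x \<le> norm (x + z) + norm z" "norm x \<le> norm (x - z) + norm z"
        "norm (x + z) \<le> norm x + norm z" "norm (x - z) \<le> norm x + norm z"
        using norm_triangle_ineq4[of "x + z" z] norm_triangle_ineq[of "x - z" z]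
          norm_triangle_ineq[of x z] norm_triangle_ineq4[of x z] by simp_all
      hence "v (x + z) = u (x + z)" "v (x - z) = u (x - z)" using x z d by (auto intro!: vu)
      thus "\<bar>2 * v x - v (x + z) - v (x - z)\<bar> \<le> M * (norm z)\<^sup>2" using M[OF x z] vx by simp
    qed
    thus "\<exists>\<delta> M B. 0 < \<delta> \<and> \<delta> \<le> 1 \<and> (\<forall>x. e \<le> norm x \<and> norm x \<le> R \<longrightarrow> \<bar>v x\<bar> \<le> B \<and>
        (\<forall>z. norm z < \<delta> \<longrightarrow> \<bar>2 * v x - v (x + z) - v (x - z)\<bar> \<le> M * (norm z)\<^sup>2))"
      using d by blast
  next
    fix x :: "real ^ 'n" assume x: "0 < norm x" "norm x < 1"
    hence xS: "x \<in> ?S" by auto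
    from eqn[OF xS] have "((\<lambda>t. ?c * flap s t v x) \<longlongrightarrow> norm x powr \<theta> * v x powr p) (at_right 0)"
      unfolding has_frac_laplacian_def flap_eq[OF xS] vS[OF xS] .
    from tendsto_divide[OF this tendsto_const[of ?c]] c
    show "((\<lambda>t. flap s t v x) \<longlongrightarrow> norm x powr \<theta> * v x powr p / ?c) (at_right 0)" by simp
  qed
  thus thesis using vS by (rule that)
qed

section \<open>Conclusion: local mass bound and weighted integrability\<close>

lemma integrable_borel_lebesgue:
  fixes f g :: "'a::euclidean_space \<Rightarrow> real"
  assumes "integrable lborel f" "\<And>x. g x = f x"
  shows "integrable lebesgue g" "integral\<^sup>L lebesgue g = integral\<^sup>L lborel f"
proof -
  have "g = f" using assms(2) by auto
  thus "integrable lebesgue g" "integral\<^sup>L lebesgue g = integral\<^sup>L lborel f"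
    using assms(1) integrable_completion[of f lborel] integral_completion[of f lborel] by auto
qed

theorem proposition1p1:
  fixes s \<theta> p :: real
  assumes "0 < s" and "s < 1"
    and "real CARD('n::finite) > 2 * s"
    and "\<theta> > - 2 * s"
    and "p \<ge> (real CARD('n) + \<theta>) / (real CARD('n) - 2 * s)"
  shows "\<exists>c5>0. \<forall>(h :: real ^ 'n \<Rightarrow> real) (u0 :: real ^ 'n \<Rightarrow> real).
      (\<forall>x \<in> - ball 0 1. h x \<ge> 0) \<longrightarrow>
      classical_solution s \<theta> p h u0 \<longrightarrow>
      (\<forall>x. x \<noteq> 0 \<longrightarrow> u0 x \<ge> 0) \<longrightarrow>
      set_integrable lebesgue (ball 0 1)
        (\<lambda>x. norm x powr \<theta> * u0 x powr p * (1 - norm x) powr s) \<and>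
      (\<forall>r \<in> {0<..<1/2}.
        (LINT x : ball 0 r | lebesgue. norm x powr \<theta> * u0 x powr p)
          \<le> c5 * r powr (real CARD('n) - (\<theta> + 2 * s * p) / (p - 1)))"
proof -
  define c where "c = frac_laplacian_const CARD('n) s"
  have c: "0 < c"
    unfolding c_def using assms(1,2) by (rule frac_laplacian_const_pos)
  define m where "m = p / (p - 1)"
  define \<gamma> where "\<gamma> = real CARD('n) - (\<theta> + 2 * s * p) / (p - 1)"
  obtain C where C: "0 < C"
    "\<And>(v :: real ^ 'n \<Rightarrow> real) R e. punctured_ball_solution s v \<theta> p c \<Longrightarrow> 0 < e \<Longrightarrow> e < R \<Longrightarrow> R < 1 \<Longrightarrow>
      integrable lborel (\<lambda>x. cutoff s R e x powr m * punctured_ball_solution.source v \<theta> p x) \<and>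
      (\<integral>x. cutoff s R e x powr m * punctured_ball_solution.source v \<theta> p x \<partial>lborel) \<le> C * R powr \<gamma>"
    using source_energy_bound[where 'a = "real ^ 'n", OF assms(1,2) _ assms(4) _ c, of p] assms
    unfolding m_def \<gamma>_def by auto
  have m0: "0 < m"
  proof -
    have "1 < (real CARD('n) + \<theta>) / (real CARD('n) - 2 * s)" using assms by (simp add: field_simps)
    hence "1 < p" using assms(5) by linarith
    thus ?thesis by (simp add: m_def)
  qed
  \<comment> \<open>With R = 3 r / 2, points of the ball of radius r satisfy |x / R| <= 2/3, and 1 -
    4/9 = 5/9 bounds the torsion function from below.\<close>
  define k where "k = ((5/9) powr s) powr m"
  have k: "0 < k" by (simp add: k_def)
  have main: "set_integrable lebesgue (ball 0 1) (\<lambda>x. norm x powr \<theta> * u x powr p * (1 - norm x) powr s) \<and>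
      (\<forall>r \<in> {0<..<1/2}. (LINT x : ball 0 r | lebesgue. norm x powr \<theta> * u x powr p)
          \<le> C * (3/2) powr \<gamma> / k * r powr \<gamma>)"
    if sol: "classical_solution s \<theta> p h u" and u0: "\<And>x. x \<noteq> 0 \<Longrightarrow> 0 \<le> u x"
    for h u :: "real ^ 'n \<Rightarrow> real"
  proof -
    obtain v where v: "punctured_ball_solution s v \<theta> p c" "\<And>x. x \<in> ball 0 1 - {0} \<Longrightarrow> v x = u x"
      using classical_solution_borel_version[OF assms(1,2) sol u0] unfolding c_def by blast
    interpret punctured_ball_solution s v \<theta> p c by (rule v(1))
    \<comment> \<open>At the origin both sides are 0, since \<open>0 powr \<theta> = 0\<close>; the
      unconstrained value of u there is invisible.\<close>
    have src: "source x = norm x powr \<theta> * u x powr p" if "norm x < 1" for x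
      using v(2)[of x] that by (cases "x = 0") (auto simp: source_def)
    have [measurable]: "source \<in> borel_measurable borel" by (rule borel_measurable_source)
    have local_bound: "integrable lborel (\<lambda>x. indicator (ball 0 r) x * source x)"
      "(\<integral>x. indicator (ball 0 r) x * source x \<partial>lborel) \<le> C * (3/2) powr \<gamma> / k * r powr \<gamma>"
      if r: "0 < r" "r < 1/2" for r
    proof -
      \<comment> \<open>The factor exceeds 1, so that the torsion function stays away from 0 on the
        ball of radius r, and it keeps R below 1 for r < 1/2.\<close>
      define R where "R = 3/2 * r"
      have R: "0 < R" "R < 1" using r by (auto simp: R_def)
      define e where "e n = R * inverse (real (Suc (Suc n)))" for n
      have e: "0 < e n" "e n < R" for n
        using R mult_strict_left_mono[OF _ R(1), of "inverse (real (Suc (Suc n)))" 1]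
        by (auto simp: e_def inverse_less_1_iff)
      have e0: "e \<longlonglongrightarrow> 0" unfolding e_def
        using tendsto_mult[OF tendsto_const[of R] LIMSEQ_Suc[OF LIMSEQ_inverse_real_of_nat]] by simp
      \<comment> \<open>Every cutoff vanishes at 0, so the limit is 0 there; elsewhere it is
        attained as soon as 2 e n < |x|, where the plug is 0.\<close>
      define g where "g x = (if x = 0 then 0 else torsion s (x /\<^sub>R R) powr m * source x)" for x
      have lim: "(\<lambda>n. cutoff s R (e n) x powr m * source x) \<longlonglongrightarrow> g x" for x
      proof (cases "x = 0")
        case True
        have "cutoff s R (e n) x = 0" for n
          using cutoff_pos(1)[OF assms(1) R(1) e(1), of n x] True e(1)[of n] by force
        thus ?thesis using True by (simp add: g_def)
      next
        case False
        have "\<forall>\<^sub>F n in sequentially. e n < norm x / 2"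
          using order_tendstoD(2)[OF e0, of "norm x / 2"] False by simp
        hence "\<forall>\<^sub>F n in sequentially. cutoff s R (e n) x powr m * source x = g x"
        proof eventually_elim
          case (elim n)
          have "2 \<le> norm (x /\<^sub>R e n)" using elim e(1)[of n] by (simp add: field_simps)
          hence "plug (x /\<^sub>R e n) = 0" by (rule plug_eq_zero)
          thus ?case using False torsion_nonneg[of s "x /\<^sub>R R"] by (simp add: g_def cutoff_def)
        qed
        thus ?thesis by (rule tendsto_eventually)
      qed
      have nonneg: "0 \<le> cutoff s R (e n) x powr m * source x" for n x by (simp add: source_nonneg)
      note C' = C(2)[OF v(1) e R(2)]
      have g: "integrable lborel g" "(\<integral>x. g x \<partial>lborel) \<le> C * R powr \<gamma>"
        using integral_bound_limit[of lborel "\<lambda>n x. cutoff s R (e n) x powr m * source x" "C * R powr \<gamma>" g] C' nonneg lim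
        by blast+
      have le: "indicator (ball 0 r) x * source x \<le> g x / k" for x
      proof (cases "x \<noteq> 0 \<and> norm x < r")
        case True
        have "norm (x /\<^sub>R R) \<le> 2/3" using True r by (simp add: R_def field_simps)
        hence "(norm (x /\<^sub>R R))\<^sup>2 \<le> (2/3)\<^sup>2" by (intro power_mono) auto
        hence "5/9 \<le> max 0 (1 - (norm (x /\<^sub>R R))\<^sup>2)" by (simp add: power2_eq_square)
        hence "(5/9) powr s \<le> torsion s (x /\<^sub>R R)" unfolding torsion_def
          by (rule powr_mono2[rotated 2]) (use assms(1) in auto)
        hence "k \<le> torsion s (x /\<^sub>R R) powr m" unfolding k_def using m0 by (intro powr_mono2) auto
        hence "k * source x \<le> torsion s (x /\<^sub>R R) powr m * source x" by (rule mult_right_mono[OF _ source_nonneg])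
        thus ?thesis using True k by (simp add: g_def field_simps)
      next
        case False
        hence "indicator (ball 0 r) x * source x = 0" by (auto simp: source_def)
        moreover have "0 \<le> g x / k" using k by (simp add: g_def source_nonneg)
        ultimately show ?thesis by linarith
      qed
      show i: "integrable lborel (\<lambda>x. indicator (ball 0 r) x * source x)"
      proof (rule Bochner_Integration.integrable_bound)
        show "integrable lborel (\<lambda>x. g x / k)" using g(1) by simp
        have "norm (indicator (ball 0 r) x * source x) \<le> norm (g x / k)" for x
        proof -
          have "norm (indicator (ball 0 r) x * source x) = indicator (ball 0 r) x * source x"
            using source_nonneg[of x] by (simp add: abs_mult)
          thus ?thesis using order_trans[OF le[of x] abs_ge_self] by (simp only: real_norm_def)
        qed
        thus "AE x in lborel. norm (indicator (ball 0 r) x * source x) \<le> norm (g x / k)" by simp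
      qed (auto intro!: borel_measurable_times borel_measurable_indicator)
      have "(\<integral>x. indicator (ball 0 r) x * source x \<partial>lborel) \<le> (\<integral>x. g x / k \<partial>lborel)"
        by (rule Bochner_Integration.integral_mono[OF i _ le]) (use g(1) in simp)
      also have "\<dots> \<le> C * R powr \<gamma> / k" using g(2) k by (simp add: divide_right_mono)
      also have "R powr \<gamma> = (3/2) powr \<gamma> * r powr \<gamma>" by (subst R_def, subst powr_mult) (use r in auto)
      finally show "(\<integral>x. indicator (ball 0 r) x * source x \<partial>lborel) \<le> C * (3/2) powr \<gamma> / k * r powr \<gamma>"
        by (simp add: mult.assoc)
    qed
    have "(LINT x : ball 0 r | lebesgue. norm x powr \<theta> * u x powr p) \<le> C * (3/2) powr \<gamma> / k * r powr \<gamma>"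
      if r: "r \<in> {0<..<1/2}" for r
    proof -
      \<comment> \<open>The first local bound guarantees that this is the integral of an integrable
        function and not the default value 0.\<close>
      have "(LINT x : ball 0 r | lebesgue. norm x powr \<theta> * u x powr p) = (\<integral>x. indicator (ball 0 r) x * source x \<partial>lborel)"
        unfolding set_lebesgue_integral_def
        by (rule integrable_borel_lebesgue(2)[OF local_bound(1)]) (use r src in \<open>auto simp: indicator_def\<close>)
      thus ?thesis using local_bound(2)[of r] r by simp
    qed
    moreover have "set_integrable lebesgue (ball 0 1) (\<lambda>x. norm x powr \<theta> * u x powr p * (1 - norm x) powr s)"
    proof -
      define f where "f x = indicator (ball 0 1) x * (source x * (1 - norm x) powr s)" for x
      have [measurable]: "ball (0 :: real ^ 'n) 1 \<in> sets borel" by simp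
      have [measurable]: "f \<in> borel_measurable borel" unfolding f_def by measurable
      have "integrable lborel f"
      proof (rule Bochner_Integration.integrable_bound)
        \<comment> \<open>A plug of scale 1/8 is 0 from |x| = 1/4 on, where the cutoff is the full
          torsion function; the ball of radius 1/3 < 1/2 covers the rest.\<close>
        show "integrable lborel (\<lambda>x. cutoff s 1 (1/8) x * source x + indicator (ball 0 (1/3)) x * source x)"
          using source_weighted_integrable_aux local_bound(1)[of "1/3"] by auto
        have "f x \<le> cutoff s 1 (1/8) x * source x + indicator (ball 0 (1/3)) x * source x" for x
        proof -
          have n: "0 \<le> cutoff s 1 (1/8) x * source x" "0 \<le> indicator (ball 0 (1/3)) x * source x"
            by (intro mult_nonneg_nonneg cutoff_bounds(1)[OF assms(1)] source_nonneg indicator_pos_le)+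
          consider "norm x < 1/3" | "1/3 \<le> norm x" "norm x < 1" | "1 \<le> norm x" by linarith
          thus ?thesis
          proof cases
            case 1
            have "(1 - norm x) powr s \<le> 1 powr s" using 1 assms by (intro powr_mono2) auto
            hence "source x * (1 - norm x) powr s \<le> source x * 1" by (intro mult_left_mono source_nonneg) auto
            thus ?thesis using n 1 by (simp add: f_def)
          next
            case 2
            have "plug (x /\<^sub>R (1/8)) = 0" by (rule plug_eq_zero) (use 2 in simp)
            hence ct: "cutoff s 1 (1/8) x = torsion s x" using torsion_nonneg[of s x] by (simp add: cutoff_def)
            have "norm x * norm x \<le> 1 * norm x" using 2 by (intro mult_right_mono) auto
            hence "1 - norm x \<le> max 0 (1 - (norm x)\<^sup>2)" by (simp add: power2_eq_square)
            hence "(1 - norm x) powr s \<le> torsion s x" unfolding torsion_def using 2 assms by (intro powr_mono2) auto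
            hence "source x * (1 - norm x) powr s \<le> source x * torsion s x" by (intro mult_left_mono source_nonneg)
            thus ?thesis using n 2 by (simp add: f_def ct mult.commute)
          next
            case 3
            thus ?thesis using n by (simp add: f_def)
          qed
        qed
        moreover have "0 \<le> f x" for x by (simp add: f_def source_nonneg)
        ultimately have "norm (f x) \<le> norm (cutoff s 1 (1/8) x * source x + indicator (ball 0 (1/3)) x * source x)" for x
          by (smt (verit) real_norm_def)
        thus "AE x in lborel. norm (f x) \<le> norm (cutoff s 1 (1/8) x * source x + indicator (ball 0 (1/3)) x * source x)"
          by simp
      qed measurable
      thus ?thesis unfolding set_integrable_def
        by (rule integrable_borel_lebesgue(1)) (use src in \<open>auto simp: f_def indicator_def\<close>)
    qed
    ultimately show ?thesis by blast
  qed
  show ?thesis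
  proof (intro exI[of _ "C * (3/2) powr \<gamma> / k"] conjI allI impI)
    show "0 < C * (3/2) powr \<gamma> / k" using C(1) k by simp
  qed (use main in \<open>auto simp: \<gamma>_def\<close>)
qed

end
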